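(* Consider the composite optimization problem $\min f(x)+\theta(F(x))$ s.t. $h(x)=0$, $g(x)\in K$, with the notation of the context. Suppose that $K$ is a nonempty closed convex cone and that ${\rm D}\theta_c(\cdot)$ (for every $c>0$) and $\Pi_{K^*}(\cdot)$ are semismooth everywhere. Let $\overline x$ be a stationary point and let $\overline y=(\overline Y,\overline\mu,\overline\lambda)$ be a Lagrange multiplier at $\overline x$ such that Assumptions B1 and B2 (see context) hold, with positive numbers $c_0,\underline\eta,\overline c,\mu_0,\varrho_0$ and $\gamma>1$ as in these assumptions. Define $\varrho_1:=2\varrho_0$ and $\varrho_2:=4\mu_0$. Then for any $c\ge\overline c$ there exist two positive numbers $\varepsilon$ and $\delta$ (both depending on $c$) such that for any $(Y,\mu,\lambda)\in\mathbb B_\delta(\overline Y,\overline\mu,\overline\lambda)$ the problem $$\min\ L_c(x,Y,\mu,\lambda)\quad\text{s.t. } x\in\mathbb B_\varepsilon(\overline x)$$ has a unique solution, denoted $x_c(Y,\mu,\lambda)$. The function $x_c(\cdot,\cdot,\cdot)$ is locally Lipschitz continuous on $\mathbb B_\delta(\overline Y,\overline\mu,\overline\lambda)$ and semismooth at any point of $\mathbb B_\delta(\overline Y,\overline\mu,\overline\lambda)$, and for any $(Y,\mu,\lambda)\in\mathbb B_\delta(\overline Y,\overline\mu,\overline\lambda)$ $$\|x_c(Y,\mu,\lambda)-\overline x\|\le\varrho_1\|(Y,\mu,\lambda)-(\overline Y,\overline\mu,\overline\lambda)\|/c$$ and $$\|(Y_c(Y,\mu,\lambda),\mu_c(Y,\mu,\lambda),\lambda_c(Y,\mu,\lambda))-(\overline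 Y,\overline\mu,\overline\lambda)\|\le\varrho_2\|(Y,\mu,\lambda)-(\overline Y,\overline\mu,\overline\lambda)\|/c^{\gamma-1},$$ where, with $x_c=x_c(Y,\mu,\lambda)$, $$Y_c(Y,\mu,\lambda)=\nabla\theta_c(F(x_c)+Y/c),\quad \mu_c(Y,\mu,\lambda)=\mu+c\,h(x_c),\quad \lambda_c(Y,\mu,\lambda)=\Pi_{K^*}(\lambda-c\,g(x_c)).$$
   Context: Setting. $\mathcal Z,\mathcal Y$ are finite-dimensional real Hilbert spaces; $f:\mathbb R^n\to\mathbb R$, $F:\mathbb R^n\to\mathcal Z$, $h:\mathbb R^n\to\mathbb R^m$, $g:\mathbb R^n\to\mathcal Y$ are twice continuously differentiable; $\theta:\mathcal Z\to\mathbb R\cup\{+\infty\}$ is proper, lower semicontinuous, convex; $K\subset\mathcal Y$ is a closed convex cone with dual cone $K^*=\{v:\langle v,z\rangle\ge0\ \forall z\in K\}$; $\Pi_{K^*}$ is the metric projection onto $K^*$. ${\rm D}$ denotes derivative, $\mathcal J h$ the Jacobian, $^*$ on operators the adjoint. $\mathbb B_\delta(\cdot)$ is an open ball. For $\tau>0$, $[e_\tau\theta](Z)=\inf_{Z'\in\mathcal Z}\{\theta(Z')+\frac1{2\tau}\|Z'-Z\|^2\}$ and $\theta_c:=e_{1/c}\theta$, which is continuously differentiable; $\nabla\theta_c(Z)={\rm D}\theta_c(Z)^*\in\mathcal Z$ is its gradient. A locally Lipschitz map $G$ is semismooth at $x$ if it is directionally differentiable at $x$ and $Vd-G'(x;d)=o(\|d\|)$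 for $V\in\partial G(x+d)$, $d\to0$ ($\partial$ is Clarke's generalized Jacobian). The B-subdifferential $\partial_BG(x)$ is the set of limits of derivatives ${\rm D}G(x_k)$ with $x_k\to x$, $G$ differentiable at $x_k$. Lagrangian: $L(x,Y,\mu,\lambda)=f(x)+\langle Y,F(x)\rangle+\langle\mu,h(x)\rangle-\langle\lambda,g(x)\rangle$. A feasible $x$ is a stationary point if there is a Lagrange multiplier $(Y,\mu,\lambda)$ with $\nabla_xL(x,Y,\mu,\lambda)=0$, $Y\in\partial\theta(F(x))$, $h(x)=0$, $g(x)\in K$, $\lambda\in K^*$, $\langle g(x),\lambda\rangle=0$; $\mathcal M(x)$ is the set of all Lagrange multipliers at $x$. Augmented Lagrangian ($c>0$): $L_c(x,Y,\mu,\lambda)=f(x)+\theta_c(F(x)+Y/c)-\frac{\|Y\|^2}{2c}+\langle\mu,h(x)\rangle+\frac c2\|h(x)\|^2+\frac1{2c}[\|\Pi_{K^*}(\lambda-cg(x))\|^2-\|\lambda\|^2]$. For linear operators $W_1:\mathcal Z\to\mathcal Z$, $W_2:\mathcal Y\to\mathcal Y$: $\mathcal A_c(\overline y,W_1,W_2)=\nabla^2_{xx}L(\overline x,\overline y)+{\rm D}F(\overline x)^*W_1{\rm D}F(\overline x)+c\,\mathcal Jh(\overline x)^T\mathcal Jh(\overline x)+c\,{\rm D}g(\overline x)^*W_2{\rm D}g(\overline x)$. Write $\mathcal W_1(c)=\partial_B(\nabla\theta_c)(F(\overline x)+\overline Y/c)$, $\mathcal W_2(c)=\partial_B\Pi_{K^*}(\overline\lambda-cg(\overline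 x))$. Assumption B1: $\mathcal M(\overline x)=\{\overline y\}$ and there are $c_0,\underline\eta>0$ such that for all $c\ge c_0$, $W_1\in\mathcal W_1(c)$, $W_2\in\mathcal W_2(c)$, $d\in\mathbb R^n$: $\langle d,\mathcal A_c(\overline y,W_1,W_2)d\rangle\ge\underline\eta\langle d,d\rangle$. Under B1, for each $c\ge c_0$ there is, on a neighborhood of $\overline y$, a unique (as a germ at $\overline y$) locally Lipschitz, directionally differentiable function $x_c(\cdot)$ with $x_c(\overline y)=\overline x$ and $\nabla_xL_c(x_c(y),y)=0$; $(x_c)'(\overline y;\cdot)$ denotes its directional derivative. For $\Delta y=(\Delta Y,\Delta\mu,\Delta\lambda)\in\mathcal Z\times\mathbb R^m\times\mathcal Y$, $\overline{\mathcal V}_c(\Delta y)$ is the set of all vectors $$\begin{pmatrix}c^{-1}W_1{\rm D}F(\overline x)\\ \mathcal Jh(\overline x)\\ -W_2{\rm D}g(\overline x)\end{pmatrix}\mathcal A_c(\overline y,W_1,W_2)^{-1}\big[-c^{-1}{\rm D}F(\overline x)^*W_1\Delta Y-\mathcal Jh(\overline x)^T\Delta\mu+{\rm D}g(\overline x)^*W_2\Delta\lambda\big]+\begin{pmatrix}-c^{-1}\Delta Y+c^{-2}W_1\Delta Y\\0\\-c^{-1}\Delta\lambda+c^{-1}W_2\Delta\lambda\end{pmatrix}$$ with $W_1\in\mathcal W_1(c)$, $W_2\in\mathcal W_2(c)$. Assumption B2: there are $\overline c\ge c_0$, $\mu_0>0$, $\varrho_0>0$, $\gamma>1$ such that for all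 $c\ge\overline c$ and all $\Delta y$: $\|(x_c)'(\overline y;\Delta y)\|\le\varrho_0\|\Delta y\|/c$, and $|\langle v+c^{-1}\Delta y,\Delta y\rangle|\le\mu_0\|\Delta y\|^2/c^\gamma$ for every $v\in\overline{\mathcal V}_c(\Delta y)$. *)

theory Defs
  imports "HOL-Analysis.Analysis"
begin

section \<open>Derivatives, gradients and smoothness\<close>

definition Fderiv :: "('a::real_normed_vector \<Rightarrow> 'b::real_normed_vector) \<Rightarrow> 'a \<Rightarrow> 'a \<Rightarrow>\<^sub>L 'b" where
  "Fderiv G x = Blinfun (frechet_derivative G (at x))"

text \<open>The gradient is \<open>D\<phi>(x)\<^sup>*\<close>, an operator from \<open>\<real>\<close> to the space, identified with its value at \<open>1\<close>.\<close>
definition grad :: "('a::euclidean_space \<Rightarrow> real) \<Rightarrow> 'a \<Rightarrow> 'a" where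
  "grad \<phi> x = adjoint (blinfun_apply (Fderiv \<phi> x)) 1"

definition C2 :: "('a::real_normed_vector \<Rightarrow> 'b::real_normed_vector) \<Rightarrow> bool" where
  "C2 G \<longleftrightarrow> (\<exists>(G' :: 'a \<Rightarrow> 'a \<Rightarrow>\<^sub>L 'b) (G'' :: 'a \<Rightarrow> 'a \<Rightarrow>\<^sub>L 'a \<Rightarrow>\<^sub>L 'b).
     (\<forall>x. (G has_derivative blinfun_apply (G' x)) (at x)) \<and>
     (\<forall>x. (G' has_derivative blinfun_apply (G'' x)) (at x)) \<and>
     continuous_on UNIV G'')"


section \<open>Semismoothness\<close>

definition locally_lipschitz_on :: "'a::metric_space set \<Rightarrow> ('a \<Rightarrow> 'b::metric_space) \<Rightarrow> bool" where
  "locally_lipschitz_on S G \<longleftrightarrow> (\<forall>x\<in>S. \<exists>r>0. \<exists>C. C-lipschitz_on (ball x r \<inter> S) G)"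

definition has_dir_deriv ::
  "('a::real_normed_vector \<Rightarrow> 'b::real_normed_vector) \<Rightarrow> 'a \<Rightarrow> 'a \<Rightarrow> 'b \<Rightarrow> bool" where
  "has_dir_deriv G x d l \<longleftrightarrow> ((\<lambda>t::real. (G (x + t *\<^sub>R d) - G x) /\<^sub>R t) \<longlongrightarrow> l) (at_right 0)"

definition dir_differentiable :: "('a::real_normed_vector \<Rightarrow> 'b::real_normed_vector) \<Rightarrow> 'a \<Rightarrow> bool" where
  "dir_differentiable G x \<longleftrightarrow> (\<forall>d. \<exists>l. has_dir_deriv G x d l)"

definition dir_deriv :: "('a::real_normed_vector \<Rightarrow> 'b::real_normed_vector) \<Rightarrow> 'a \<Rightarrow> 'a \<Rightarrow> 'b" where
  "dir_deriv G x d = (THE l. has_dir_deriv G x d l)"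

definition B_subdiff ::
  "('a::euclidean_space \<Rightarrow> 'b::real_normed_vector) \<Rightarrow> 'a \<Rightarrow> ('a \<Rightarrow>\<^sub>L 'b) set" where
  "B_subdiff G x = {V. \<exists>\<xi>. \<xi> \<longlonglongrightarrow> x \<and> (\<forall>k. G differentiable at (\<xi> k)) \<and>
                          (\<lambda>k::nat. Fderiv G (\<xi> k)) \<longlonglongrightarrow> V}"

definition clarke_jacobian ::
  "('a::euclidean_space \<Rightarrow> 'b::real_normed_vector) \<Rightarrow> 'a \<Rightarrow> ('a \<Rightarrow>\<^sub>L 'b) set" where
  "clarke_jacobian G x = convex hull (B_subdiff G x)"

definition semismooth_at :: "('a::euclidean_space \<Rightarrow> 'b::real_normed_vector) \<Rightarrow> 'a \<Rightarrow> bool" where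
  "semismooth_at G x \<longleftrightarrow>
     (\<exists>r>0. locally_lipschitz_on (ball x r) G) \<and>
     dir_differentiable G x \<and>
     (\<forall>e>0. \<exists>r>0. \<forall>d. norm d < r \<longrightarrow>
        (\<forall>V\<in>clarke_jacobian G (x + d). norm (V d - dir_deriv G x d) \<le> e * norm d))"


section \<open>Convex analysis for extended-real-valued functions and cones\<close>

definition proper_fun :: "('z \<Rightarrow> ereal) \<Rightarrow> bool" where
  "proper_fun \<theta> \<longleftrightarrow> (\<forall>z. \<theta> z \<noteq> -\<infinity>) \<and> (\<exists>z. \<theta> z \<noteq> \<infinity>)"

definition lsc_fun :: "('z::topological_space \<Rightarrow> ereal) \<Rightarrow> bool" where
  "lsc_fun \<theta> \<longleftrightarrow> (\<forall>z. \<theta> z \<le> Liminf (at z) \<theta>)"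

definition convex_fun :: "('z::real_vector \<Rightarrow> ereal) \<Rightarrow> bool" where
  "convex_fun \<theta> \<longleftrightarrow> convex {(z, r::real). \<theta> z \<le> ereal r}"

text \<open>The subdifferential is empty outside the effective domain of a proper \<open>\<theta>\<close>:
  there the left-hand side is \<open>\<infinity>\<close>.\<close>
definition subdiff :: "('z::real_inner \<Rightarrow> ereal) \<Rightarrow> 'z \<Rightarrow> 'z set" where
  "subdiff \<theta> z = {v. \<forall>z'. \<theta> z + ereal (v \<bullet> (z' - z)) \<le> \<theta> z'}"

definition moreau :: "real \<Rightarrow> ('z::real_inner \<Rightarrow> ereal) \<Rightarrow> 'z \<Rightarrow> ereal" where
  "moreau \<tau> \<theta> Z = (INF Z'. \<theta> Z' + ereal (1 / (2 * \<tau>) * (norm (Z' - Z))\<^sup>2))"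

text \<open>For proper lower semicontinuous convex \<open>\<theta>\<close> and \<open>c > 0\<close> the envelope is finite.\<close>
definition theta_c :: "('z::real_inner \<Rightarrow> ereal) \<Rightarrow> real \<Rightarrow> 'z \<Rightarrow> real" where
  "theta_c \<theta> c Z = real_of_ereal (moreau (1 / c) \<theta> Z)"

definition dual_cone :: "'y::real_inner set \<Rightarrow> 'y set" where
  "dual_cone K = {v. \<forall>z\<in>K. 0 \<le> v \<bullet> z}"


section \<open>Lagrangian, multipliers, stationary points\<close>

fun Lagr :: "('x::euclidean_space \<Rightarrow> real) \<Rightarrow> ('x \<Rightarrow> 'z::euclidean_space) \<Rightarrow> ('x \<Rightarrow> real^'m)
    \<Rightarrow> ('x \<Rightarrow> 'y::euclidean_space) \<Rightarrow> 'x \<Rightarrow> 'z \<times> (real^'m) \<times> 'y \<Rightarrow> real" where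
  "Lagr f F h g x (Y, \<mu>, l) = f x + Y \<bullet> F x + \<mu> \<bullet> h x - l \<bullet> g x"

definition multipliers :: "('x::euclidean_space \<Rightarrow> real) \<Rightarrow> ('x \<Rightarrow> 'z::euclidean_space)
    \<Rightarrow> ('x \<Rightarrow> real^'m) \<Rightarrow> ('x \<Rightarrow> 'y::euclidean_space) \<Rightarrow> ('z \<Rightarrow> ereal) \<Rightarrow> 'y set
    \<Rightarrow> 'x \<Rightarrow> ('z \<times> (real^'m) \<times> 'y) set" where
  "multipliers f F h g \<theta> K x = {(Y, \<mu>, l).
     grad (\<lambda>x'. Lagr f F h g x' (Y, \<mu>, l)) x = 0 \<and> Y \<in> subdiff \<theta> (F x) \<and> h x = 0 \<and>
     g x \<in> K \<and> l \<in> dual_cone K \<and> g x \<bullet> l = 0}"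

definition stationary :: "('x::euclidean_space \<Rightarrow> real) \<Rightarrow> ('x \<Rightarrow> 'z::euclidean_space)
    \<Rightarrow> ('x \<Rightarrow> real^'m) \<Rightarrow> ('x \<Rightarrow> 'y::euclidean_space) \<Rightarrow> ('z \<Rightarrow> ereal) \<Rightarrow> 'y set
    \<Rightarrow> 'x \<Rightarrow> bool" where
  "stationary f F h g \<theta> K x \<longleftrightarrow>
     (\<theta> (F x) < \<infinity> \<and> h x = 0 \<and> g x \<in> K) \<and> multipliers f F h g \<theta> K x \<noteq> {}"

fun aug_Lagr :: "('x::euclidean_space \<Rightarrow> real) \<Rightarrow> ('x \<Rightarrow> 'z::euclidean_space) \<Rightarrow> ('x \<Rightarrow> real^'m)
    \<Rightarrow> ('x \<Rightarrow> 'y::euclidean_space) \<Rightarrow> ('z \<Rightarrow> ereal) \<Rightarrow> 'y set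
    \<Rightarrow> real \<Rightarrow> 'x \<Rightarrow> 'z \<times> (real^'m) \<times> 'y \<Rightarrow> real" where
  "aug_Lagr f F h g \<theta> K c x (Y, \<mu>, l) =
     f x + theta_c \<theta> c (F x + Y /\<^sub>R c) - (norm Y)\<^sup>2 / (2 * c)
     + \<mu> \<bullet> h x + c / 2 * (norm (h x))\<^sup>2
     + 1 / (2 * c) * ((norm (closest_point (dual_cone K) (l - c *\<^sub>R g x)))\<^sup>2 - (norm l)\<^sup>2)"


section \<open>Assumptions B1 and B2\<close>

fun W1_set :: "('x \<Rightarrow> 'z::euclidean_space) \<Rightarrow> ('z \<Rightarrow> ereal) \<Rightarrow> 'x
    \<Rightarrow> 'z \<times> (real^'m) \<times> 'y::euclidean_space \<Rightarrow> real \<Rightarrow> ('z \<Rightarrow>\<^sub>L 'z) set" where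
  "W1_set F \<theta> xbar (Y, \<mu>, l) c = B_subdiff (grad (theta_c \<theta> c)) (F xbar + Y /\<^sub>R c)"

fun W2_set :: "('x \<Rightarrow> 'y::euclidean_space) \<Rightarrow> 'y set \<Rightarrow> 'x
    \<Rightarrow> 'z::euclidean_space \<times> (real^'m) \<times> 'y \<Rightarrow> real \<Rightarrow> ('y \<Rightarrow>\<^sub>L 'y) set" where
  "W2_set g K xbar (Y, \<mu>, l) c = B_subdiff (closest_point (dual_cone K)) (l - c *\<^sub>R g xbar)"

definition A_op :: "(real^'n \<Rightarrow> real) \<Rightarrow> (real^'n \<Rightarrow> 'z::euclidean_space)
    \<Rightarrow> (real^'n \<Rightarrow> real^'m) \<Rightarrow> (real^'n \<Rightarrow> 'y::euclidean_space) \<Rightarrow> real^'n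
    \<Rightarrow> 'z \<times> (real^'m) \<times> 'y \<Rightarrow> real \<Rightarrow> ('z \<Rightarrow>\<^sub>L 'z) \<Rightarrow> ('y \<Rightarrow>\<^sub>L 'y) \<Rightarrow> real^'n \<Rightarrow> real^'n" where
  "A_op f F h g xbar ybar c W1 W2 d =
     Fderiv (grad (\<lambda>x. Lagr f F h g x ybar)) xbar d
     + adjoint (Fderiv F xbar) (W1 (Fderiv F xbar d))
     + c *\<^sub>R (transpose (jacobian h (at xbar)) *v (jacobian h (at xbar) *v d))
     + c *\<^sub>R adjoint (Fderiv g xbar) (W2 (Fderiv g xbar d))"

definition B1 :: "(real^'n \<Rightarrow> real) \<Rightarrow> (real^'n \<Rightarrow> 'z::euclidean_space)
    \<Rightarrow> (real^'n \<Rightarrow> real^'m) \<Rightarrow> (real^'n \<Rightarrow> 'y::euclidean_space) \<Rightarrow> ('z \<Rightarrow> ereal) \<Rightarrow> 'y set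
    \<Rightarrow> real^'n \<Rightarrow> 'z \<times> (real^'m) \<times> 'y \<Rightarrow> real \<Rightarrow> real \<Rightarrow> bool" where
  "B1 f F h g \<theta> K xbar ybar c0 \<eta> \<longleftrightarrow>
     multipliers f F h g \<theta> K xbar = {ybar} \<and> c0 > 0 \<and> \<eta> > 0 \<and>
     (\<forall>c\<ge>c0. \<forall>W1\<in>W1_set F \<theta> xbar ybar c. \<forall>W2\<in>W2_set g K xbar ybar c. \<forall>d.
        d \<bullet> A_op f F h g xbar ybar c W1 W2 d \<ge> \<eta> * (d \<bullet> d))"

text \<open>\<open>X\<close> represents the germ at \<open>ybar\<close> of the implicit solution \<open>x\<^sub>c\<close> of
  \<open>\<nabla>\<^sub>x L\<^sub>c(x, y) = 0\<close>. Under B1 such an \<open>X\<close> exists for each \<open>c \<ge> c0\<close> and its germ is unique.\<close>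
definition implicit_solution :: "(real^'n \<Rightarrow> real) \<Rightarrow> (real^'n \<Rightarrow> 'z::euclidean_space)
    \<Rightarrow> (real^'n \<Rightarrow> real^'m) \<Rightarrow> (real^'n \<Rightarrow> 'y::euclidean_space) \<Rightarrow> ('z \<Rightarrow> ereal) \<Rightarrow> 'y set
    \<Rightarrow> real^'n \<Rightarrow> 'z \<times> (real^'m) \<times> 'y \<Rightarrow> real \<Rightarrow> ('z \<times> (real^'m) \<times> 'y \<Rightarrow> real^'n) \<Rightarrow> bool" where
  "implicit_solution f F h g \<theta> K xbar ybar c X \<longleftrightarrow>
     X ybar = xbar \<and>
     (\<exists>U. open U \<and> ybar \<in> U \<and> locally_lipschitz_on U X \<and>
        (\<forall>y\<in>U. dir_differentiable X y \<and> grad (\<lambda>x. aug_Lagr f F h g \<theta> K c x y) (X y) = 0))"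

fun V_vec :: "(real^'n \<Rightarrow> real) \<Rightarrow> (real^'n \<Rightarrow> 'z::euclidean_space)
    \<Rightarrow> (real^'n \<Rightarrow> real^'m) \<Rightarrow> (real^'n \<Rightarrow> 'y::euclidean_space) \<Rightarrow> real^'n
    \<Rightarrow> 'z \<times> (real^'m) \<times> 'y \<Rightarrow> real \<Rightarrow> ('z \<Rightarrow>\<^sub>L 'z) \<Rightarrow> ('y \<Rightarrow>\<^sub>L 'y)
    \<Rightarrow> 'z \<times> (real^'m) \<times> 'y \<Rightarrow> 'z \<times> (real^'m) \<times> 'y" where
  "V_vec f F h g xbar ybar c W1 W2 (dY, d\<mu>, dl) =
     (let u = inv (A_op f F h g xbar ybar c W1 W2)
                (- (adjoint (Fderiv F xbar) (W1 dY) /\<^sub>R c)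
                 - transpose (jacobian h (at xbar)) *v d\<mu>
                 + adjoint (Fderiv g xbar) (W2 dl))
      in (W1 (Fderiv F xbar u) /\<^sub>R c, jacobian h (at xbar) *v u, - W2 (Fderiv g xbar u))
         + (- (dY /\<^sub>R c) + W1 dY /\<^sub>R c\<^sup>2, 0, - (dl /\<^sub>R c) + W2 dl /\<^sub>R c))"

definition V_set :: "(real^'n \<Rightarrow> real) \<Rightarrow> (real^'n \<Rightarrow> 'z::euclidean_space)
    \<Rightarrow> (real^'n \<Rightarrow> real^'m) \<Rightarrow> (real^'n \<Rightarrow> 'y::euclidean_space) \<Rightarrow> ('z \<Rightarrow> ereal) \<Rightarrow> 'y set
    \<Rightarrow> real^'n \<Rightarrow> 'z \<times> (real^'m) \<times> 'y \<Rightarrow> real \<Rightarrow> 'z \<times> (real^'m) \<times> 'y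
    \<Rightarrow> ('z \<times> (real^'m) \<times> 'y) set" where
  "V_set f F h g \<theta> K xbar ybar c dy =
     {V_vec f F h g xbar ybar c W1 W2 dy | W1 W2.
        W1 \<in> W1_set F \<theta> xbar ybar c \<and> W2 \<in> W2_set g K xbar ybar c}"

definition B2 :: "(real^'n \<Rightarrow> real) \<Rightarrow> (real^'n \<Rightarrow> 'z::euclidean_space)
    \<Rightarrow> (real^'n \<Rightarrow> real^'m) \<Rightarrow> (real^'n \<Rightarrow> 'y::euclidean_space) \<Rightarrow> ('z \<Rightarrow> ereal) \<Rightarrow> 'y set
    \<Rightarrow> real^'n \<Rightarrow> 'z \<times> (real^'m) \<times> 'y \<Rightarrow> real \<Rightarrow> real \<Rightarrow> real \<Rightarrow> real \<Rightarrow> real \<Rightarrow> bool" where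
  "B2 f F h g \<theta> K xbar ybar c0 cbar \<mu>0 \<rho>0 \<gamma> \<longleftrightarrow>
     cbar \<ge> c0 \<and> \<mu>0 > 0 \<and> \<rho>0 > 0 \<and> \<gamma> > 1 \<and>
     (\<forall>c\<ge>cbar. \<forall>dy.
        (\<forall>X. implicit_solution f F h g \<theta> K xbar ybar c X \<longrightarrow>
             norm (dir_deriv X ybar dy) \<le> \<rho>0 * norm dy / c) \<and>
        (\<forall>v\<in>V_set f F h g \<theta> K xbar ybar c dy.
             \<bar>(v + dy /\<^sub>R c) \<bullet> dy\<bar> \<le> \<mu>0 * (norm dy)\<^sup>2 / c powr \<gamma>))"


section \<open>Multiplier update\<close>

fun mult_update :: "('x \<Rightarrow> 'z::euclidean_space) \<Rightarrow> ('x \<Rightarrow> real^'m)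
    \<Rightarrow> ('x \<Rightarrow> 'y::euclidean_space) \<Rightarrow> ('z \<Rightarrow> ereal) \<Rightarrow> 'y set
    \<Rightarrow> real \<Rightarrow> 'x \<Rightarrow> 'z \<times> (real^'m) \<times> 'y \<Rightarrow> 'z \<times> (real^'m) \<times> 'y" where
  "mult_update F h g \<theta> K c x (Y, \<mu>, l) =
     (grad (theta_c \<theta> c) (F x + Y /\<^sub>R c), \<mu> + c *\<^sub>R h x,
      closest_point (dual_cone K) (l - c *\<^sub>R g x))"

end

theory Submission
  imports Defs
begin

text \<open>
  Put \<open>\<Phi>(x, y) = \<nabla>\<^sub>xL\<^sub>c(x, y)\<close>, which equals \<open>\<nabla>\<^sub>xL(x, M(x, y))\<close> for the multiplier update \<open>M\<close>.
  Directional derivatives of \<open>\<nabla>\<theta>\<^sub>c\<close> and of the projection are values of elements of their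
  B-subdifferentials, so compactness of these sets turns B1 into strong monotonicity of \<open>\<Phi>(\<cdot>, y)\<close>
  near \<open>xbar\<close>, uniformly for \<open>y\<close> near \<open>ybar\<close>. Hence \<open>L\<^sub>c(\<cdot>, y)\<close> is strongly convex there, which gives
  the unique minimizer \<open>X y\<close>, its Lipschitz continuity and, by linearizing \<open>\<Phi>(X y, y) = 0\<close>, its
  semismoothness. The first estimate is B2 up to first order. For the second one, the linearization
  of \<open>y \<mapsto> M(X y, y)\<close> at \<open>ybar\<close> in direction \<open>d\<close> is \<open>c (v + d/c)\<close> for some \<open>v\<close> in the set of
  B2, given by self-adjoint operators, so the bound on the quadratic form is a bound on the norm.
\<close>

section \<open>Semismooth calculus\<close>

text \<open>Two obstacles shape the development. Clarke Jacobians obey no exact chain rule, so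
  semismoothness is carried through compositions as \<open>G' (x + d) d - G' x d = o(d)\<close>,
  with directional derivatives in place of generalized Jacobians; these are nonlinear in
  \<open>d\<close>, and Lipschitz bounds in \<open>d\<close> replace operator norms. Moreover,
  writing a directional derivative as \<open>V d\<close> with \<open>V\<close> in a
  B-subdifferential presupposes that such sets are nonempty: points of differentiability come from a
  Baire category argument, and local Lipschitz continuity makes the derivatives at them subconverge.
  Self-adjointness holds because both maps are gradients, one of the Moreau envelope, the other of
  half the squared norm of the projection. The first half of B2 speaks about implicit solutions, so
  the minimizer map has to be recognized as one. The factors 2 and 4 in \<rho>1 and \<rho>2 leave
  room for first-order remainders: the linearizations obey the same bounds with \<rho>0 and
  \<mu>0.\<close>

definition little_o :: "('a::real_normed_vector \<Rightarrow> 'b::real_normed_vector) \<Rightarrow> bool" where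
  "little_o R \<longleftrightarrow> (\<forall>e>0. \<forall>\<^sub>F d in nhds 0. norm (R d) \<le> e * norm d)"

lemma little_oD: "little_o R \<Longrightarrow> e > 0 \<Longrightarrow> \<forall>\<^sub>F d in nhds 0. norm (R d) \<le> e * norm d"
  by (simp add: little_o_def)

lemma little_o_dom:
  assumes "little_o R" and "\<forall>\<^sub>F d in nhds 0. norm (Q d) \<le> C * norm (R d)"
  shows "little_o Q"
  unfolding little_o_def
proof (intro allI impI)
  fix e :: real assume e: "e > 0"
  \<comment> \<open>\<open>C\<close> carries no sign condition; the maximum is a positive constant
    to divide by.\<close>
  define D where "D = max C 1"
  have D: "D > 0" "C \<le> D" by (auto simp: D_def)
  have "e / D > 0" using e D by simp
  from little_oD[OF assms(1) this] assms(2)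
  show "\<forall>\<^sub>F d in nhds 0. norm (Q d) \<le> e * norm d"
  proof eventually_elim
    case (elim d)
    have "norm (Q d) \<le> D * norm (R d)"
      using elim(2) D mult_right_mono[OF D(2), of "norm (R d)"] by simp
    also have "\<dots> \<le> D * (e / D * norm d)" using elim(1) D by (intro mult_left_mono) auto
    finally show ?case using D by simp
  qed
qed

lemma little_o_add:
  assumes "little_o R" "little_o Q" shows "little_o (\<lambda>d. R d + Q d)"
  unfolding little_o_def
proof (intro allI impI)
  fix e :: real assume e: "e > 0"
  then have "e / 2 > 0" by simp
  from little_oD[OF assms(1) this] little_oD[OF assms(2) this]
  show "\<forall>\<^sub>F d in nhds 0. norm (R d + Q d) \<le> e * norm d"
    by eventually_elim (rule norm_triangle_le, simp)
qed

lemma little_o_minus: "little_o R \<Longrightarrow> little_o (\<lambda>d. - R d)"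
  by (simp add: little_o_def)

lemma little_o_diff: "little_o R \<Longrightarrow> little_o Q \<Longrightarrow> little_o (\<lambda>d. R d - Q d)"
  using little_o_add[of R "\<lambda>d. - Q d"] little_o_minus[of Q] by simp

lemma little_o_Pair: "little_o R \<Longrightarrow> little_o Q \<Longrightarrow> little_o (\<lambda>d. (R d, Q d))"
proof -
  assume R: "little_o R" and Q: "little_o Q"
  show ?thesis unfolding little_o_def
  proof (intro allI impI)
    fix e :: real assume e: "e > 0"
    then have "e / 2 > 0" by simp
    from little_oD[OF R this] little_oD[OF Q this]
    show "\<forall>\<^sub>F d in nhds 0. norm (R d, Q d) \<le> e * norm d"
    proof eventually_elim
      case (elim d)
      then show ?case using norm_Pair_le[of "R d" "Q d"] by simp
    qed
  qed
qed

lemma little_o_quadratic: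
  assumes "\<And>d. norm (R d) \<le> C * (norm d)\<^sup>2" shows "little_o R"
  unfolding little_o_def
proof (intro allI impI)
  fix e :: real assume e: "e > 0"
  define D where "D = max C 1"
  have D: "D > 0" "C \<le> D" by (auto simp: D_def)
  have "\<forall>\<^sub>F d in nhds 0. dist d (0::'a) < e / D"
    using e D by (auto simp: eventually_nhds_metric intro!: exI[of _ "e/D"])
  then show "\<forall>\<^sub>F d in nhds 0. norm (R d) \<le> e * norm d"
  proof eventually_elim
    case (elim d)
    have "norm (R d) \<le> C * (norm d)\<^sup>2" by (rule assms)
    also have "\<dots> \<le> D * (norm d)\<^sup>2" using D by (intro mult_right_mono) auto
    also have "\<dots> = (D * norm d) * norm d" by (simp add: power2_eq_square)
    also have "\<dots> \<le> e * norm d" using elim D by (intro mult_right_mono) (auto simp: field_simps)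
    finally show ?case .
  qed
qed

lemma little_o_compose:
  fixes k :: "'c::real_normed_vector \<Rightarrow> 'a::real_normed_vector" and R :: "'a \<Rightarrow> 'b::real_normed_vector"
  assumes R: "little_o R" and k: "\<forall>\<^sub>F d in nhds 0. norm (k d) \<le> C * norm d"
  shows "little_o (\<lambda>d. R (k d))"
proof -
  define D where "D = max C 1"
  have D: "D > 0" "C \<le> D" by (auto simp: D_def)
  have kD: "\<forall>\<^sub>F d in nhds 0. norm (k d) \<le> D * norm d"
    using k by eventually_elim (meson D(2) mult_right_mono norm_ge_zero order_trans)
  have "isCont (\<lambda>d::'c. D * norm d) 0" by (intro continuous_intros)
  then have "((\<lambda>d::'c. D * norm d) \<longlongrightarrow> D * norm (0::'c)) (nhds 0)"
    by (simp add: continuous_at tendsto_nhds_iff)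
  then have "(k \<longlongrightarrow> 0) (nhds 0)"
    using Lim_null_comparison[OF kD] by simp
  show ?thesis unfolding little_o_def
  proof (intro allI impI)
    fix e :: real assume e: "e > 0"
    then have "e / D > 0" using D by simp
    \<comment> \<open>\<open>k d\<close> may vanish for \<open>d \<noteq> 0\<close>. This is
      harmless because \<open>little_o\<close> uses \<open>nhds 0\<close> and not
      \<open>at 0\<close>, so it includes \<open>R 0 = 0\<close>.\<close>
    from little_oD[OF R this]
    have "\<forall>\<^sub>F d in nhds 0. norm (R (k d)) \<le> e / D * norm (k d)"
      using \<open>(k \<longlongrightarrow> 0) (nhds 0)\<close> by (rule eventually_compose_filterlim)
    with kD show "\<forall>\<^sub>F d in nhds 0. norm (R (k d)) \<le> e * norm d"
    proof eventually_elim
      case (elim d)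
      have "norm (R (k d)) \<le> e / D * norm (k d)" by (rule elim)
      also have "\<dots> \<le> e / D * (D * norm d)" using elim e D by (intro mult_left_mono) auto
      finally show ?case using D by simp
    qed
  qed
qed

text \<open>The last clause, with the derivative taken at the perturbed point, is equivalent to the
  condition on Clarke Jacobians for maps that are semismooth everywhere (see
  \<open>semismooth_at_imp_semismooth_on\<close> and \<open>semismooth_on_imp_semismooth_at\<close>), but it is
  stable under composition without any chain rule for generalized Jacobians.\<close>
definition semismooth_on :: "'a::real_normed_vector set \<Rightarrow> ('a \<Rightarrow> 'b::real_normed_vector) \<Rightarrow> ('a \<Rightarrow> 'a \<Rightarrow> 'b) \<Rightarrow> bool"
  where "semismooth_on U G G' \<longleftrightarrow> open U \<and> (\<forall>x\<in>U. (\<exists>r>0. \<exists>C. C-lipschitz_on (ball x r) G) \<and>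
     (\<forall>t\<ge>0. \<forall>d. G' x (t *\<^sub>R d) = t *\<^sub>R G' x d) \<and>
     little_o (\<lambda>d. G (x + d) - G x - G' x d) \<and>
     little_o (\<lambda>d. G' (x + d) d - G' x d))"

lemma semismooth_onI:
  assumes "open U"
    and "\<And>x. x \<in> U \<Longrightarrow> \<exists>r>0. \<exists>C. C-lipschitz_on (ball x r) G"
    and "\<And>x t d. x \<in> U \<Longrightarrow> 0 \<le> t \<Longrightarrow> G' x (t *\<^sub>R d) = t *\<^sub>R G' x d"
    and "\<And>x. x \<in> U \<Longrightarrow> little_o (\<lambda>d. G (x + d) - G x - G' x d)"
    and "\<And>x. x \<in> U \<Longrightarrow> little_o (\<lambda>d. G' (x + d) d - G' x d)"
  shows "semismooth_on U G G'"
  using assms unfolding semismooth_on_def by auto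

lemma semismooth_on_open: "semismooth_on U G G' \<Longrightarrow> open U"
  and semismooth_on_lipschitz: "semismooth_on U G G' \<Longrightarrow> x \<in> U \<Longrightarrow> \<exists>r>0. \<exists>C. C-lipschitz_on (ball x r) G"
  and semismooth_on_scale: "semismooth_on U G G' \<Longrightarrow> x \<in> U \<Longrightarrow> 0 \<le> t \<Longrightarrow> G' x (t *\<^sub>R d) = t *\<^sub>R G' x d"
  and semismooth_on_bdiff: "semismooth_on U G G' \<Longrightarrow> x \<in> U \<Longrightarrow> little_o (\<lambda>d. G (x + d) - G x - G' x d)"
  and semismooth_on_semi: "semismooth_on U G G' \<Longrightarrow> x \<in> U \<Longrightarrow> little_o (\<lambda>d. G' (x + d) d - G' x d)"
  unfolding semismooth_on_def by auto

section \<open>Right-hand directional derivatives and the chain rule\<close>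

lemma eventually_at_right_scaled:
  assumes "\<forall>\<^sub>F d in nhds (0::'a::real_normed_vector). P d"
  shows "\<forall>\<^sub>F t in at_right (0::real). P (t *\<^sub>R d)"
proof -
  have "((\<lambda>t::real. t *\<^sub>R d) \<longlongrightarrow> 0 *\<^sub>R d) (at_right 0)" by (intro tendsto_intros)
  then show ?thesis using eventually_compose_filterlim[OF assms, of "\<lambda>t. t *\<^sub>R d"] by simp
qed

lemma little_o_imp_has_dir_deriv:
  assumes L: "little_o (\<lambda>d. G (x + d) - G x - L d)" and h: "\<And>t. 0 \<le> t \<Longrightarrow> L (t *\<^sub>R d) = t *\<^sub>R L d"
  shows "has_dir_deriv G x d (L d)"
  unfolding has_dir_deriv_def
proof (rule tendstoI)
  fix e :: real assume e: "e > 0"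
  \<comment> \<open>The added 1 covers \<open>d = 0\<close> and makes \<open>e' * norm d < e\<close>
    strict.\<close>
  define e' where "e' = e / (norm d + 1)"
  have e': "e' > 0" "e' * norm d < e"
    using e by (auto simp: e'_def field_simps add_pos_nonneg)
  from eventually_at_right_scaled[OF little_oD[OF L e'(1)], of d] eventually_at_right_less[of "0::real"]
  show "\<forall>\<^sub>F t in at_right 0. dist ((G (x + t *\<^sub>R d) - G x) /\<^sub>R t) (L d) < e"
  proof eventually_elim
    case (elim t)
    have "(G (x + t *\<^sub>R d) - G x) /\<^sub>R t - L d = (G (x + t *\<^sub>R d) - G x - L (t *\<^sub>R d)) /\<^sub>R t"
      using elim h[of t] by (simp add: scaleR_diff_right)
    then have "dist ((G (x + t *\<^sub>R d) - G x) /\<^sub>R t) (L d) = norm (G (x + t *\<^sub>R d) - G x - L (t *\<^sub>R d)) / t"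
      using elim by (simp add: dist_norm divide_inverse mult.commute)
    also have "\<dots> \<le> e' * norm d" using elim by (simp add: field_simps)
    finally show ?case using e' by simp
  qed
qed

lemma semismooth_on_has_dir_deriv:
  assumes "semismooth_on U G G'" "x \<in> U" shows "has_dir_deriv G x d (G' x d)"
  using little_o_imp_has_dir_deriv semismooth_on_bdiff[OF assms] semismooth_on_scale[OF assms] by blast

lemma has_derivative_imp_little_o:
  assumes "(G has_derivative G') (at x)" shows "little_o (\<lambda>d. G (x + d) - G x - G' d)"
  unfolding little_o_def
proof (intro allI impI)
  fix e :: real assume "e > 0"
  with assms obtain s where s: "s > 0" "\<And>y. norm (y - x) < s \<Longrightarrow> norm (G y - G x - G' (y - x)) \<le> e * norm (y - x)"
    unfolding has_derivative_at_alt by blast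
  show "\<forall>\<^sub>F d in nhds 0. norm (G (x + d) - G x - G' d) \<le> e * norm d"
    unfolding eventually_nhds_metric
    using s(1) s(2)[of "x + _"] by (intro exI[of _ s]) (simp add: dist_norm)
qed

lemma has_derivative_imp_has_dir_deriv:
  assumes "(G has_derivative G') (at x)" shows "has_dir_deriv G x d (G' d)"
  using little_o_imp_has_dir_deriv[OF has_derivative_imp_little_o[OF assms]]
    linear_scale[OF has_derivative_linear[OF assms]] by blast

lemma has_dir_deriv_unique:
  "has_dir_deriv G x d l \<Longrightarrow> has_dir_deriv G x d l' \<Longrightarrow> l = l'"
  unfolding has_dir_deriv_def by (rule tendsto_unique[OF trivial_limit_at_right_real])

lemma dir_deriv_eq: "has_dir_deriv G x d l \<Longrightarrow> dir_deriv G x d = l"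
  unfolding dir_deriv_def using has_dir_deriv_unique by blast

text \<open>Difference quotients in two directions with the same step differ by at most
  \<open>C * norm (d1 - d2)\<close>, and the bound survives the limit. With \<open>d2 = 0\<close> it
  bounds the derivative itself.\<close>

lemma has_dir_deriv_norm_diff_le:
  assumes L: "C-lipschitz_on (ball x r) G" and "z \<in> ball x r"
    and d: "has_dir_deriv G z d1 l1" "has_dir_deriv G z d2 l2"
  shows "norm (l1 - l2) \<le> C * norm (d1 - d2)"
proof -
  have lim: "((\<lambda>t. norm ((G (z + t *\<^sub>R d1) - G z) /\<^sub>R t - (G (z + t *\<^sub>R d2) - G z) /\<^sub>R t)) \<longlongrightarrow> norm (l1 - l2)) (at_right 0)"
    using d unfolding has_dir_deriv_def by (intro tendsto_intros)
  have ev: "\<forall>\<^sub>F t in at_right (0::real). z + t *\<^sub>R d \<in> ball x r" for d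
  proof -
    have "((\<lambda>t::real. z + t *\<^sub>R d) \<longlongrightarrow> z + 0 *\<^sub>R d) (at_right 0)" by (intro tendsto_intros)
    then show ?thesis using topological_tendstoD[of _ _ _ "ball x r"] assms(2) by auto
  qed
  have "\<forall>\<^sub>F t in at_right (0::real).
      norm ((G (z + t *\<^sub>R d1) - G z) /\<^sub>R t - (G (z + t *\<^sub>R d2) - G z) /\<^sub>R t) \<le> C * norm (d1 - d2)"
    using ev[of d1] ev[of d2] eventually_at_right_less[of "0::real"]
  proof eventually_elim
    case (elim t)
    have "dist (G (z + t *\<^sub>R d1)) (G (z + t *\<^sub>R d2)) \<le> C * dist (z + t *\<^sub>R d1) (z + t *\<^sub>R d2)"
      using L elim unfolding lipschitz_on_def by blast
    also have "dist (z + t *\<^sub>R d1) (z + t *\<^sub>R d2) = t * norm (d1 - d2)"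
      using elim by (simp add: dist_norm flip: scaleR_diff_right)
    finally have "norm (G (z + t *\<^sub>R d1) - G (z + t *\<^sub>R d2)) \<le> t * (C * norm (d1 - d2))"
      by (simp add: dist_norm algebra_simps)
    moreover have "(G (z + t *\<^sub>R d1) - G z) /\<^sub>R t - (G (z + t *\<^sub>R d2) - G z) /\<^sub>R t
        = (G (z + t *\<^sub>R d1) - G (z + t *\<^sub>R d2)) /\<^sub>R t" by (simp flip: scaleR_diff_right)
    then have "norm ((G (z + t *\<^sub>R d1) - G z) /\<^sub>R t - (G (z + t *\<^sub>R d2) - G z) /\<^sub>R t)
        = norm (G (z + t *\<^sub>R d1) - G (z + t *\<^sub>R d2)) / t"
      using elim by (simp add: divide_inverse mult.commute)
    ultimately show ?case using elim by (simp add: pos_divide_le_eq mult.commute)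
  qed
  then show ?thesis by (rule tendsto_upperbound[OF lim]) simp
qed

text \<open>\<open>G' z\<close> may be nonlinear, so a Lipschitz bound in the direction, uniform
  over base points near \<open>x\<close>, takes the role of a bound on operator norms.\<close>

lemma semismooth_on_deriv_lipschitz:
  assumes "semismooth_on U G G'" "x \<in> U"
  obtains r C where "r > 0" "C \<ge> 0" "ball x r \<subseteq> U" "C-lipschitz_on (ball x r) G"
    "\<And>z d1 d2. z \<in> ball x r \<Longrightarrow> norm (G' z d1 - G' z d2) \<le> C * norm (d1 - d2)"
    "\<And>z d. z \<in> ball x r \<Longrightarrow> norm (G' z d) \<le> C * norm d"
proof -
  obtain r1 C where r1: "r1 > 0" "C-lipschitz_on (ball x r1) G" using semismooth_on_lipschitz[OF assms] by auto
  obtain r2 where r2: "r2 > 0" "ball x r2 \<subseteq> U" using semismooth_on_open[OF assms(1)] assms(2) openE by blast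
  define r where "r = min r1 r2"
  have r: "r > 0" "ball x r \<subseteq> U" "ball x r \<subseteq> ball x r1" using r1 r2 by (auto simp: r_def)
  have L: "C-lipschitz_on (ball x r) G" using lipschitz_on_subset[OF r1(2) r(3)] .
  have 1: "norm (G' z d1 - G' z d2) \<le> C * norm (d1 - d2)" if "z \<in> ball x r" for z d1 d2
    using has_dir_deriv_norm_diff_le[OF L that] semismooth_on_has_dir_deriv[OF assms(1)] that r(2) by blast
  have 2: "norm (G' z d) \<le> C * norm d" if "z \<in> ball x r" for z d
    using 1[OF that, of d 0] semismooth_on_scale[OF assms(1), of z 0 0] that r(2) by auto
  show ?thesis by (rule that[OF r(1) _ r(2) L 1 2]) (use L lipschitz_on_nonneg in auto)
qed

lemma semismooth_on_continuous: "semismooth_on U G G' \<Longrightarrow> x \<in> U \<Longrightarrow> isCont G x"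
proof -
  assume "semismooth_on U G G'" "x \<in> U"
  then obtain r C where "r > 0" "C-lipschitz_on (ball x r) G" using semismooth_on_lipschitz by blast
  then show ?thesis
    using lipschitz_on_continuous_on[of C "ball x r" G] continuous_on_interior[of "ball x r" G x] by simp
qed

lemma eventually_nhds_0_ball: "r > 0 \<Longrightarrow> \<forall>\<^sub>F d in nhds 0. x + d \<in> ball (x::'a::real_normed_vector) r"
  by (auto simp: eventually_nhds_metric dist_norm)

text \<open>Both clauses for \<open>H\<close> are applied to the true increment
  \<open>k d = G (x + d) - G x\<close>, which is O(d) by Lipschitz continuity. Replacing
  \<open>k d\<close> afterwards by \<open>G' x d\<close> or by \<open>G' (x + d) d\<close> costs
  o(d), because \<open>H'\<close> is Lipschitz in its direction.\<close>

lemma semismooth_on_compose: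
  assumes G: "semismooth_on U G G'" and H: "semismooth_on V H H'" and UV: "\<And>x. x \<in> U \<Longrightarrow> G x \<in> V"
  shows "semismooth_on U (\<lambda>x. H (G x)) (\<lambda>x d. H' (G x) (G' x d))"
proof (rule semismooth_onI)
  show "open U" using semismooth_on_open[OF G] .
  fix x assume x: "x \<in> U"
  note [simp] = UV[OF x]
  obtain r C where rC: "r > 0" "C \<ge> 0" "ball x r \<subseteq> U" "C-lipschitz_on (ball x r) G"
    "\<And>z d1 d2. z \<in> ball x r \<Longrightarrow> norm (G' z d1 - G' z d2) \<le> C * norm (d1 - d2)"
    "\<And>z d. z \<in> ball x r \<Longrightarrow> norm (G' z d) \<le> C * norm d" using semismooth_on_deriv_lipschitz[OF G x] by blast
  obtain s D where sD: "s > 0" "D \<ge> 0" "ball (G x) s \<subseteq> V" "D-lipschitz_on (ball (G x) s) H"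
    "\<And>z d1 d2. z \<in> ball (G x) s \<Longrightarrow> norm (H' z d1 - H' z d2) \<le> D * norm (d1 - d2)"
    "\<And>z d. z \<in> ball (G x) s \<Longrightarrow> norm (H' z d) \<le> D * norm d"
    using semismooth_on_deriv_lipschitz[OF H, of "G x"] by auto
  have "\<forall>\<^sub>F z in nhds x. G z \<in> ball (G x) s"
    using semismooth_on_continuous[OF G x] sD(1) topological_tendstoD[of G "G x" "nhds x" "ball (G x) s"]
    by (simp add: continuous_at tendsto_nhds_iff)
  then obtain r2 where r2: "r2 > 0" "\<And>z. dist z x < r2 \<Longrightarrow> G z \<in> ball (G x) s"
    by (auto simp: eventually_nhds_metric)
  define r3 where "r3 = min r r2"
  have r3: "r3 > 0" "ball x r3 \<subseteq> ball x r" "G ` ball x r3 \<subseteq> ball (G x) s"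
    using r2 rC by (auto simp: r3_def dist_commute)
  have "(D * C)-lipschitz_on (ball x r3) (\<lambda>x. H (G x))"
    using lipschitz_on_compose[of C "ball x r3" G D H, OF lipschitz_on_subset[OF rC(4) r3(2)] lipschitz_on_subset[OF sD(4) r3(3)]]
    by (simp add: o_def mult.commute)
  then show "\<exists>r>0. \<exists>C. C-lipschitz_on (ball x r) (\<lambda>x. H (G x))" using r3 by blast
  show "H' (G x) (G' x (t *\<^sub>R d)) = t *\<^sub>R H' (G x) (G' x d)" if "0 \<le> t" for t d
    using semismooth_on_scale[OF G x that] semismooth_on_scale[OF H UV[OF x] that] by simp
  define k where "k d = G (x + d) - G x" for d
  have k: "\<forall>\<^sub>F d in nhds 0. norm (k d) \<le> C * norm d"
    using eventually_nhds_0_ball[OF rC(1), of x]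
  proof eventually_elim
    case (elim d)
    then show ?case using rC(1,4) lipschitz_onD[OF rC(4), of "x+d" x] by (simp add: k_def dist_norm)
  qed
  have kG: "little_o (\<lambda>d. k d - G' x d)" using semismooth_on_bdiff[OF G x] by (simp add: k_def)
  have 1: "little_o (\<lambda>d. H (G x + k d) - H (G x) - H' (G x) (k d))"
    using little_o_compose[OF semismooth_on_bdiff[OF H UV[OF x]] k] .
  have 2: "little_o (\<lambda>d. H' (G x) (k d) - H' (G x) (G' x d))"
    by (rule little_o_dom[OF kG, of _ D]) (use sD in auto)
  from little_o_add[OF 1 2]
  show "little_o (\<lambda>d. H (G (x + d)) - H (G x) - H' (G x) (G' x d))" by (simp add: k_def)
  have 3: "little_o (\<lambda>d. H' (G x + k d) (k d) - H' (G x) (k d))"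
    using little_o_compose[OF semismooth_on_semi[OF H UV[OF x]] k] .
  \<comment> \<open>Both \<open>G' (x + d) d\<close> and \<open>k d\<close> equal
    \<open>G' x d\<close> up to o(d).\<close>
  have 4: "little_o (\<lambda>d. (G' (x + d) d - G' x d) - (k d - G' x d))"
    by (intro little_o_diff kG semismooth_on_semi[OF G x])
  \<comment> \<open>The base point \<open>G x + k d\<close> moves with \<open>d\<close>; here the
    Lipschitz constant of \<open>H'\<close> must be valid on a whole ball around
    \<open>G x\<close>.\<close>
  have 5: "little_o (\<lambda>d. H' (G x + k d) (G' (x + d) d) - H' (G x + k d) (k d))"
  proof (rule little_o_dom[OF 4, of _ D])
    show "\<forall>\<^sub>F d in nhds 0. norm (H' (G x + k d) (G' (x + d) d) - H' (G x + k d) (k d))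
        \<le> D * norm (G' (x + d) d - G' x d - (k d - G' x d))"
      using eventually_nhds_0_ball[OF r3(1), of x]
    proof eventually_elim
      case (elim d)
      then have "G (x + d) \<in> ball (G x) s" using r3(3) by blast
      then have "G x + k d \<in> ball (G x) s" by (simp add: k_def)
      then show ?case using sD(5)[of "G x + k d"] by auto
    qed
  qed
  from little_o_add[OF little_o_add[OF 5 3] 2]
  show "little_o (\<lambda>d. H' (G (x + d)) (G' (x + d) d) - H' (G x) (G' x d))" by (simp add: k_def)
qed

section \<open>Building blocks: pairs, affine, bilinear and continuously differentiable maps\<close>

lemma lipschitz_on_Pair:
  assumes "C-lipschitz_on S G" "D-lipschitz_on S H"
  shows "(C + D)-lipschitz_on S (\<lambda>x. (G x, H x))"
proof (rule lipschitz_onI)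
  fix x y assume xy: "x \<in> S" "y \<in> S"
  have "dist (G x, H x) (G y, H y) \<le> dist (G x) (G y) + dist (H x) (H y)"
    by (simp add: dist_Pair_Pair sqrt_sum_squares_le_sum)
  also have "\<dots> \<le> C * dist x y + D * dist x y" using assms xy by (auto simp: lipschitz_on_def intro!: add_mono)
  finally show "dist (G x, H x) (G y, H y) \<le> (C + D) * dist x y" by (simp add: algebra_simps)
qed (use lipschitz_on_nonneg[OF assms(1)] lipschitz_on_nonneg[OF assms(2)] in simp)

lemma semismooth_on_Pair:
  assumes G: "semismooth_on U G G'" and H: "semismooth_on U H H'"
  shows "semismooth_on U (\<lambda>x. (G x, H x)) (\<lambda>x d. (G' x d, H' x d))"
proof (rule semismooth_onI)
  show "open U" using semismooth_on_open[OF G] .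
  fix x assume x: "x \<in> U"
  obtain r C where r: "r > 0" "C-lipschitz_on (ball x r) G" using semismooth_on_lipschitz[OF G x] by auto
  obtain s D where s: "s > 0" "D-lipschitz_on (ball x s) H" using semismooth_on_lipschitz[OF H x] by auto
  have "(C + D)-lipschitz_on (ball x (min r s)) (\<lambda>x. (G x, H x))"
    by (rule lipschitz_on_Pair) (auto intro: lipschitz_on_subset[OF r(2)] lipschitz_on_subset[OF s(2)])
  then show "\<exists>r>0. \<exists>C. C-lipschitz_on (ball x r) (\<lambda>x. (G x, H x))"
    using r s by (intro exI[of _ "min r s"]) auto
  show "(G' x (t *\<^sub>R d), H' x (t *\<^sub>R d)) = t *\<^sub>R (G' x d, H' x d)" if "0 \<le> t" for t d
    using semismooth_on_scale[OF G x that] semismooth_on_scale[OF H x that] by simp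
  show "little_o (\<lambda>d. (G (x + d), H (x + d)) - (G x, H x) - (G' x d, H' x d))"
    using little_o_Pair[OF semismooth_on_bdiff[OF G x] semismooth_on_bdiff[OF H x]] by simp
  show "little_o (\<lambda>d. (G' (x + d) d, H' (x + d) d) - (G' x d, H' x d))"
    using little_o_Pair[OF semismooth_on_semi[OF G x] semismooth_on_semi[OF H x]] by simp
qed

lemma semismooth_on_bounded_linear:
  assumes "bounded_linear T" shows "semismooth_on UNIV T (\<lambda>x. T)"
proof -
  interpret bounded_linear T by fact
  obtain K where K: "\<And>x. norm (T x) \<le> norm x * K" "K > 0" using pos_bounded by blast
  have "K-lipschitz_on UNIV T"
    using K by (intro lipschitz_onI) (auto simp: dist_norm mult.commute simp flip: diff)
  then have "\<exists>r>0. \<exists>C. C-lipschitz_on (ball x r) T" for x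
    using lipschitz_on_subset[OF _ subset_UNIV] zero_less_one by blast
  then show ?thesis
    by (intro semismooth_onI) (simp_all add: scaleR add little_o_def)
qed

lemma semismooth_on_affine:
  assumes "bounded_linear T" shows "semismooth_on UNIV (\<lambda>x. T x + a) (\<lambda>x. T)"
proof -
  have "1-lipschitz_on (ball x 1) (\<lambda>x. x + a)" for x by (rule lipschitz_onI) auto
  then have *: "\<exists>r>0. \<exists>C. C-lipschitz_on (ball x r) (\<lambda>x. x + a)" for x
    using zero_less_one by blast
  have "semismooth_on UNIV (\<lambda>x. x + a) (\<lambda>x d. d)"
    by (intro semismooth_onI *) (simp_all add: little_o_def)
  from semismooth_on_compose[OF semismooth_on_bounded_linear[OF assms] this] show ?thesis by simp
qed

text \<open>Both remainders are quadratic: the expansion leaves \<open>T u v\<close>, and moving the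
  base point by \<open>(u, v)\<close> changes the derivative in direction \<open>(u, v)\<close> by
  twice \<open>T u v\<close>.\<close>

lemma semismooth_on_bounded_bilinear:
  assumes "bounded_bilinear T"
  shows "semismooth_on UNIV (\<lambda>(a, b). T a b) (\<lambda>(a, b) (u, v). T a v + T u b)"
proof -
  interpret bounded_bilinear T by fact
  obtain K where K: "\<And>a b. norm (T a b) \<le> norm a * norm b * K" "K > 0" using pos_bounded by blast
  have q: "norm (T u v) \<le> K * (norm (u, v))\<^sup>2" for u v
  proof -
    have "norm (T u v) \<le> norm u * norm v * K" by (rule K)
    also have "\<dots> \<le> norm (u,v) * norm (u,v) * K"
      using K(2) by (intro mult_right_mono mult_mono) (auto simp: norm_Pair)
    finally show ?thesis by (simp add: power2_eq_square mult_ac)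
  qed
  show ?thesis
  proof (rule semismooth_onI)
    fix x :: "'a \<times> 'b"
    obtain a b where x: "x = (a, b)" by fastforce
    let ?M = "K * (norm a + norm b + 1) * 2"
    have "?M-lipschitz_on (ball x 1) (\<lambda>(a, b). T a b)"
    proof (rule lipschitz_onI)
      fix y z assume "y \<in> ball x 1" "z \<in> ball x 1"
      obtain a1 b1 a2 b2 where yz: "y = (a1, b1)" "z = (a2, b2)" by fastforce
      have "dist a a1 \<le> dist x y" "dist b b2 \<le> dist x z"
        unfolding x yz by (auto simp: dist_Pair_Pair)
      then have n: "norm a1 \<le> norm a + 1" "norm b2 \<le> norm b + 1"
        using \<open>y \<in> ball x 1\<close> \<open>z \<in> ball x 1\<close> norm_triangle_ineq2[of a1 a] norm_triangle_ineq2[of b2 b]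
        by (auto simp: dist_norm norm_minus_commute)
      have "T a1 b1 - T a2 b2 = T a1 (b1 - b2) + T (a1 - a2) b2" by (simp add: diff_left diff_right)
      then have "norm (T a1 b1 - T a2 b2) \<le> norm a1 * norm (b1 - b2) * K + norm (a1 - a2) * norm b2 * K"
        by (metis K(1) add_mono norm_triangle_le)
      also have "\<dots> \<le> (norm a + 1) * dist y z * K + dist y z * (norm b + 1) * K"
        using n K(2) norm_fst_le[of "a1 - a2" "b1 - b2"] norm_snd_le[of "b1 - b2" "a1 - a2"]
        by (intro add_mono mult_right_mono mult_mono) (auto simp: yz dist_norm)
      also have "\<dots> = K * (norm a + norm b + 2) * dist y z" by (simp add: algebra_simps)
      also have "\<dots> \<le> ?M * dist y z" using K(2) by (intro mult_right_mono) (auto simp: algebra_simps)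
      finally show "dist (case y of (a, b) \<Rightarrow> T a b) (case z of (a, b) \<Rightarrow> T a b) \<le> ?M * dist y z"
        by (simp add: yz dist_norm)
    qed (use K in auto)
    then show "\<exists>r>0. \<exists>C. C-lipschitz_on (ball x r) (\<lambda>(a, b). T a b)" using zero_less_one by blast
    show "(case x of (a, b) \<Rightarrow> \<lambda>(u, v). T a v + T u b) (t *\<^sub>R d)
        = t *\<^sub>R (case x of (a, b) \<Rightarrow> \<lambda>(u, v). T a v + T u b) d" for t d
      by (auto simp: x scaleR_right scaleR_left scaleR_add_right split: prod.split)
    show "little_o (\<lambda>d. (case x + d of (a, b) \<Rightarrow> T a b) - (case x of (a, b) \<Rightarrow> T a b)
        - (case x of (a, b) \<Rightarrow> \<lambda>(u, v). T a v + T u b) d)"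
      by (rule little_o_quadratic[of _ K]) (use q in \<open>auto simp: x add_left add_right\<close>)
    show "little_o (\<lambda>d. (case x + d of (a, b) \<Rightarrow> \<lambda>(u, v). T a v + T u b) d
        - (case x of (a, b) \<Rightarrow> \<lambda>(u, v). T a v + T u b) d)"
      by (rule little_o_quadratic[of _ "2 * K"])
        (use q in \<open>auto simp: x add_left add_right intro!: norm_triangle_le\<close>)
  qed simp
qed

lemma semismooth_on_C1:
  fixes G' :: "'a::real_normed_vector \<Rightarrow> 'a \<Rightarrow>\<^sub>L 'b::real_normed_vector"
  assumes d: "\<And>x. (G has_derivative G' x) (at x)" and c: "continuous_on UNIV G'"
  shows "semismooth_on UNIV G (\<lambda>x. G' x)"
proof (rule semismooth_onI)
  fix x :: 'a
  have ic: "isCont G' x" using c by (simp add: continuous_on_eq_continuous_at)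
  have near: "\<exists>r>0. \<forall>z\<in>ball x r. norm (G' z - G' x) \<le> e" if "e > 0" for e
  proof -
    from ic that obtain s where "s > 0" "\<And>z. dist z x < s \<Longrightarrow> dist (G' z) (G' x) < e"
      unfolding continuous_at_eps_delta by blast
    then show ?thesis by (intro exI[of _ s]) (force simp: dist_norm norm_minus_commute less_imp_le)
  qed
  obtain r where r: "r > 0" "\<And>z. z \<in> ball x r \<Longrightarrow> norm (G' z - G' x) \<le> 1" using near[of 1] by auto
  have b: "norm (G' z) \<le> norm (G' x) + 1" if "z \<in> ball x r" for z
    using r(2)[OF that] norm_triangle_ineq2[of "G' z" "G' x"] by simp
  have "(norm (G' x) + 1)-lipschitz_on (ball x r) G"
    by (rule bounded_derivative_imp_lipschitz[of _ _ "\<lambda>z. blinfun_apply (G' z)"])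
      (use d b in \<open>auto intro: has_derivative_at_withinI simp flip: norm_blinfun.rep_eq\<close>)
  then show "\<exists>r>0. \<exists>C. C-lipschitz_on (ball x r) G" using r(1) by blast
  show "little_o (\<lambda>d. G (x + d) - G x - blinfun_apply (G' x) d)"
    by (rule has_derivative_imp_little_o[OF d])
  show "little_o (\<lambda>d. blinfun_apply (G' (x + d)) d - blinfun_apply (G' x) d)"
    unfolding little_o_def
  proof (intro allI impI)
    fix e :: real assume "e > 0"
    with near obtain s where s: "s > 0" "\<And>z. z \<in> ball x s \<Longrightarrow> norm (G' z - G' x) \<le> e" by blast
    show "\<forall>\<^sub>F d in nhds 0. norm (blinfun_apply (G' (x + d)) d - blinfun_apply (G' x) d) \<le> e * norm d"
      using eventually_nhds_0_ball[OF s(1), of x]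
    proof eventually_elim
      case (elim d)
      have "norm ((G' (x+d) - G' x) d) \<le> norm (G' (x + d) - G' x) * norm d" by (rule norm_blinfun)
      also have "\<dots> \<le> e * norm d" using s(2)[OF elim] by (intro mult_right_mono) auto
      finally show ?case by (simp add: blinfun.diff_left)
    qed
  qed
qed (auto simp: blinfun.scaleR_right)

section \<open>Differentiability of directionally differentiable maps\<close>

text \<open>The set \<open>S\<close> where \<open>H\<close> lies above the line of slope
  \<open>- e\<close> through \<open>(a, H a)\<close> is closed. At its supremum a nonnegative right
  derivative would allow a further step to the right unless the supremum is \<open>b\<close>; the
  slope \<open>- e\<close> supplies the strictness that a vanishing derivative lacks.\<close>

lemma right_deriv_nonneg_imp_le:
  fixes H :: "real \<Rightarrow> real"
  assumes ab: "a \<le> b" and c: "continuous_on {a..b} H"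
    and d: "\<And>s. a \<le> s \<Longrightarrow> s < b \<Longrightarrow> \<exists>l\<ge>0. ((\<lambda>t. (H (s + t) - H s) /\<^sub>R t) \<longlongrightarrow> l) (at_right 0)"
  shows "H a \<le> H b"
proof (rule field_le_epsilon)
  fix e' :: real assume e': "e' > 0"
  \<comment> \<open>The total loss \<open>e * (b - a)\<close> must not exceed \<open>e'\<close>; the
    added 1 covers \<open>a = b\<close>.\<close>
  define e where "e = e' / (b - a + 1)"
  have e: "e > 0" "e * (b - a) \<le> e'" using e' ab by (auto simp: e_def field_simps)
  define S where "S = {s \<in> {a..b}. H a - e * (s - a) \<le> H s}"
  have "closed S" unfolding S_def by (intro continuous_on_closed_Collect_le continuous_intros c)
  moreover have aS: "a \<in> S" using ab by (simp add: S_def)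
  moreover have bd: "bdd_above S" by (auto simp: S_def)
  ultimately have m: "Sup S \<in> S" using closed_contains_Sup[of S] by blast
  have "Sup S = b"
  proof (rule ccontr)
    assume "Sup S \<noteq> b"
    define s where "s = Sup S"
    have s: "a \<le> s" "s < b" "H a - e * (s - a) \<le> H s"
      using m \<open>Sup S \<noteq> b\<close> by (auto simp: S_def s_def)
    from d[OF s(1,2)] obtain l where l: "l \<ge> 0" "((\<lambda>t. (H (s + t) - H s) /\<^sub>R t) \<longlongrightarrow> l) (at_right 0)" by blast
    have "\<forall>\<^sub>F t in at_right 0. - e < (H (s + t) - H s) /\<^sub>R t"
      using order_tendstoD(1)[OF l(2), of "-e"] l(1) e(1) by simp
    moreover have "\<forall>\<^sub>F t in at_right 0. t < b - s"
      using s eventually_at_right_field by (metis diff_gt_0_iff_gt)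
    ultimately have "\<forall>\<^sub>F t in at_right 0. s + t \<in> S \<and> t > 0"
      using eventually_at_right_less[of "0::real"]
    proof eventually_elim
      case (elim t)
      then have "- e * t < H (s + t) - H s" by (simp add: field_simps)
      with s elim show ?case by (auto simp: S_def algebra_simps)
    qed
    then obtain t where "s + t \<in> S" "t > 0"
      using eventually_happens'[OF trivial_limit_at_right_real] by blast
    with cSup_upper[OF _ bd, of "s + t"] show False by (simp add: s_def)
  qed
  with m have "H a - e * (b - a) \<le> H b" by (simp add: S_def)
  with e show "H a \<le> H b + e'" by linarith
qed

text \<open>The vector case reduces to the scalar one by testing with the defect \<open>w\<close>
  itself: monotonicity of \<open>\<phi>\<close> gives
  \<open>w \<bullet> w \<le> norm w * (e * (b - a))\<close>, and one factor \<open>norm w\<close>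
  cancels.\<close>

lemma right_deriv_increment_bound:
  fixes H :: "real \<Rightarrow> 'b::real_inner"
  assumes ab: "a \<le> b" and c: "continuous_on {a..b} H"
    and d: "\<And>s. a \<le> s \<Longrightarrow> s < b \<Longrightarrow>
      \<exists>l. norm (l - v) \<le> e \<and> ((\<lambda>t. (H (s + t) - H s) /\<^sub>R t) \<longlongrightarrow> l) (at_right 0)"
  shows "norm (H b - H a - (b - a) *\<^sub>R v) \<le> e * (b - a)"
proof -
  define w where "w = H b - H a - (b - a) *\<^sub>R v"
  define \<phi> where "\<phi> s = e * norm w * s - w \<bullet> (H s - s *\<^sub>R v)" for s
  have "\<phi> a \<le> \<phi> b"
  proof (rule right_deriv_nonneg_imp_le[OF ab])
    show "continuous_on {a..b} \<phi>" unfolding \<phi>_def by (intro continuous_intros c)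
    fix s assume s: "a \<le> s" "s < b"
    then obtain l where l: "norm (l - v) \<le> e" "((\<lambda>t. (H (s + t) - H s) /\<^sub>R t) \<longlongrightarrow> l) (at_right 0)"
      using d by blast
    have "w \<bullet> (l - v) \<le> norm w * norm (l - v)" by (rule norm_cauchy_schwarz)
    also have "\<dots> \<le> e * norm w" using mult_left_mono[OF l(1), of "norm w"] by (simp add: mult.commute)
    finally have 1: "0 \<le> e * norm w - w \<bullet> (l - v)" by simp
    have "((\<lambda>t. e * norm w - w \<bullet> ((H (s + t) - H s) /\<^sub>R t - v)) \<longlongrightarrow> e * norm w - w \<bullet> (l - v)) (at_right 0)"
      by (intro tendsto_intros l)
    moreover have "\<forall>\<^sub>F t in at_right (0::real). (\<phi> (s + t) - \<phi> s) /\<^sub>R t = e * norm w - w \<bullet> ((H (s + t) - H s) /\<^sub>R t - v)"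
      using eventually_at_right_less[of "0::real"]
      by eventually_elim (simp add: \<phi>_def inner_diff_right inner_add_right field_simps)
    ultimately have "((\<lambda>t. (\<phi> (s + t) - \<phi> s) /\<^sub>R t) \<longlongrightarrow> e * norm w - w \<bullet> (l - v)) (at_right 0)"
      by (subst tendsto_cong)
    with 1 show "\<exists>l\<ge>0. ((\<lambda>t. (\<phi> (s + t) - \<phi> s) /\<^sub>R t) \<longlongrightarrow> l) (at_right 0)" by blast
  qed
  then have "w \<bullet> w \<le> norm w * (e * (b - a))"
    by (simp add: \<phi>_def w_def inner_diff_right algebra_simps)
  then have "norm w * norm w \<le> norm w * (e * (b - a))" by (simp add: dot_square_norm power2_eq_square)
  \<comment> \<open>For \<open>w = 0\<close> nothing can be cancelled and the right-hand side must
    be nonnegative; if \<open>a < b\<close>, the sign of \<open>e\<close> follows from the existence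
    of a derivative at \<open>a\<close>.\<close>
  moreover have "0 \<le> e * (b - a)"
  proof (cases "a < b")
    case True
    with d[of a] obtain l where "norm (l - v) \<le> e" by auto
    then have "0 \<le> e" using norm_ge_zero order_trans by blast
    then show ?thesis using ab by simp
  qed (use ab in auto)
  ultimately show ?thesis unfolding w_def[symmetric]
    by (cases "w = 0") auto
qed

text \<open>Every point of a closed ball lies in some closed set \<open>E N\<close>, on which the
  tail of the sequence varies by at most \<open>e / 4\<close>. By Baire some \<open>E N\<close> has
  interior; there \<open>D\<close> is within \<open>e / 4\<close> of the single continuous function
  \<open>q N\<close>, hence nearly constant on a small ball.\<close>

lemma Baire_one_oscillation:
  fixes q :: "nat \<Rightarrow> 'a::euclidean_space \<Rightarrow> 'b::metric_space"
  assumes q: "\<And>n. continuous_on UNIV (q n)" and lim: "\<And>x. (\<lambda>n. q n x) \<longlonglongrightarrow> D x" and e: "e > 0"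
  shows "closure (\<Union>{U. open U \<and> (\<forall>u\<in>U. \<forall>v\<in>U. dist (D u) (D v) \<le> e)}) = UNIV"
proof -
  let ?O = "\<Union>{U. open U \<and> (\<forall>u\<in>U. \<forall>v\<in>U. dist (D u) (D v) \<le> e)}"
  have "\<exists>y\<in>?O. dist y x0 < s" if s: "s > 0" for x0 s
  proof -
    define E where "E N = (cball x0 (s/2)) \<inter> (\<Inter>m\<in>{N..}. \<Inter>n\<in>{N..}. {x. dist (q m x) (q n x) \<le> e/4})" for N
    have cl: "closed (E N)" for N
      unfolding E_def by (intro closed_Int closed_INT ballI closed_cball closed_Collect_le continuous_intros q)
    have un: "(\<Union>N. E N) = cball x0 (s/2)"
    proof
      show "cball x0 (s/2) \<subseteq> (\<Union>N. E N)"
      proof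
        fix x assume x: "x \<in> cball x0 (s/2)"
        have "Cauchy (\<lambda>n. q n x)" using lim LIMSEQ_imp_Cauchy by blast
        then obtain N where "\<And>m n. m \<ge> N \<Longrightarrow> n \<ge> N \<Longrightarrow> dist (q m x) (q n x) < e/4"
          using e unfolding Cauchy_def by (meson divide_pos_pos zero_less_numeral)
        then have "x \<in> E N" using x by (auto simp: E_def intro: less_imp_le)
        then show "x \<in> (\<Union>N. E N)" by blast
      qed
    qed (auto simp: E_def)
    obtain N where N: "interior (E N) \<noteq> {}"
    proof (rule ccontr)
      assume "\<not> thesis"
      with that have i: "\<And>N. interior (E N) = {}" by blast
      \<comment> \<open>If every \<open>E N\<close> had empty interior, the intersection of the
        complements would be dense; but it misses a ball around \<open>x0\<close>.\<close>
      have "UNIV \<subseteq> closure (\<Inter>(range (\<lambda>N. - E N)))"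
        by (rule Baire) (use cl i in \<open>auto simp: closure_complement\<close>)
      also have "\<Inter>(range (\<lambda>N. - E N)) = - cball x0 (s/2)" unfolding un[symmetric] by blast
      finally have "UNIV \<subseteq> - ball x0 (s/2)" by (simp add: closure_complement)
      then have "x0 \<in> - ball x0 (s/2)" by blast
      with s show False by simp
    qed
    then obtain x1 where x1: "x1 \<in> interior (E N)" by blast
    then have "\<exists>r>0. ball x1 r \<subseteq> E N" by (simp add: mem_interior)
    then obtain r1 where r1: "r1 > 0" "ball x1 r1 \<subseteq> E N" by blast
    have "isCont (q N) x1" using q by (simp add: continuous_on_eq_continuous_at)
    then obtain r2 where r2: "r2 > 0" "\<And>u. dist u x1 < r2 \<Longrightarrow> dist (q N u) (q N x1) < e/4"
      using e unfolding continuous_at_eps_delta by (meson divide_pos_pos zero_less_numeral)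
    define r where "r = min r1 r2"
    have r: "r > 0" using r1 r2 by (simp add: r_def)
    have near: "dist (D u) (q N x1) \<le> e/2" if "u \<in> ball x1 r" for u
    proof -
      have u: "u \<in> E N" "dist u x1 < r2" using that r1 by (auto simp: r_def dist_commute)
      have "dist (D u) (q N u) \<le> e/4"
      proof (rule LIMSEQ_le_const2[of "\<lambda>n. dist (q n u) (q N u)"])
        show "(\<lambda>n. dist (q n u) (q N u)) \<longlonglongrightarrow> dist (D u) (q N u)" by (intro tendsto_intros lim)
      qed (use u(1) in \<open>auto simp: E_def\<close>)
      moreover have "dist (q N u) (q N x1) < e/4" by (rule r2(2)[OF u(2)])
      ultimately show ?thesis using dist_triangle[of "D u" "q N x1" "q N u"] by simp
    qed
    have "dist (D u) (D v) \<le> e" if "u \<in> ball x1 r" "v \<in> ball x1 r" for u v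
      using near[OF that(1)] near[OF that(2)] dist_triangle2[of "D u" "D v" "q N x1"] by simp
    then have "x1 \<in> ?O" using r by (intro UnionI[of "ball x1 r"]) auto
    moreover have "dist x1 x0 < s"
      using x1 interior_subset[of "E N"] s by (auto simp: E_def dist_commute)
    ultimately show ?thesis by blast
  qed
  then show ?thesis unfolding closure_approachable set_eq_iff by simp
qed

text \<open>Only right-hand derivatives in the positive coordinate directions are given, continuous
  at the one point \<open>x\<close>. The increment of \<open>G\<close> is telescoped over the
  coordinates, and each step is compared with the constant vector \<open>D i x\<close> by the mean
  value inequality.\<close>

lemma differentiable_if_partials_continuous:
  fixes G :: "'a::euclidean_space \<Rightarrow> 'b::real_inner"
  assumes cont: "continuous_on UNIV G" and dd: "\<And>y i. i \<in> Basis \<Longrightarrow> has_dir_deriv G y i (D i y)"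
    and near: "\<And>e i. e > 0 \<Longrightarrow> i \<in> Basis \<Longrightarrow> \<exists>r>0. \<forall>z\<in>ball x r. norm (D i z - D i x) \<le> e"
  shows "G differentiable (at x)"
proof -
  have step: "norm (G (y + a *\<^sub>R i) - G y - a *\<^sub>R v) \<le> e * \<bar>a\<bar>"
    if i: "i \<in> Basis" and B: "\<And>z. z \<in> closed_segment y (y + a *\<^sub>R i) \<Longrightarrow> norm (D i z - v) \<le> e" for y a i v e
  proof -
    have pos: "norm (G (y + a *\<^sub>R i) - G y - a *\<^sub>R v) \<le> e * a"
      if a: "a \<ge> 0" and B: "\<And>z. z \<in> closed_segment y (y + a *\<^sub>R i) \<Longrightarrow> norm (D i z - v) \<le> e" for y a
    proof -
      have "norm (G (y + a *\<^sub>R i) - G (y + 0 *\<^sub>R i) - (a - 0) *\<^sub>R v) \<le> e * (a - 0)"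
      proof (rule right_deriv_increment_bound[OF a])
        show "continuous_on {0..a} (\<lambda>s. G (y + s *\<^sub>R i))"
          by (rule continuous_on_compose2[OF cont]) (auto intro!: continuous_intros)
        fix s assume s: "0 \<le> s" "s < a"
        have "y + s *\<^sub>R i \<in> closed_segment y (y + a *\<^sub>R i)"
          unfolding in_segment using s by (intro exI[of _ "s/a"]) (auto simp: algebra_simps)
        from B[OF this] dd[OF i, of "y + s *\<^sub>R i"]
        show "\<exists>l. norm (l - v) \<le> e \<and> ((\<lambda>t. (G (y + (s + t) *\<^sub>R i) - G (y + s *\<^sub>R i)) /\<^sub>R t) \<longlongrightarrow> l) (at_right 0)"
          unfolding has_dir_deriv_def by (auto simp: scaleR_add_left add.assoc)
      qed
      then show ?thesis by simp
    qed
    show ?thesis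
    proof (cases "a \<ge> 0")
      case True with pos[OF True B] show ?thesis by simp
    next
      \<comment> \<open>A negative step is traversed from its other end, since the given derivatives
        are right-hand ones.\<close>
      case False
      have "norm (G ((y + a *\<^sub>R i) + (-a) *\<^sub>R i) - G (y + a *\<^sub>R i) - (-a) *\<^sub>R v) \<le> e * (-a)"
        by (rule pos) (use False B in \<open>auto simp: closed_segment_commute\<close>)
      then have "norm (G y - G (y + a *\<^sub>R i) + a *\<^sub>R v) \<le> e * \<bar>a\<bar>" using False by simp
      moreover have "norm (G y - G (y + a *\<^sub>R i) + a *\<^sub>R v) = norm (G (y + a *\<^sub>R i) - G y - a *\<^sub>R v)"
        by (subst norm_minus_cancel[symmetric]) (simp add: algebra_simps)
      ultimately show ?thesis by simp
    qed
  qed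
  define T where "T d = (\<Sum>i\<in>Basis. (d \<bullet> i) *\<^sub>R D i x)" for d
  have bl: "bounded_linear T"
    unfolding T_def by (intro bounded_linear_sum bounded_linear_compose[OF bounded_linear_scaleR_left] bounded_linear_inner_left)
  have "(G has_derivative T) (at x)"
    unfolding has_derivative_at_alt
  proof (intro conjI bl allI impI)
    fix e :: real assume e: "e > 0"
    define n where "n = real DIM('a)"
    have n: "n > 0" by (simp add: n_def)
    have "\<forall>i\<in>Basis. \<exists>r>0. \<forall>z\<in>ball x r. norm (D i z - D i x) \<le> e / n"
      using near[of "e/n"] e n by simp
    then obtain R where R: "\<And>i. i \<in> Basis \<Longrightarrow> R i > 0"
      "\<And>i z. i \<in> Basis \<Longrightarrow> z \<in> ball x (R i) \<Longrightarrow> norm (D i z - D i x) \<le> e / n" by metis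
    define r where "r = Min (R ` (Basis :: 'a set))"
    have r: "r > 0" "\<And>i. i \<in> Basis \<Longrightarrow> r \<le> R i"
      using R(1) by (auto simp: r_def)
    have near': "norm (D i z - D i x) \<le> e / n" if "i \<in> Basis" "z \<in> ball x r" for i z
      using R(2)[OF that(1)] r(2)[OF that(1)] that(2) by auto
    \<comment> \<open>The coordinates of \<open>d\<close> sum to at most
      \<open>n * norm d < r\<close> in absolute value, so every partial sum of coordinate steps
      stays in \<open>ball x r\<close>.\<close>
    have "norm (G (x + d) - G x - T d) \<le> e * norm d" if d: "norm d < r / n" for d
    proof -
      let ?p = "\<lambda>S. \<Sum>i\<in>S. (d \<bullet> i) *\<^sub>R i"
      have tot: "(\<Sum>i\<in>Basis. \<bar>d \<bullet> i\<bar>) \<le> n * norm d"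
        using sum_bounded_above[of Basis "\<lambda>i. \<bar>d \<bullet> i\<bar>" "norm d"] by (simp add: Basis_le_norm n_def)
      have nsum: "norm (?p S) \<le> (\<Sum>i\<in>S. \<bar>d \<bullet> i\<bar>)" if "S \<subseteq> Basis" for S
        by (rule sum_norm_le) (use that in auto)
      have inb: "x + ?p S \<in> ball x r" if "S \<subseteq> Basis" for S
      proof -
        have "norm (?p S) \<le> (\<Sum>i\<in>Basis. \<bar>d \<bullet> i\<bar>)"
          using nsum[OF that] sum_mono2[of Basis S "\<lambda>i. \<bar>d \<bullet> i\<bar>"] that by simp
        also have "\<dots> \<le> n * norm d" by (rule tot)
        also have "\<dots> < r" using d n by (simp add: field_simps)
        finally show ?thesis by (simp add: dist_norm)
      qed
      have "norm (G (x + ?p S) - G x - (\<Sum>i\<in>S. (d \<bullet> i) *\<^sub>R D i x)) \<le> e / n * (\<Sum>i\<in>S. \<bar>d \<bullet> i\<bar>)"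
        if "S \<subseteq> Basis" for S
        using finite_subset[OF that finite_Basis] that
      proof (induction S rule: finite_induct)
        case (insert i S)
        let ?y = "x + ?p S"
        have eq: "x + ?p (insert i S) = ?y + (d \<bullet> i) *\<^sub>R i" using insert by (simp add: algebra_simps)
        have "closed_segment ?y (?y + (d \<bullet> i) *\<^sub>R i) \<subseteq> ball x r"
          by (rule closed_segment_subset) (use inb[of S] inb[of "insert i S"] insert.prems eq in auto)
        then have "norm (G (?y + (d \<bullet> i) *\<^sub>R i) - G ?y - (d \<bullet> i) *\<^sub>R D i x) \<le> e / n * \<bar>d \<bullet> i\<bar>"
          using insert.prems by (intro step near') auto
        moreover have "norm (G ?y - G x - (\<Sum>i\<in>S. (d \<bullet> i) *\<^sub>R D i x)) \<le> e / n * (\<Sum>i\<in>S. \<bar>d \<bullet> i\<bar>)"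
          using insert by auto
        ultimately have "norm ((G (?y + (d \<bullet> i) *\<^sub>R i) - G ?y - (d \<bullet> i) *\<^sub>R D i x) + (G ?y - G x - (\<Sum>i\<in>S. (d \<bullet> i) *\<^sub>R D i x)))
           \<le> e / n * \<bar>d \<bullet> i\<bar> + e / n * (\<Sum>i\<in>S. \<bar>d \<bullet> i\<bar>)" by (intro norm_triangle_mono)
        then show ?case unfolding eq using insert.hyps by (simp add: algebra_simps)
      qed simp
      from this[of Basis] have "norm (G (x + d) - G x - T d) \<le> e / n * (\<Sum>i\<in>Basis. \<bar>d \<bullet> i\<bar>)"
        by (simp add: euclidean_representation T_def)
      also have "\<dots> \<le> e / n * (n * norm d)" using tot e n by (intro mult_left_mono) auto
      finally show ?thesis using n by simp
    qed
    then show "\<exists>s>0. \<forall>y. norm (y - x) < s \<longrightarrow> norm (G y - G x - T (y - x)) \<le> e * norm (y - x)"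
      using r n by (intro exI[of _ "r / n"]) (metis add_diff_cancel_left' add_diff_eq divide_pos_pos add.commute)
  qed
  then show ?thesis by (auto simp: differentiable_def)
qed

text \<open>A substitute for Rademacher's theorem: the one-sided partial derivatives are pointwise limits
  of difference quotients, hence have a dense set of common continuity points.\<close>
lemma dense_differentiable:
  fixes G :: "'a::euclidean_space \<Rightarrow> 'b::real_inner"
  assumes cont: "continuous_on UNIV G" and dd: "\<And>y. dir_differentiable G y" and s: "s > 0"
  shows "\<exists>z\<in>ball x s. G differentiable (at z)"
proof -
  define D where "D i y = dir_deriv G y i" for i y
  have D: "has_dir_deriv G y i (D i y)" for y i
    using dd[of y] dir_deriv_eq unfolding dir_differentiable_def D_def by metis
  define \<O> where "\<O> = (\<lambda>(i, k::nat). \<Union>{U. open U \<and> (\<forall>u\<in>U. \<forall>v\<in>U. dist (D i u) (D i v) \<le> inverse (Suc k))})"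
  have dense: "closure (\<O> (i, k)) = UNIV" for i k
    unfolding \<O>_def prod.case
  proof (rule Baire_one_oscillation)
    fix n show "continuous_on UNIV (\<lambda>y. (G (y + inverse (Suc n) *\<^sub>R i) - G y) /\<^sub>R inverse (Suc n))"
      by (intro continuous_intros continuous_on_compose2[OF cont]) auto
  next
    fix y
    have "filterlim (\<lambda>n. inverse (real (Suc n))) (at_right 0) sequentially"
      unfolding filterlim_at using LIMSEQ_inverse_real_of_nat by (auto simp: eventually_sequentially)
    from filterlim_compose[OF D[of y i, unfolded has_dir_deriv_def] this]
    show "(\<lambda>n. (G (y + inverse (Suc n) *\<^sub>R i) - G y) /\<^sub>R inverse (Suc n)) \<longlonglongrightarrow> D i y" .
  qed simp
  have op: "open (\<O> ik)" for ik unfolding \<O>_def by (auto split: prod.split)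
  \<comment> \<open>Countably many open dense sets, one for each coordinate and each tolerance
    \<open>1 / (k + 1)\<close>; at a point of all of them every partial derivative is
    continuous.\<close>
  have "UNIV \<subseteq> closure (\<Inter>(\<O> ` (Basis \<times> UNIV)))"
    by (rule Baire) (use dense op in \<open>auto intro: countable_finite intro!: countable_image countable_SIGMA\<close>)
  then have "x \<in> closure (\<Inter>(\<O> ` (Basis \<times> UNIV)))" by auto
  then obtain z where z: "z \<in> \<Inter>(\<O> ` (Basis \<times> UNIV))" "dist z x < s"
    using s unfolding closure_approachable by blast
  have "G differentiable (at z)"
  proof (rule differentiable_if_partials_continuous[OF cont D])
    fix e :: real and i :: 'a assume e: "e > 0" and i: "i \<in> Basis"
    obtain k where k: "inverse (real (Suc k)) < e" using reals_Archimedean[OF e] by blast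
    have "z \<in> \<O> (i, k)" using z i by blast
    then obtain U where U: "open U" "z \<in> U" "\<And>u v. u \<in> U \<Longrightarrow> v \<in> U \<Longrightarrow> dist (D i u) (D i v) \<le> inverse (Suc k)"
      by (auto simp: \<O>_def)
    then obtain r where r: "r > 0" "ball z r \<subseteq> U" using openE by blast
    then have "\<forall>w\<in>ball z r. norm (D i w - D i z) \<le> e"
      using U(2) U(3)[of _ z] k by (force simp: dist_norm)
    with r show "\<exists>r>0. \<forall>w\<in>ball z r. norm (D i w - D i z) \<le> e" by blast
  qed
  with z show ?thesis by (auto simp: dist_commute)
qed

section \<open>The B-subdifferential and semismoothness\<close>

lemma LIMSEQ_dist_less_inverse_Suc:
  assumes "\<And>k::nat. dist (\<xi> k) x < inverse (Suc k)" shows "\<xi> \<longlonglongrightarrow> x"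
proof -
  have "(\<lambda>k. dist (\<xi> k) x) \<longlonglongrightarrow> 0"
    by (rule tendsto_sandwich[OF _ _ tendsto_const LIMSEQ_inverse_real_of_nat])
      (use assms in \<open>auto intro!: always_eventually less_imp_le simp del: of_nat_Suc\<close>)
  then show ?thesis using tendsto_dist_iff by blast
qed

lemma eventually_in_ball:
  assumes "w \<longlonglongrightarrow> z" "z \<in> ball x r" shows "\<forall>\<^sub>F k in sequentially. w k \<in> ball x r"
  using topological_tendstoD[OF assms(1) open_ball assms(2)] .

lemma le_zero_if_le_all_mult:
  fixes a b :: real
  assumes "\<And>e. e > 0 \<Longrightarrow> a \<le> e * b" shows "a \<le> 0"
proof (rule ccontr)
  assume a: "\<not> a \<le> 0"
  define e where "e = a / (2 * (\<bar>b\<bar> + 1))"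
  have e: "e > 0" using a by (simp add: e_def add_pos_nonneg)
  have "a \<le> e * b" by (rule assms[OF e])
  also have "\<dots> \<le> e * (\<bar>b\<bar> + 1)" using e by (intro mult_left_mono) auto
  also have "\<dots> = a / 2"
    using add_nonneg_pos[of "\<bar>b\<bar>" 1] by (simp add: e_def del: distrib_left_numeral)
  finally show False using a by simp
qed

lemma Fderiv_eqI: "(G has_derivative blinfun_apply V) (at x) \<Longrightarrow> Fderiv G x = V"
  unfolding Fderiv_def by (metis blinfun_apply_inverse frechet_derivative_at)

lemma Fderiv_works:
  assumes "G differentiable (at x)" shows "(G has_derivative blinfun_apply (Fderiv G x)) (at x)"
proof -
  have d: "(G has_derivative frechet_derivative G (at x)) (at x)"
    using assms frechet_derivative_works by blast
  then show ?thesis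
    unfolding Fderiv_def by (simp add: bounded_linear_Blinfun_apply has_derivative_bounded_linear)
qed

lemma norm_Fderiv_le:
  assumes "C-lipschitz_on (ball x r) G" "z \<in> ball x r" "G differentiable (at z)"
  shows "norm (Fderiv G z) \<le> C"
proof (rule norm_blinfun_bound)
  show "C \<ge> 0" using assms(1) lipschitz_on_nonneg by blast
  fix d
  note F = has_derivative_imp_has_dir_deriv[OF Fderiv_works[OF assms(3)]]
  show "norm (Fderiv G z d) \<le> C * norm d"
    using has_dir_deriv_norm_diff_le[OF assms(1,2) F[of d] F[of 0]] by (simp add: blinfun.zero_right)
qed

text \<open>The approximation form spares diagonal sequences: closedness under moving base points
  becomes a triangle inequality.\<close>

lemma B_subdiff_iff:
  "V \<in> B_subdiff G x \<longleftrightarrow>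
    (\<forall>e>0. \<exists>\<xi>. dist \<xi> x < e \<and> G differentiable (at \<xi>) \<and> dist (Fderiv G \<xi>) V < e)"
proof
  assume "V \<in> B_subdiff G x"
  then obtain \<xi> where \<xi>: "\<xi> \<longlonglongrightarrow> x" "\<And>k. G differentiable at (\<xi> k)" "(\<lambda>k. Fderiv G (\<xi> k)) \<longlonglongrightarrow> V"
    unfolding B_subdiff_def by blast
  show "\<forall>e>0. \<exists>\<xi>. dist \<xi> x < e \<and> G differentiable (at \<xi>) \<and> dist (Fderiv G \<xi>) V < e"
  proof (intro allI impI)
    fix e :: real assume "e > 0"
    from tendstoD[OF \<xi>(1) this] tendstoD[OF \<xi>(3) this]
    have "\<forall>\<^sub>F k in sequentially. dist (\<xi> k) x < e \<and> dist (Fderiv G (\<xi> k)) V < e"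
      by eventually_elim simp
    then show "\<exists>\<xi>. dist \<xi> x < e \<and> G differentiable (at \<xi>) \<and> dist (Fderiv G \<xi>) V < e"
      using \<xi>(2) eventually_happens'[OF sequentially_bot] by blast
  qed
next
  assume R: "\<forall>e>0. \<exists>\<xi>. dist \<xi> x < e \<and> G differentiable (at \<xi>) \<and> dist (Fderiv G \<xi>) V < e"
  then have "\<forall>k::nat. \<exists>\<xi>. dist \<xi> x < inverse (Suc k) \<and> G differentiable (at \<xi>) \<and> dist (Fderiv G \<xi>) V < inverse (Suc k)"
    by simp
  then obtain \<xi> where \<xi>: "\<And>k::nat. dist (\<xi> k) x < inverse (Suc k)" "\<And>k. G differentiable (at (\<xi> k))"
    "\<And>k. dist (Fderiv G (\<xi> k)) V < inverse (Suc k)" by metis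
  show "V \<in> B_subdiff G x"
    unfolding B_subdiff_def
    using \<xi>(2) LIMSEQ_dist_less_inverse_Suc[OF \<xi>(1)] LIMSEQ_dist_less_inverse_Suc[OF \<xi>(3)] by blast
qed

lemma Fderiv_in_B_subdiff: "G differentiable (at x) \<Longrightarrow> Fderiv G x \<in> B_subdiff G x"
  unfolding B_subdiff_iff by (metis dist_self)

lemma norm_B_subdiff_le:
  assumes L: "C-lipschitz_on (ball x r) G" "z \<in> ball x r" and V: "V \<in> B_subdiff G z"
  shows "norm V \<le> C"
proof -
  obtain \<xi> where \<xi>: "\<xi> \<longlonglongrightarrow> z" "\<And>k. G differentiable at (\<xi> k)" "(\<lambda>k. Fderiv G (\<xi> k)) \<longlonglongrightarrow> V"
    using V unfolding B_subdiff_def by blast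
  have "\<forall>\<^sub>F k in sequentially. \<xi> k \<in> ball x r" by (rule eventually_in_ball[OF \<xi>(1) L(2)])
  then have "\<forall>\<^sub>F k in sequentially. norm (Fderiv G (\<xi> k)) \<le> C"
    by eventually_elim (rule norm_Fderiv_le[OF L(1) _ \<xi>(2)])
  then show ?thesis by (rule tendsto_upperbound[OF tendsto_norm[OF \<xi>(3)]]) simp
qed

text \<open>Lipschitz continuity bounds the \<open>V k\<close>, and the limit stays in the
  B-subdifferential although the base points move: compactness and upper semicontinuity in
  sequential form.\<close>

lemma B_subdiff_compactness:
  fixes G :: "'a::euclidean_space \<Rightarrow> 'b::euclidean_space"
  assumes L: "r > 0" "C-lipschitz_on (ball x r) G"
    and w: "w \<longlonglongrightarrow> x" and V: "\<And>k::nat. V k \<in> B_subdiff G (w k)"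
  obtains \<phi> W where "strict_mono \<phi>" "W \<in> B_subdiff G x" "(\<lambda>k. V (\<phi> k)) \<longlonglongrightarrow> W"
proof -
  have "\<forall>\<^sub>F k in sequentially. w k \<in> ball x r" using eventually_in_ball[OF w] L(1) by simp
  then obtain N where N: "\<And>k. k \<ge> N \<Longrightarrow> w k \<in> ball x r" unfolding eventually_sequentially by blast
  \<comment> \<open>The Lipschitz bound applies once \<open>w k\<close> has entered the ball, hence
    the shift by \<open>N\<close>.\<close>
  have "norm (V (k + N)) \<le> C" for k by (rule norm_B_subdiff_le[OF L(2) N V]) simp
  then have "bounded (range (\<lambda>k. V (k + N)))" by (auto intro!: boundedI)
  then obtain W \<psi> where \<psi>: "strict_mono \<psi>" "((\<lambda>k. V (k + N)) \<circ> \<psi>) \<longlonglongrightarrow> W"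
    using bounded_imp_convergent_subsequence by blast
  define \<phi> where "\<phi> k = \<psi> k + N" for k
  have \<phi>: "strict_mono \<phi>" using \<psi>(1) by (auto simp: strict_mono_def \<phi>_def)
  have lim: "(\<lambda>k. V (\<phi> k)) \<longlonglongrightarrow> W" using \<psi>(2) by (simp add: o_def \<phi>_def)
  have limw: "(\<lambda>k. w (\<phi> k)) \<longlonglongrightarrow> x" using LIMSEQ_subseq_LIMSEQ[OF w \<phi>] by (simp add: o_def)
  have "W \<in> B_subdiff G x"
    unfolding B_subdiff_iff
  proof (intro allI impI)
    fix e :: real assume "e > 0"
    then have e: "e / 2 > 0" by simp
    from tendstoD[OF lim e] tendstoD[OF limw e]
    have "\<forall>\<^sub>F k in sequentially. dist (V (\<phi> k)) W < e / 2 \<and> dist (w (\<phi> k)) x < e / 2"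
      by eventually_elim simp
    then obtain k where k: "dist (V (\<phi> k)) W < e / 2" "dist (w (\<phi> k)) x < e / 2"
      using eventually_happens'[OF sequentially_bot] by blast
    obtain \<xi> where \<xi>: "dist \<xi> (w (\<phi> k)) < e / 2" "G differentiable (at \<xi>)" "dist (Fderiv G \<xi>) (V (\<phi> k)) < e / 2"
      using V[of "\<phi> k"] e unfolding B_subdiff_iff by blast
    show "\<exists>\<xi>. dist \<xi> x < e \<and> G differentiable (at \<xi>) \<and> dist (Fderiv G \<xi>) W < e"
      using dist_triangle[of \<xi> x "w (\<phi> k)"] dist_triangle[of "Fderiv G \<xi>" W "V (\<phi> k)"] \<xi> k
      by (intro exI[of _ \<xi>]) auto
  qed
  then show ?thesis using that[OF \<phi> _ lim] by blast
qed

section \<open>Clarke's condition and the condition on derivatives at the perturbed point\<close>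

lemma semismooth_lipschitz:
  assumes "semismooth_at G x" shows "\<exists>r>0. \<exists>C. C-lipschitz_on (ball x r) G"
proof -
  obtain s where s: "s > 0" "locally_lipschitz_on (ball x s) G"
    using assms unfolding semismooth_at_def by blast
  then obtain r C where "r > 0" "C-lipschitz_on (ball x r \<inter> ball x s) G"
    unfolding locally_lipschitz_on_def by (meson centre_in_ball)
  then have "C-lipschitz_on (ball x (min r s)) G" by (auto elim: lipschitz_on_subset)
  with \<open>r > 0\<close> s show ?thesis by (intro exI[of _ "min r s"]) auto
qed

lemma semismooth_has_dir_deriv:
  assumes "semismooth_at G x" shows "has_dir_deriv G x d (dir_deriv G x d)"
proof -
  obtain l where "has_dir_deriv G x d l"
    using assms unfolding semismooth_at_def dir_differentiable_def by blast
  then show ?thesis using dir_deriv_eq by blast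
qed

lemma has_dir_deriv_scale:
  assumes "has_dir_deriv G x d l" "s \<ge> 0" shows "has_dir_deriv G x (s *\<^sub>R d) (s *\<^sub>R l)"
proof (cases "s = 0")
  case True then show ?thesis by (simp add: has_dir_deriv_def)
next
  case False
  then have s: "s > 0" using assms by simp
  have "filterlim (\<lambda>t. t * s) (at_right 0) (at_right 0)"
    unfolding filterlim_at
  proof
    show "((\<lambda>t. t * s) \<longlongrightarrow> 0) (at_right 0)" by (auto intro!: tendsto_eq_intros)
    show "\<forall>\<^sub>F t in at_right 0. t * s \<in> {0<..} \<and> t * s \<noteq> 0"
      using eventually_at_right_less[of "0::real"] by eventually_elim (use s in auto)
  qed
  from tendsto_scaleR[OF tendsto_const[of s] filterlim_compose[OF assms(1)[unfolded has_dir_deriv_def] this]]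
  have "((\<lambda>t. s *\<^sub>R ((G (x + (t * s) *\<^sub>R d) - G x) /\<^sub>R (t * s))) \<longlongrightarrow> s *\<^sub>R l) (at_right 0)" .
  moreover have "s *\<^sub>R ((G (x + (t * s) *\<^sub>R d) - G x) /\<^sub>R (t * s)) = (G (x + t *\<^sub>R s *\<^sub>R d) - G x) /\<^sub>R t" for t
    using s by simp
  ultimately have "((\<lambda>t. (G (x + t *\<^sub>R s *\<^sub>R d) - G x) /\<^sub>R t) \<longlongrightarrow> s *\<^sub>R l) (at_right 0)"
    by (simp only:)
  then show ?thesis unfolding has_dir_deriv_def .
qed

text \<open>Choose \<open>V k\<close> in the B-subdifferential at \<open>x + t k *\<^sub>R d\<close>
  with \<open>t k\<close> tending to 0. Semismoothness at \<open>x\<close> forces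
  \<open>V k d\<close> to tend to the directional derivative, while a subsequence of
  \<open>V k\<close> tends to an element of the B-subdifferential at \<open>x\<close>.\<close>

lemma dir_deriv_eq_B_subdiff:
  fixes G :: "'a::euclidean_space \<Rightarrow> 'b::euclidean_space"
  assumes sm: "\<And>x. semismooth_at G x"
  shows "\<exists>V\<in>B_subdiff G x. dir_deriv G x d = V d"
proof -
  have cont: "continuous_on UNIV G"
  proof (intro continuous_at_imp_continuous_on ballI)
    fix x obtain r C where "r > 0" "C-lipschitz_on (ball x r) G" using semismooth_lipschitz[OF sm] by blast
    then show "isCont G x"
      using lipschitz_on_continuous_on[of C "ball x r" G] continuous_on_interior[of "ball x r" G x] by simp
  qed
  \<comment> \<open>Points of differentiability accumulate at every \<open>z\<close>, and the
    derivatives there are bounded by a local Lipschitz constant.\<close>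
  have ne: "B_subdiff G z \<noteq> {}" for z
  proof -
    have "\<forall>k::nat. \<exists>y\<in>ball z (inverse (Suc k)). G differentiable (at y)"
      using dense_differentiable[OF cont] sm by (simp add: semismooth_at_def)
    then obtain y where y: "\<And>k::nat. y k \<in> ball z (inverse (Suc k))" "\<And>k. G differentiable (at (y k))"
      by metis
    have "y \<longlonglongrightarrow> z" using y(1) by (intro LIMSEQ_dist_less_inverse_Suc) (simp add: dist_commute)
    obtain r C where "r > 0" "C-lipschitz_on (ball z r) G" using semismooth_lipschitz[OF sm] by blast
    from B_subdiff_compactness[OF this \<open>y \<longlonglongrightarrow> z\<close> Fderiv_in_B_subdiff[OF y(2)]] show ?thesis by blast
  qed
  define t where "t k = inverse (real (Suc k))" for k
  have t: "t k > 0" "t \<longlonglongrightarrow> 0" for k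
    unfolding t_def using LIMSEQ_inverse_real_of_nat by auto
  define w where "w k = x + t k *\<^sub>R d" for k
  have "w \<longlonglongrightarrow> x + 0 *\<^sub>R d" unfolding w_def by (intro tendsto_intros t)
  then have w: "w \<longlonglongrightarrow> x" by simp
  define V where "V k = (SOME U. U \<in> B_subdiff G (w k))" for k
  have V: "V k \<in> B_subdiff G (w k)" for k unfolding V_def using ne some_in_eq by blast
  obtain r C where "r > 0" "C-lipschitz_on (ball x r) G" using semismooth_lipschitz[OF sm] by blast
  from B_subdiff_compactness[OF this w V] obtain \<phi> W
    where W: "strict_mono \<phi>" "W \<in> B_subdiff G x" "(\<lambda>k. V (\<phi> k)) \<longlonglongrightarrow> W" by blast
  let ?l = "dir_deriv G x d"
  have "norm (W d - ?l) \<le> e * norm d" if e: "e > 0" for e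
  proof -
    obtain s where s: "s > 0" "\<And>u U. norm u < s \<Longrightarrow> U \<in> clarke_jacobian G (x + u) \<Longrightarrow> norm (U u - dir_deriv G x u) \<le> e * norm u"
      using sm[of x] e unfolding semismooth_at_def by blast
    have "(\<lambda>k. t k *\<^sub>R d) \<longlonglongrightarrow> 0 *\<^sub>R d" by (intro tendsto_intros t)
    then have "(\<lambda>k. t k *\<^sub>R d) \<longlonglongrightarrow> 0" by simp
    then have "\<forall>\<^sub>F k in sequentially. dist (t k *\<^sub>R d) 0 < s" using tendstoD s(1) by blast
    then have "\<forall>\<^sub>F k in sequentially. norm (t k *\<^sub>R d) < s" by (simp only: dist_0_norm dist_commute)
    then have "\<forall>\<^sub>F k in sequentially. norm (V k d - ?l) \<le> e * norm d"
    proof eventually_elim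
      case (elim k)
      have "V k \<in> clarke_jacobian G (x + t k *\<^sub>R d)"
        using V[of k] unfolding clarke_jacobian_def w_def by (rule hull_inc)
      from s(2)[OF elim this]
      have "norm (V k (t k *\<^sub>R d) - dir_deriv G x (t k *\<^sub>R d)) \<le> e * norm (t k *\<^sub>R d)" .
      moreover have "dir_deriv G x (t k *\<^sub>R d) = t k *\<^sub>R ?l"
        using has_dir_deriv_scale[OF semismooth_has_dir_deriv[OF sm], of "t k"] t by (simp add: dir_deriv_eq less_imp_le)
      ultimately have "norm (t k *\<^sub>R (V k d - ?l)) \<le> t k * (e * norm d)"
        using t(1)[of k] by (simp add: blinfun.scaleR_right scaleR_diff_right mult_ac)
      then show ?case using t(1)[of k] by simp
    qed
    then have ev: "\<forall>\<^sub>F k in sequentially. norm (V (\<phi> k) d - ?l) \<le> e * norm d"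
      using W(1) eventually_subseq by blast
    have lim: "(\<lambda>k. norm (V (\<phi> k) d - ?l)) \<longlonglongrightarrow> norm (W d - ?l)"
      by (intro tendsto_intros W)
    show ?thesis by (rule tendsto_upperbound[OF lim ev]) simp
  qed
  then have "norm (W d - ?l) \<le> 0"
    by (rule le_zero_if_le_all_mult)
  then have "?l = W d" by simp
  then show ?thesis using W(2) by blast
qed

text \<open>The derivative at \<open>x + d\<close> in direction \<open>d\<close> is a value
  \<open>V d\<close> of an element of the Clarke Jacobian there, so Clarke's condition gives the
  last clause. The first-order expansion, uniform over directions, comes from Lipschitz continuity
  and compactness of the unit sphere.\<close>

lemma semismooth_at_imp_semismooth_on:
  fixes G :: "'a::euclidean_space \<Rightarrow> 'b::euclidean_space"
  assumes sm: "\<And>x. semismooth_at G x"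
  shows "semismooth_on UNIV G (dir_deriv G)"
proof (rule semismooth_onI)
  fix x
  obtain r C where rC: "r > 0" "C-lipschitz_on (ball x r) G" using semismooth_lipschitz[OF sm] by blast
  then show "\<exists>r>0. \<exists>C. C-lipschitz_on (ball x r) G" by blast
  have sc: "dir_deriv G x (t *\<^sub>R d) = t *\<^sub>R dir_deriv G x d" if "t \<ge> 0" for t d
    by (rule dir_deriv_eq[OF has_dir_deriv_scale[OF semismooth_has_dir_deriv[OF sm] that]])
  then show "dir_deriv G x (t *\<^sub>R d) = t *\<^sub>R dir_deriv G x d" if "t \<ge> 0" for t d using that .
  show "little_o (\<lambda>d. dir_deriv G (x + d) d - dir_deriv G x d)"
    unfolding little_o_def
  proof (intro allI impI)
    fix e :: real assume "e > 0"
    then obtain s where s: "s > 0" "\<And>u U. norm u < s \<Longrightarrow> U \<in> clarke_jacobian G (x + u) \<Longrightarrow> norm (U u - dir_deriv G x u) \<le> e * norm u"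
      using sm[of x] unfolding semismooth_at_def by blast
    have "norm (dir_deriv G (x + d) d - dir_deriv G x d) \<le> e * norm d" if "norm d < s" for d
    proof -
      obtain V where V: "V \<in> B_subdiff G (x + d)" "dir_deriv G (x + d) d = V d"
        using dir_deriv_eq_B_subdiff[OF sm] by blast
      have "V \<in> clarke_jacobian G (x + d)" using V(1) unfolding clarke_jacobian_def by (rule hull_inc)
      with s(2)[OF that] V(2) show ?thesis by simp
    qed
    then show "\<forall>\<^sub>F d in nhds 0. norm (dir_deriv G (x + d) d - dir_deriv G x d) \<le> e * norm d"
      using s(1) unfolding eventually_nhds_metric by (intro exI[of _ s]) auto
  qed
  show "little_o (\<lambda>d. G (x + d) - G x - dir_deriv G x d)"
  \<comment> \<open>If the expansion failed along \<open>d k\<close>, the normalized directions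
    \<open>u k\<close> would subconverge to some \<open>v\<close>, and Lipschitz continuity would
    transfer the failure to the fixed direction \<open>v\<close>, against the directional derivative
    there.\<close>
  proof (rule ccontr)
    assume "\<not> ?thesis"
    then obtain e where e: "e > 0" "\<not> (\<forall>\<^sub>F d in nhds 0. norm (G (x + d) - G x - dir_deriv G x d) \<le> e * norm d)"
      unfolding little_o_def by blast
    then have "\<forall>k::nat. \<exists>d. norm d < inverse (Suc k) \<and> norm (G (x + d) - G x - dir_deriv G x d) > e * norm d"
      unfolding eventually_nhds_metric by (simp add: not_le del: of_nat_Suc)
    then obtain d where d: "\<And>k::nat. norm (d k) < inverse (Suc k)"
      "\<And>k. norm (G (x + d k) - G x - dir_deriv G x (d k)) > e * norm (d k)" by metis
    have d0: "d k \<noteq> 0" for k using d(2)[of k] sc[of 0 0] by auto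
    define t where "t k = norm (d k)" for k
    have t: "t k > 0" for k using d0 by (simp add: t_def)
    have "d \<longlonglongrightarrow> 0" by (rule LIMSEQ_dist_less_inverse_Suc) (use d(1) in simp)
    then have t0: "t \<longlonglongrightarrow> 0" unfolding t_def using tendsto_norm_zero by blast
    define u where "u k = d k /\<^sub>R t k" for k
    have u: "u k \<in> sphere 0 1" "d k = t k *\<^sub>R u k" for k using d0[of k] by (auto simp: u_def t_def)
    obtain v \<phi> where v: "strict_mono \<phi>" "(u \<circ> \<phi>) \<longlonglongrightarrow> v"
      using compact_sphere[of "0::'a" 1] u(1) unfolding compact_def by metis
    have v': "(\<lambda>k. u (\<phi> k)) \<longlonglongrightarrow> v" using v by (simp add: o_def)
    have t\<phi>: "(\<lambda>k. t (\<phi> k)) \<longlonglongrightarrow> 0" using LIMSEQ_subseq_LIMSEQ[OF t0 v(1)] by (simp add: o_def)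
    have fl: "filterlim (\<lambda>k. t (\<phi> k)) (at_right 0) sequentially"
      unfolding filterlim_at using t\<phi> t by (simp add: less_imp_neq[symmetric])
    have dv: "(\<lambda>k. (G (x + t (\<phi> k) *\<^sub>R v) - G x) /\<^sub>R t (\<phi> k)) \<longlonglongrightarrow> dir_deriv G x v"
      using filterlim_compose[OF semismooth_has_dir_deriv[OF sm, of x v, unfolded has_dir_deriv_def] fl] .
    have inb: "\<forall>\<^sub>F k in sequentially. x + t (\<phi> k) *\<^sub>R w k \<in> ball x r" if w: "w \<longlonglongrightarrow> v" for w
    proof -
      have "(\<lambda>k. x + t (\<phi> k) *\<^sub>R w k) \<longlonglongrightarrow> x + 0 *\<^sub>R v" by (intro tendsto_intros t\<phi> w)
      from eventually_in_ball[OF this, of x r] show ?thesis using rC(1) by simp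
    qed
    \<comment> \<open>The factor \<open>2 * C\<close> pays for exchanging
      \<open>u (\<phi> k)\<close> and \<open>v\<close> once in \<open>G\<close> and once in its
      directional derivative; the other term is the error of the difference quotient along
      \<open>v\<close>.\<close>
    let ?b = "\<lambda>k. 2 * C * norm (u (\<phi> k) - v) + norm ((G (x + t (\<phi> k) *\<^sub>R v) - G x) /\<^sub>R t (\<phi> k) - dir_deriv G x v)"
    have "?b \<longlonglongrightarrow> 2 * C * norm (v - v) + norm (dir_deriv G x v - dir_deriv G x v)"
      by (intro tendsto_intros v' dv)
    then have "\<forall>\<^sub>F k in sequentially. ?b k < e" using order_tendstoD(2)[of ?b 0] e(1) by simp
    moreover have "\<forall>\<^sub>F k in sequentially. e < ?b k"
      using inb[OF v'] inb[OF tendsto_const]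
    proof eventually_elim
      case (elim k)
      let ?t = "t (\<phi> k)" and ?u = "u (\<phi> k)"
      have tp: "?t > 0" by (rule t)
      have 1: "norm (G (x + ?t *\<^sub>R ?u) - G (x + ?t *\<^sub>R v)) \<le> ?t * (C * norm (?u - v))"
      proof -
        have "dist (G (x + ?t *\<^sub>R ?u)) (G (x + ?t *\<^sub>R v)) \<le> C * dist (x + ?t *\<^sub>R ?u) (x + ?t *\<^sub>R v)"
          by (rule lipschitz_onD[OF rC(2) elim])
        also have "dist (x + ?t *\<^sub>R ?u) (x + ?t *\<^sub>R v) = ?t * norm (?u - v)"
          using tp by (simp add: dist_norm flip: scaleR_diff_right)
        finally show ?thesis by (simp add: dist_norm mult_ac)
      qed
      have 2: "norm (dir_deriv G x ?u - dir_deriv G x v) \<le> C * norm (?u - v)"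
        using has_dir_deriv_norm_diff_le[OF rC(2) _ semismooth_has_dir_deriv[OF sm] semismooth_has_dir_deriv[OF sm]] rC(1) by simp
      have "e * ?t < norm (G (x + ?t *\<^sub>R ?u) - G x - ?t *\<^sub>R dir_deriv G x ?u)"
        using d(2)[of "\<phi> k"] sc[of ?t ?u] tp unfolding u(2)[of "\<phi> k", symmetric] t_def[of "\<phi> k", symmetric] by simp
      also have "G (x + ?t *\<^sub>R ?u) - G x - ?t *\<^sub>R dir_deriv G x ?u
        = (G (x + ?t *\<^sub>R ?u) - G (x + ?t *\<^sub>R v)) + (G (x + ?t *\<^sub>R v) - G x - ?t *\<^sub>R dir_deriv G x v)
          - ?t *\<^sub>R (dir_deriv G x ?u - dir_deriv G x v)" by (simp add: algebra_simps)
      also have "norm \<dots> \<le> norm (G (x + ?t *\<^sub>R ?u) - G (x + ?t *\<^sub>R v)) + norm (G (x + ?t *\<^sub>R v) - G x - ?t *\<^sub>R dir_deriv G x v)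
          + norm (?t *\<^sub>R (dir_deriv G x ?u - dir_deriv G x v))"
        by (meson add_right_mono norm_triangle_ineq norm_triangle_ineq4 order_trans)
      also have "\<dots> \<le> ?t * (C * norm (?u - v)) + norm (G (x + ?t *\<^sub>R v) - G x - ?t *\<^sub>R dir_deriv G x v)
          + ?t * (C * norm (?u - v))"
        using 1 2 tp by (intro add_mono) auto
      also have "norm (G (x + ?t *\<^sub>R v) - G x - ?t *\<^sub>R dir_deriv G x v)
          = ?t * norm ((G (x + ?t *\<^sub>R v) - G x) /\<^sub>R ?t - dir_deriv G x v)"
      proof -
        have "G (x + ?t *\<^sub>R v) - G x - ?t *\<^sub>R dir_deriv G x v
          = ?t *\<^sub>R ((G (x + ?t *\<^sub>R v) - G x) /\<^sub>R ?t - dir_deriv G x v)"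
          using tp by (simp add: scaleR_diff_right)
        then show ?thesis using tp by simp
      qed
      also have "?t * (C * norm (?u - v)) + ?t * norm ((G (x + ?t *\<^sub>R v) - G x) /\<^sub>R ?t - dir_deriv G x v)
          + ?t * (C * norm (?u - v)) = ?t * ?b k" by (simp only: algebra_simps mult_2)
      finally have "?t * e < ?t * ?b k" by (simp only: mult.commute)
      then show ?case using tp by simp
    qed
    ultimately have "\<forall>\<^sub>F k::nat in sequentially. False" by eventually_elim simp
    then show False by simp
  qed
qed simp

text \<open>At a differentiability point \<open>\<xi>\<close> near \<open>x + d\<close> the
  derivative is \<open>G' \<xi>\<close>, and the last clause of \<open>semismooth_on\<close> with
  increment \<open>\<xi> - x\<close> compares it with \<open>G' x\<close>. Letting
  \<open>\<xi>\<close> tend to \<open>x + d\<close> covers limits of derivatives; the resulting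
  inequality is convex in \<open>V\<close> and so passes to the convex hull.\<close>

lemma semismooth_on_imp_semismooth_at:
  fixes G :: "'a::euclidean_space \<Rightarrow> 'b::real_normed_vector"
  assumes S: "semismooth_on U G G'" and x: "x \<in> U"
  shows "semismooth_at G x"
  unfolding semismooth_at_def
proof (intro conjI allI impI)
  obtain r C where rC: "r > 0" "C \<ge> 0" "ball x r \<subseteq> U" "C-lipschitz_on (ball x r) G"
    "\<And>z d1 d2. z \<in> ball x r \<Longrightarrow> norm (G' z d1 - G' z d2) \<le> C * norm (d1 - d2)"
    "\<And>z d. z \<in> ball x r \<Longrightarrow> norm (G' z d) \<le> C * norm d" using semismooth_on_deriv_lipschitz[OF S x] by blast
  have "locally_lipschitz_on (ball x r) G"
    unfolding locally_lipschitz_on_def using lipschitz_on_subset[OF rC(4)] by (meson inf_le2 zero_less_one)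
  then show "\<exists>r>0. locally_lipschitz_on (ball x r) G" using rC(1) by blast
  show "dir_differentiable G x"
    unfolding dir_differentiable_def using semismooth_on_has_dir_deriv[OF S x] by blast
  have dd: "dir_deriv G z d = G' z d" if "z \<in> U" for z d
    by (rule dir_deriv_eq[OF semismooth_on_has_dir_deriv[OF S that]])
  fix e :: real assume "e > 0"
  from little_oD[OF semismooth_on_semi[OF S x] this] obtain s where
    s: "s > 0" "\<And>d. norm d < s \<Longrightarrow> norm (G' (x + d) d - G' x d) \<le> e * norm d"
    by (auto simp: eventually_nhds_metric)
  have main: "norm (V d - G' x d) \<le> e * norm d"
    if d: "norm d < min r s" and V: "V \<in> B_subdiff G (x + d)" for V d
  proof -
    obtain \<xi> where \<xi>: "\<xi> \<longlonglongrightarrow> x + d" "\<And>k. G differentiable at (\<xi> k)" "(\<lambda>k. Fderiv G (\<xi> k)) \<longlonglongrightarrow> V"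
      using V unfolding B_subdiff_def by blast
    have "(\<lambda>k. norm (\<xi> k - x)) \<longlonglongrightarrow> norm (x + d - x)" by (intro tendsto_intros \<xi>)
    then have "\<forall>\<^sub>F k in sequentially. norm (\<xi> k - x) < min r s" using order_tendstoD(2) d by fastforce
    \<comment> \<open>The clause at \<open>x\<close> speaks about the increment
      \<open>\<xi> k - x\<close>; exchanging it for \<open>d\<close> costs
      \<open>C * norm (\<xi> k - (x + d))\<close> once in the Frechet derivative and once in
      \<open>G' x\<close>.\<close>
    then have ev: "\<forall>\<^sub>F k in sequentially. norm (Fderiv G (\<xi> k) d - G' x d) \<le> e * norm (\<xi> k - x) + 2 * C * norm (\<xi> k - (x + d))"
    proof eventually_elim
      case (elim k)
      let ?z = "\<xi> k" and ?k = "\<xi> k - x"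
      have zr: "?z \<in> ball x r" using elim by (simp add: dist_norm norm_minus_commute)
      then have "Fderiv G ?z ?k = G' ?z ?k"
        using has_dir_deriv_unique[OF has_derivative_imp_has_dir_deriv[OF Fderiv_works[OF \<xi>(2)]] semismooth_on_has_dir_deriv[OF S]] rC(3) by blast
      then have 1: "norm (Fderiv G ?z ?k - G' x ?k) \<le> e * norm ?k" using s(2)[of ?k] elim by simp
      have 2: "norm (G' x ?k - G' x d) \<le> C * norm (?k - d)" using rC(5)[of x] rC(1) by simp
      have "norm (Fderiv G ?z (d - ?k)) \<le> norm (Fderiv G ?z) * norm (d - ?k)" by (rule norm_blinfun)
      also have "\<dots> \<le> C * norm (?k - d)"
        using norm_Fderiv_le[OF rC(4) zr \<xi>(2)] by (simp add: norm_minus_commute mult_right_mono)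
      finally have 3: "norm (Fderiv G ?z (d - ?k)) \<le> C * norm (?k - d)" .
      have "Fderiv G ?z d - G' x d = Fderiv G ?z (d - ?k) + (Fderiv G ?z ?k - G' x ?k) + (G' x ?k - G' x d)"
        by (simp add: blinfun.diff_right)
      also have "norm \<dots> \<le> norm (Fderiv G ?z (d - ?k)) + norm (Fderiv G ?z ?k - G' x ?k) + norm (G' x ?k - G' x d)"
        by (meson add_right_mono norm_triangle_ineq order_trans)
      also have "\<dots> \<le> C * norm (?k - d) + e * norm ?k + C * norm (?k - d)" using 1 2 3 by linarith
      finally show ?case by (simp add: algebra_simps)
    qed
    have l: "(\<lambda>k. norm (Fderiv G (\<xi> k) d - G' x d)) \<longlonglongrightarrow> norm (V d - G' x d)" by (intro tendsto_intros \<xi>)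
    have "(\<lambda>k. e * norm (\<xi> k - x) + 2 * C * norm (\<xi> k - (x + d))) \<longlonglongrightarrow> e * norm (x + d - x) + 2 * C * norm (x + d - (x + d))"
      by (intro tendsto_intros \<xi>)
    from tendsto_le[OF sequentially_bot this l ev] show ?thesis by simp
  qed
  have "\<forall>V\<in>clarke_jacobian G (x + d). norm (V d - dir_deriv G x d) \<le> e * norm d" if d: "norm d < min r s" for d
  proof -
    have "convex {V :: 'a \<Rightarrow>\<^sub>L 'b. norm (V d - G' x d) \<le> e * norm d}"
    proof -
      have "{V :: 'a \<Rightarrow>\<^sub>L 'b. norm (V d - G' x d) \<le> e * norm d} = (\<lambda>V. blinfun_apply V d) -` cball (G' x d) (e * norm d)"
        by (auto simp: dist_norm norm_minus_commute)
      moreover have "linear (\<lambda>V :: 'a \<Rightarrow>\<^sub>L 'b. blinfun_apply V d)"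
        by (intro linearI) (auto simp: blinfun.add_left blinfun.scaleR_left)
      ultimately show ?thesis using convex_linear_vimage by (metis convex_cball)
    qed
    then have "clarke_jacobian G (x + d) \<subseteq> {V. norm (blinfun_apply V d - G' x d) \<le> e * norm d}"
      unfolding clarke_jacobian_def using main[OF d] by (intro hull_minimal) auto
    then show ?thesis using dd[OF x] by auto
  qed
  then show "\<exists>r>0. \<forall>d. norm d < r \<longrightarrow> (\<forall>V\<in>clarke_jacobian G (x + d). norm (V d - dir_deriv G x d) \<le> e * norm d)"
    using rC(1) s(1) by (intro exI[of _ "min r s"]) auto
qed

text \<open>Needed for \<open>\<nabla>\<theta>\<^sub>c\<close>, whose semismoothness is assumed for the functional-valued \<open>D\<theta>\<^sub>c\<close>.\<close>
lemma semismooth_linear_iso: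
  fixes G :: "'a::euclidean_space \<Rightarrow> 'b::real_normed_vector" and T :: "'b \<Rightarrow> 'c::real_normed_vector"
  assumes G: "semismooth_at G x" and T: "bounded_linear T" and S: "bounded_linear S"
    and ST: "\<And>v. S (T v) = v" and TS: "\<And>w. T (S w) = w"
  shows "semismooth_at (\<lambda>x. T (G x)) x"
  unfolding semismooth_at_def
proof (intro conjI allI impI)
  interpret T: bounded_linear T by fact
  interpret S: bounded_linear S by fact
  obtain K where K: "\<And>v. norm (T v) \<le> norm v * K" "K > 0" using T.pos_bounded by blast
  have TL: "K-lipschitz_on X T" for X
    using K by (intro lipschitz_onI) (auto simp: dist_norm mult.commute simp flip: T.diff)
  show "\<exists>r>0. locally_lipschitz_on (ball x r) (\<lambda>x. T (G x))"
  proof -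
    obtain r where r: "r > 0" "locally_lipschitz_on (ball x r) G"
      using G unfolding semismooth_at_def by blast
    have "\<exists>C. C-lipschitz_on X (\<lambda>x. T (G x))" if "C-lipschitz_on X G" for C X
      using lipschitz_on_compose[OF that TL] by (auto simp: o_def)
    then have "locally_lipschitz_on (ball x r) (\<lambda>x. T (G x))"
      using r(2) unfolding locally_lipschitz_on_def by meson
    then show ?thesis using r(1) by blast
  qed
  have dd: "has_dir_deriv (\<lambda>x. T (G x)) x d (T (dir_deriv G x d))" for d
    using T.tendsto[OF semismooth_has_dir_deriv[OF G, of d, unfolded has_dir_deriv_def]]
    unfolding has_dir_deriv_def by (simp add: T.scaleR T.diff)
  then show "dir_differentiable (\<lambda>x. T (G x)) x" unfolding dir_differentiable_def by blast
  have dd': "dir_deriv (\<lambda>x. T (G x)) x d = T (dir_deriv G x d)" for d using dir_deriv_eq[OF dd] .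
  define B where "B = Blinfun S"
  have B: "blinfun_apply B = S" unfolding B_def by (rule bounded_linear_Blinfun_apply[OF S])
  \<comment> \<open>The inverse \<open>S\<close> brings differentiability of
    \<open>\<lambda>x. T (G x)\<close> back to \<open>G\<close>, so generalized derivatives are
    pulled back along it.\<close>
  have sub: "B o\<^sub>L V \<in> B_subdiff G z" if "V \<in> B_subdiff (\<lambda>x. T (G x)) z" for V z
  proof -
    obtain \<xi> where \<xi>: "\<xi> \<longlonglongrightarrow> z" "\<And>k. (\<lambda>x. T (G x)) differentiable at (\<xi> k)" "(\<lambda>k. Fderiv (\<lambda>x. T (G x)) (\<xi> k)) \<longlonglongrightarrow> V"
      using \<open>V \<in> _\<close> unfolding B_subdiff_def by blast
    have hd: "(G has_derivative blinfun_apply (B o\<^sub>L Fderiv (\<lambda>x. T (G x)) (\<xi> k))) (at (\<xi> k))" for k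
      using S.has_derivative[OF Fderiv_works[OF \<xi>(2)[of k]]] by (simp add: ST B blinfun_compose.rep_eq o_def)
    have "(\<lambda>k. B o\<^sub>L Fderiv (\<lambda>x. T (G x)) (\<xi> k)) \<longlonglongrightarrow> (B o\<^sub>L V)" by (intro tendsto_intros \<xi>)
    then show ?thesis
      unfolding B_subdiff_def using \<xi>(1) hd Fderiv_eqI[OF hd] by (auto simp: differentiable_def intro!: exI[of _ \<xi>])
  qed
  have sub2: "B o\<^sub>L V \<in> clarke_jacobian G z" if "V \<in> clarke_jacobian (\<lambda>x. T (G x)) z" for V z
  proof -
    have "linear (\<lambda>V. B o\<^sub>L V)"
      by (intro linearI) (auto simp: bounded_bilinear.add_right[OF bounded_bilinear_blinfun_compose] bounded_bilinear.scaleR_right[OF bounded_bilinear_blinfun_compose])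
    then have "convex ((\<lambda>V. B o\<^sub>L V) -` clarke_jacobian G z)"
      by (intro convex_linear_vimage) (auto simp: clarke_jacobian_def)
    then have "convex hull B_subdiff (\<lambda>x. T (G x)) z \<subseteq> (\<lambda>V. B o\<^sub>L V) -` clarke_jacobian G z"
      by (intro hull_minimal) (use sub hull_subset in \<open>auto simp: clarke_jacobian_def hull_inc\<close>)
    with that show ?thesis unfolding clarke_jacobian_def by blast
  qed
  fix e :: real assume e: "e > 0"
  then have "e / K > 0" using K by simp
  then obtain r where r: "r > 0" "\<And>d V. norm d < r \<Longrightarrow> V \<in> clarke_jacobian G (x + d) \<Longrightarrow> norm (V d - dir_deriv G x d) \<le> e / K * norm d"
    using G unfolding semismooth_at_def by blast
  have "norm (V d - dir_deriv (\<lambda>x. T (G x)) x d) \<le> e * norm d"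
    if d: "norm d < r" and V: "V \<in> clarke_jacobian (\<lambda>x. T (G x)) (x + d)" for d V
  proof -
    have "V d - dir_deriv (\<lambda>x. T (G x)) x d = T ((B o\<^sub>L V) d - dir_deriv G x d)"
      by (simp add: dd' T.diff B TS)
    then have "norm (V d - dir_deriv (\<lambda>x. T (G x)) x d) \<le> norm ((B o\<^sub>L V) d - dir_deriv G x d) * K"
      using K(1) by simp
    also have "\<dots> \<le> e / K * norm d * K" using r(2)[OF d sub2[OF V]] K(2) by (intro mult_right_mono) auto
    finally show ?thesis using K(2) by simp
  qed
  then show "\<exists>r>0. \<forall>d. norm d < r \<longrightarrow> (\<forall>V\<in>clarke_jacobian (\<lambda>x. T (G x)) (x + d).
      norm (V d - dir_deriv (\<lambda>x. T (G x)) x d) \<le> e * norm d)" using r(1) by blast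
qed

section \<open>Gradients, projections and Moreau envelopes\<close>

lemma has_derivative_quadratic_bound:
  fixes \<phi> :: "'a::real_inner \<Rightarrow> real"
  assumes "\<And>d. \<bar>\<phi> (x + d) - \<phi> x - v \<bullet> d\<bar> \<le> C * (norm d)\<^sup>2"
  shows "(\<phi> has_derivative (\<lambda>d. v \<bullet> d)) (at x)"
  unfolding has_derivative_at_alt
proof (intro conjI allI impI)
  show "bounded_linear ((\<bullet>) v)" by (rule bounded_linear_inner_right)
  fix e :: real assume e: "e > 0"
  have "little_o (\<lambda>d. \<phi> (x + d) - \<phi> x - v \<bullet> d)"
    by (rule little_o_quadratic[of _ C]) (use assms in simp)
  from little_oD[OF this e] obtain s where s: "s > 0"
    "\<And>d. norm d < s \<Longrightarrow> \<bar>\<phi> (x + d) - \<phi> x - v \<bullet> d\<bar> \<le> e * norm d"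
    by (auto simp: eventually_nhds_metric)
  then show "\<exists>s>0. \<forall>y. norm (y - x) < s \<longrightarrow> norm (\<phi> y - \<phi> x - v \<bullet> (y - x)) \<le> e * norm (y - x)"
    using s(2)[of "_ - x"] by (intro exI[of _ s]) auto
qed

lemma inner_adjoint:
  fixes V :: "'a::euclidean_space \<Rightarrow>\<^sub>L 'b::euclidean_space"
  shows "adjoint V z \<bullet> d = z \<bullet> V d"
  by (simp add: adjoint_clauses[OF bounded_linear.linear[OF blinfun.bounded_linear_right]])

text \<open>As a bounded bilinear map, the adjoint brings products such as
  \<open>adjoint (Fderiv F x) Y\<close> under the bilinear case of the semismooth calculus.\<close>

lemma bounded_bilinear_adjoint:
  "bounded_bilinear (\<lambda>(V :: 'a::euclidean_space \<Rightarrow>\<^sub>L 'b::euclidean_space) z. adjoint V z)"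
proof
  fix V V' :: "'a \<Rightarrow>\<^sub>L 'b" and z z' :: 'b and r :: real
  show "adjoint (V + V') z = adjoint V z + adjoint V' z"
    by (subst vector_eq_rdot[symmetric]) (simp add: inner_adjoint inner_add_left inner_add_right blinfun.add_left)
  show "adjoint V (z + z') = adjoint V z + adjoint V z'"
    by (subst vector_eq_rdot[symmetric]) (simp add: inner_adjoint inner_add_left inner_add_right blinfun.add_left)
  show "adjoint (r *\<^sub>R V) z = r *\<^sub>R adjoint V z"
    by (subst vector_eq_rdot[symmetric]) (simp add: inner_adjoint blinfun.scaleR_left)
  show "adjoint V (r *\<^sub>R z) = r *\<^sub>R adjoint V z"
    by (subst vector_eq_rdot[symmetric]) (simp add: inner_adjoint)
next
  have "norm (adjoint (blinfun_apply V) z) \<le> norm V * norm z * 1" for V :: "'a \<Rightarrow>\<^sub>L 'b" and z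
  proof -
    let ?a = "adjoint (blinfun_apply V) z"
    have "norm ?a * norm ?a = z \<bullet> V ?a" by (simp add: inner_adjoint[symmetric] dot_square_norm power2_eq_square)
    also have "\<dots> \<le> norm z * norm (V ?a)" by (rule norm_cauchy_schwarz)
    also have "\<dots> \<le> norm z * (norm V * norm ?a)" by (intro mult_left_mono norm_blinfun) simp
    finally have "norm ?a * norm ?a \<le> norm ?a * (norm V * norm z)" by (simp add: mult_ac)
    then show ?thesis by (cases "?a = 0") auto
  qed
  then show "\<exists>K. \<forall>(V :: 'a \<Rightarrow>\<^sub>L 'b) z. norm (adjoint (blinfun_apply V) z) \<le> norm V * norm z * K" by blast
qed

lemma grad_eqI:
  assumes "(\<phi> has_derivative (\<lambda>d. v \<bullet> d)) (at x)" shows "grad \<phi> x = v"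
proof -
  have "Fderiv \<phi> x = blinfun_inner_right v"
    by (rule Fderiv_eqI) (use assms in \<open>simp add: blinfun_inner_right.rep_eq\<close>)
  then show ?thesis
    unfolding grad_def vector_eq_rdot[symmetric, of "adjoint _ 1"] inner_adjoint by simp
qed

lemma semismooth_grad:
  fixes \<phi> :: "'a::euclidean_space \<Rightarrow> real"
  assumes "semismooth_at (Fderiv \<phi>) x" shows "semismooth_at (grad \<phi>) x"
  unfolding grad_def
proof (rule semismooth_linear_iso[OF assms])
  show "bounded_linear (\<lambda>V :: 'a \<Rightarrow>\<^sub>L real. adjoint V 1)"
    by (rule bounded_bilinear.bounded_linear_left[OF bounded_bilinear_adjoint])
  show "bounded_linear (blinfun_inner_right :: 'a \<Rightarrow> 'a \<Rightarrow>\<^sub>L real)" by (rule bounded_linear_blinfun_inner_right)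
  show "blinfun_inner_right (adjoint V 1) = V" for V :: "'a \<Rightarrow>\<^sub>L real"
    by (rule blinfun_eqI) (simp add: inner_adjoint)
  show "adjoint (blinfun_inner_right w :: 'a \<Rightarrow>\<^sub>L real) 1 = w" for w
    unfolding vector_eq_rdot[symmetric, of "adjoint _ 1"] inner_adjoint by simp
qed

text \<open>Symmetry of the second derivative when \<open>p\<close> is known to be differentiable at
  the single point \<open>x\<close>. The second difference of \<open>\<phi>\<close> over the
  parallelogram with sides \<open>t *\<^sub>R a\<close> and \<open>t *\<^sub>R b\<close> is
  symmetric in \<open>a\<close> and \<open>b\<close>; the mean value theorem along either side
  evaluates it as \<open>t * t * (W b \<bullet> a)\<close> or
  \<open>t * t * (W a \<bullet> b)\<close>, up to an error proportional to
  \<open>e * t * t\<close>.\<close>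

lemma grad_derivative_selfadjoint:
  fixes \<phi> :: "'a::real_inner \<Rightarrow> real"
  assumes \<phi>: "\<And>y. (\<phi> has_derivative (\<lambda>d. p y \<bullet> d)) (at y)" and p: "(p has_derivative W) (at x)"
  shows "W a \<bullet> b = W b \<bullet> a"
proof -
  interpret W: bounded_linear W using p has_derivative_bounded_linear by blast
  have "\<bar>W a \<bullet> b - W b \<bullet> a\<bar> \<le> e * (4 * (norm a + norm b)\<^sup>2)" if e: "e > 0" for e
  proof -
    from little_oD[OF has_derivative_imp_little_o[OF p] e] obtain s where
      s: "s > 0" "\<And>d. norm d < s \<Longrightarrow> norm (p (x + d) - p x - W d) \<le> e * norm d"
      by (auto simp: eventually_nhds_metric)
    define n where "n = norm a + norm b"
    have n: "n \<ge> 0" by (simp add: n_def)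
    \<comment> \<open>Keeps the displacements within the radius \<open>s\<close> of the expansion of
      \<open>p\<close>: they are at most \<open>t * n < s\<close>.\<close>
    define t where "t = s / (2 * (n + 1))"
    have t: "t > 0" using s(1) n by (simp add: t_def)
    have tn: "t * n < s"
    proof -
      have "t * n \<le> t * (n + 1)" using t by simp
      also have "\<dots> = s / 2" using n by (simp add: t_def field_simps)
      finally show ?thesis using s(1) by linarith
    qed
    \<comment> \<open>\<open>a\<close> and \<open>b\<close> are rebound here: the estimate is used
      for the given pair and for the swapped one.\<close>
    have half: "\<bar>(\<phi> (x + t *\<^sub>R a + t *\<^sub>R b) - \<phi> (x + t *\<^sub>R a) - \<phi> (x + t *\<^sub>R b) + \<phi> x) - t * (t * (W b \<bullet> a))\<bar> \<le> t * t * (2 * e * n\<^sup>2)"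
      if nab: "norm a + norm b = n" for a b
    proof -
      have fst_deriv: "((\<lambda>r. \<phi> (x + r *\<^sub>R a + w)) has_real_derivative (p (x + r *\<^sub>R a + w) \<bullet> a)) (at r)" for r w
      proof -
        have "((\<lambda>r. \<phi> (x + r *\<^sub>R a + w)) has_derivative (\<lambda>h. p (x + r *\<^sub>R a + w) \<bullet> (h *\<^sub>R a))) (at r)"
          by (rule has_derivative_compose[of "\<lambda>r. x + r *\<^sub>R a + w" "\<lambda>h. h *\<^sub>R a", OF _ \<phi>]) (auto intro!: derivative_eq_intros)
        then show ?thesis unfolding has_field_derivative_def
          by (rule has_derivative_eq_rhs) (simp add: fun_eq_iff)
      qed
      define g where "g r = \<phi> (x + r *\<^sub>R a + t *\<^sub>R b) - \<phi> (x + r *\<^sub>R a + 0)" for r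
      have "(g has_real_derivative (p (x + r *\<^sub>R a + t *\<^sub>R b) \<bullet> a - p (x + r *\<^sub>R a + 0) \<bullet> a)) (at r)" for r
        unfolding g_def by (intro DERIV_diff fst_deriv)
      from MVT2[OF t, of g, OF this] obtain r where r: "0 < r" "r < t"
        "g t - g 0 = (t - 0) * (p (x + r *\<^sub>R a + t *\<^sub>R b) \<bullet> a - p (x + r *\<^sub>R a + 0) \<bullet> a)" by blast
      let ?k = "r *\<^sub>R a + t *\<^sub>R b" and ?l = "r *\<^sub>R a"
      have l: "norm ?l \<le> t * n"
        using r n t unfolding nab[symmetric] by (simp add: mult_mono)
      have k: "norm ?k \<le> t * n"
      proof -
        have "norm ?k \<le> r * norm a + t * norm b" using r t norm_triangle_ineq[of ?l "t *\<^sub>R b"] by simp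
        also have "\<dots> \<le> t * norm a + t * norm b" using r by (simp add: mult_right_mono)
        finally show ?thesis by (simp add: nab[symmetric] algebra_simps)
      qed
      let ?R = "(p (x + ?k) - p x - W ?k) - (p (x + ?l) - p x - W ?l)"
      have "norm ?R \<le> e * norm ?k + e * norm ?l"
        using s(2)[OF order_le_less_trans[OF k tn]] s(2)[OF order_le_less_trans[OF l tn]]
        by (rule order_trans[OF norm_triangle_ineq4 add_mono])
      also have "\<dots> \<le> e * (t * n) + e * (t * n)" using k l e by (intro add_mono mult_left_mono) auto
      also have "\<dots> = 2 * e * (t * n)" by simp
      finally have R: "norm ?R \<le> 2 * e * (t * n)" .
      have an: "norm a \<le> n" using nab by auto
      have eq: "g t - g 0 - t * (t * (W b \<bullet> a)) = t * (?R \<bullet> a)"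
        unfolding r(3) by (simp add: W.add W.scaleR inner_diff_left inner_add_left algebra_simps)
      have "\<bar>?R \<bullet> a\<bar> \<le> norm ?R * norm a" by (rule Cauchy_Schwarz_ineq2)
      also have "\<dots> \<le> 2 * e * (t * n) * n" using R an n e t by (intro mult_mono) auto
      finally have "\<bar>g t - g 0 - t * (t * (W b \<bullet> a))\<bar> \<le> t * (2 * e * (t * n) * n)"
        unfolding eq using t by (simp add: abs_mult)
      moreover have "g t - g 0 = \<phi> (x + t *\<^sub>R a + t *\<^sub>R b) - \<phi> (x + t *\<^sub>R a) - \<phi> (x + t *\<^sub>R b) + \<phi> x"
        by (simp add: g_def)
      ultimately show ?thesis by (simp add: power2_eq_square mult_ac)
    qed
    let ?D = "\<phi> (x + t *\<^sub>R a + t *\<^sub>R b) - \<phi> (x + t *\<^sub>R a) - \<phi> (x + t *\<^sub>R b) + \<phi> x"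
    have 1: "\<bar>?D - t * (t * (W b \<bullet> a))\<bar> \<le> t * t * (2 * e * n\<^sup>2)" by (rule half) (simp add: n_def)
    have "x + t *\<^sub>R b + t *\<^sub>R a = x + t *\<^sub>R a + t *\<^sub>R b" by simp
    then have 2: "\<bar>?D - t * (t * (W a \<bullet> b))\<bar> \<le> t * t * (2 * e * n\<^sup>2)"
      using half[of b a] by (simp add: n_def add.commute algebra_simps)
    have "\<bar>t * (t * (W a \<bullet> b)) - t * (t * (W b \<bullet> a))\<bar> \<le> t * t * (2 * e * n\<^sup>2) + t * t * (2 * e * n\<^sup>2)"
      using 1 2 by linarith
    moreover have "t * (t * (W a \<bullet> b)) - t * (t * (W b \<bullet> a)) = (t * t) * (W a \<bullet> b - W b \<bullet> a)" by (simp add: algebra_simps)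
    ultimately have "(t * t) * \<bar>W a \<bullet> b - W b \<bullet> a\<bar> \<le> (t * t) * (e * (4 * n\<^sup>2))"
      by (simp add: abs_mult mult_ac)
    then show ?thesis using t by (simp add: n_def)
  qed
  then have "\<bar>W a \<bullet> b - W b \<bullet> a\<bar> \<le> 0" by (rule le_zero_if_le_all_mult)
  then show ?thesis by simp
qed

lemma B_subdiff_grad_selfadjoint:
  fixes \<phi> :: "'a::euclidean_space \<Rightarrow> real"
  assumes \<phi>: "\<And>y. (\<phi> has_derivative (\<lambda>d. p y \<bullet> d)) (at y)" and W: "W \<in> B_subdiff p x"
  shows "W a \<bullet> b = W b \<bullet> a"
proof -
  obtain \<xi> where \<xi>: "\<xi> \<longlonglongrightarrow> x" "\<And>k. p differentiable at (\<xi> k)" "(\<lambda>k. Fderiv p (\<xi> k)) \<longlonglongrightarrow> W"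
    using W unfolding B_subdiff_def by blast
  have "(\<lambda>k. Fderiv p (\<xi> k) a \<bullet> b) \<longlonglongrightarrow> W a \<bullet> b" by (intro tendsto_intros \<xi>)
  moreover have "(\<lambda>k. Fderiv p (\<xi> k) b \<bullet> a) \<longlonglongrightarrow> W b \<bullet> a" by (intro tendsto_intros \<xi>)
  moreover have "Fderiv p (\<xi> k) a \<bullet> b = Fderiv p (\<xi> k) b \<bullet> a" for k
    by (rule grad_derivative_selfadjoint[OF \<phi> Fderiv_works[OF \<xi>(2)]])
  ultimately show ?thesis using LIMSEQ_unique by simp
qed

text \<open>Polarization: for \<open>y\<close> parallel to \<open>S x\<close> and as long as
  \<open>x\<close>, \<open>4 * (S x \<bullet> y)\<close> is a difference of two values of the
  quadratic form, and the parallelogram law bounds it by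
  \<open>4 * m * (norm x)\<^sup>2\<close>.\<close>

lemma selfadjoint_norm_le:
  fixes S :: "'a::real_inner \<Rightarrow> 'a"
  assumes S: "linear S" and sym: "\<And>a b. S a \<bullet> b = S b \<bullet> a" and form: "\<And>d. \<bar>S d \<bullet> d\<bar> \<le> m * (norm d)\<^sup>2"
  shows "norm (S x) \<le> m * norm x"
proof (cases "S x = 0")
  case True
  have "x \<noteq> 0 \<Longrightarrow> m \<ge> 0" using form[of x] True by (simp add: zero_le_mult_iff)
  then show ?thesis using True by (cases "x = 0") auto
next
  case False
  then have x: "x \<noteq> 0" using linear_0[OF S] by auto
  define y where "y = (norm x / norm (S x)) *\<^sub>R S x"
  have ny: "norm y = norm x" using False by (simp add: y_def)
  have "4 * (S x \<bullet> y) = S (x + y) \<bullet> (x + y) - S (x - y) \<bullet> (x - y)"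
    using sym[of x y] by (simp add: linear_add[OF S] linear_diff[OF S] inner_add_left inner_add_right inner_diff_left inner_diff_right)
  also have "\<dots> \<le> m * (norm (x + y))\<^sup>2 + m * (norm (x - y))\<^sup>2"
    using form[of "x + y"] form[of "x - y"] by linarith
  also have "\<dots> = m * (4 * (norm x)\<^sup>2)"
    using ny by (simp add: power2_norm_eq_inner inner_add_left inner_add_right inner_diff_left inner_diff_right inner_commute norm_eq algebra_simps)
  also have "S x \<bullet> y = norm x * norm (S x)"
    using False by (simp add: y_def dot_square_norm power2_eq_square)
  finally have "norm x * norm (S x) \<le> norm x * (m * norm x)" by (simp add: power2_eq_square mult_ac)
  then show ?thesis using x by simp
qed

section \<open>Projection onto the dual cone\<close>

lemma dual_cone_convex_cone:
  shows "closed (dual_cone K)" "convex (dual_cone K)" "0 \<in> dual_cone K"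
    "v \<in> dual_cone K \<Longrightarrow> 0 \<le> t \<Longrightarrow> t *\<^sub>R v \<in> dual_cone K"
proof -
  have "dual_cone K = (\<Inter>z\<in>K. {v. 0 \<le> v \<bullet> z})" by (auto simp: dual_cone_def)
  then show "closed (dual_cone K)"
    by (simp only:) (intro closed_INT ballI closed_Collect_le continuous_intros)
  show "convex (dual_cone K)" by (auto simp: convex_def dual_cone_def inner_add_left)
qed (auto simp: dual_cone_def)

text \<open>Testing the variational inequality of the projection at \<open>0\<close> and at twice
  the projection forces orthogonality, which then simplifies the inequality for every
  \<open>v\<close>.\<close>

lemma closest_point_dual_cone:
  fixes K :: "'y::euclidean_space set"
  shows "(w - closest_point (dual_cone K) w) \<bullet> closest_point (dual_cone K) w = 0" (is ?A)
    and "v \<in> dual_cone K \<Longrightarrow> (w - closest_point (dual_cone K) w) \<bullet> v \<le> 0"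
proof -
  let ?C = "dual_cone K" let ?p = "closest_point ?C w"
  note C = dual_cone_convex_cone(1-3)[of K]
  have p: "?p \<in> ?C" using closest_point_in_set C(1,3) by blast
  have *: "(w - ?p) \<bullet> (v - ?p) \<le> 0" if "v \<in> ?C" for v by (rule closest_point_dot[OF C(2,1) that])
  show 1: ?A using *[OF C(3)] *[OF dual_cone_convex_cone(4)[OF p, of 2]] by (simp add: scaleR_2 inner_diff_right inner_add_right)
  show "v \<in> ?C \<Longrightarrow> (w - ?p) \<bullet> v \<le> 0" using *[of v] 1 by (simp add: inner_diff_right)
qed

text \<open>The subgradient inequality \<open>lower\<close>, used in both directions, encloses the
  remainder between 0 and \<open>(P (w + d) - P w) \<bullet> d\<close>, which nonexpansiveness
  bounds by \<open>(norm d)\<^sup>2\<close>. The result gives the derivative of the penalty for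
  \<open>g\<close> and the symmetry of the B-subdifferential of \<open>P\<close>.\<close>

lemma half_norm_closest_point_has_derivative:
  fixes K :: "'y::euclidean_space set"
  defines "P \<equiv> closest_point (dual_cone K)"
  shows "((\<lambda>w. (norm (P w))\<^sup>2 / 2) has_derivative (\<lambda>d. P w \<bullet> d)) (at w)"
proof (rule has_derivative_quadratic_bound[of _ _ _ 1])
  fix d
  have in_cone: "P z \<in> dual_cone K" for z
    unfolding P_def using closest_point_in_set dual_cone_convex_cone(1-3)[of K] by blast
  have lower: "(norm (P z))\<^sup>2 / 2 - (norm (P y))\<^sup>2 / 2 - P y \<bullet> (z - y) \<ge> 0" for y z
  proof -
    have "(z - P z) \<bullet> P y \<le> 0" "(y - P y) \<bullet> P y = 0"
      unfolding P_def by (rule closest_point_dual_cone in_cone[unfolded P_def])+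
    moreover have "0 \<le> (P z - P y) \<bullet> (P z - P y)" by simp
    ultimately show ?thesis
      by (simp add: power2_norm_eq_inner inner_diff_left inner_diff_right inner_commute algebra_simps)
  qed
  have "norm (P (w + d) - P w) \<le> norm d"
    using closest_point_lipschitz[of "dual_cone K" "w + d" w] dual_cone_convex_cone(1-3)[of K]
    unfolding P_def dist_norm by (metis add_diff_cancel_left' empty_iff)
  then have "(P (w + d) - P w) \<bullet> d \<le> (norm d)\<^sup>2"
    using norm_cauchy_schwarz[of "P (w + d) - P w" d] by (smt (verit) mult_right_mono norm_ge_zero power2_eq_square)
  then show "\<bar>(norm (P (w + d)))\<^sup>2 / 2 - (norm (P w))\<^sup>2 / 2 - P w \<bullet> d\<bar> \<le> 1 * (norm d)\<^sup>2"
    using lower[of "w + d" w] lower[of w "w + d"] by (simp add: inner_diff_left abs_le_iff)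
qed

text \<open>Since \<open>g \<bullet> l = 0\<close>, the squared distances of
  \<open>l - c *\<^sub>R g\<close> to \<open>v\<close> and to \<open>l\<close> differ by
  \<open>(norm (v - l))\<^sup>2 + 2 * c * (v \<bullet> g)\<close>, which is nonnegative on the dual
  cone.\<close>

lemma closest_point_dual_cone_complementary:
  fixes K :: "'y::euclidean_space set"
  assumes "g \<in> K" "l \<in> dual_cone K" "g \<bullet> l = 0" "c \<ge> 0"
  shows "closest_point (dual_cone K) (l - c *\<^sub>R g) = l"
proof -
  have "dist (l - c *\<^sub>R g) l \<le> dist (l - c *\<^sub>R g) v" if v: "v \<in> dual_cone K" for v
  proof -
    have "0 \<le> v \<bullet> g" using assms(1) v by (simp add: dual_cone_def)
    then have "0 \<le> (v - l) \<bullet> (v - l) + 2 * c * (v \<bullet> g)" using assms(4) by simp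
    then have "(norm (c *\<^sub>R g))\<^sup>2 \<le> (norm (l - c *\<^sub>R g - v))\<^sup>2"
      using assms(3) unfolding power2_norm_eq_inner
      by (simp add: inner_diff_left inner_diff_right inner_commute algebra_simps)
    then show ?thesis by (simp add: dist_norm abs_le_square_iff[symmetric])
  qed
  then show ?thesis
    using closest_point_unique[OF dual_cone_convex_cone(2,1) assms(2)] by (metis)
qed

text \<open>At \<open>P + v /\<^sub>R c\<close> the infimum of the envelope is attained at
  \<open>P\<close>. Nearby, the subgradient inequality and completing the square bound the envelope
  below by an affine function of slope \<open>v\<close>; inserting \<open>Z' = P\<close> shows that
  it exceeds this by at most \<open>c / 2 * (norm d)\<^sup>2\<close>.\<close>

lemma theta_c_has_derivative_at_resolvent:
  fixes \<theta> :: "'z::real_inner \<Rightarrow> ereal"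
  assumes v: "v \<in> subdiff \<theta> P" and fin: "\<bar>\<theta> P\<bar> \<noteq> \<infinity>" and c: "c > 0"
  shows "(theta_c \<theta> c has_derivative (\<lambda>d. v \<bullet> d)) (at (P + v /\<^sub>R c))"
proof -
  obtain r where r: "\<theta> P = ereal r" using fin by auto
  let ?Z = "P + v /\<^sub>R c"
  let ?lo = "\<lambda>d. r + (norm v)\<^sup>2 / (2 * c) + v \<bullet> d"
  have lo: "ereal (?lo d) \<le> moreau (1 / c) \<theta> (?Z + d)" for d
    unfolding moreau_def
  proof (rule INF_greatest)
    fix Z'
    have "v \<bullet> (Z' - P) + c / 2 * (norm (Z' - (?Z + d)))\<^sup>2
        = (norm v)\<^sup>2 / (2 * c) + v \<bullet> d + c / 2 * (norm (Z' - P - d))\<^sup>2"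
      using c unfolding power2_norm_eq_inner
      by (simp add: inner_diff_left inner_diff_right inner_add_left inner_add_right inner_commute field_simps)
    then have "?lo d \<le> r + v \<bullet> (Z' - P) + c / 2 * (norm (Z' - (?Z + d)))\<^sup>2" using c by simp
    then have "ereal (?lo d) \<le> (\<theta> P + ereal (v \<bullet> (Z' - P))) + ereal (1 / (2 * (1 / c)) * (norm (Z' - (?Z + d)))\<^sup>2)"
      by (simp add: r)
    also have "\<dots> \<le> \<theta> Z' + ereal (1 / (2 * (1 / c)) * (norm (Z' - (?Z + d)))\<^sup>2)"
      using v unfolding subdiff_def by (intro add_right_mono) blast
    finally show "ereal (?lo d) \<le> \<theta> Z' + ereal (1 / (2 * (1 / c)) * (norm (Z' - (?Z + d)))\<^sup>2)" .
  qed
  have hi: "moreau (1 / c) \<theta> (?Z + d) \<le> ereal (?lo d + c / 2 * (norm d)\<^sup>2)" for d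
  proof -
    have "moreau (1 / c) \<theta> (?Z + d) \<le> \<theta> P + ereal (1 / (2 * (1 / c)) * (norm (P - (?Z + d)))\<^sup>2)"
      unfolding moreau_def by (rule INF_lower) simp
    also have "\<dots> = ereal (?lo d + c / 2 * (norm d)\<^sup>2)"
      unfolding r plus_ereal.simps ereal.inject
      using c unfolding power2_norm_eq_inner
      by (simp add: inner_diff_left inner_diff_right inner_add_left inner_add_right inner_commute field_simps)
    finally show ?thesis .
  qed
  have th: "?lo d \<le> theta_c \<theta> c (?Z + d) \<and> theta_c \<theta> c (?Z + d) \<le> ?lo d + c / 2 * (norm d)\<^sup>2" for d
    using lo[of d] hi[of d] unfolding theta_c_def
    by (cases "moreau (1 / c) \<theta> (?Z + d)") auto
  show ?thesis
  proof (rule has_derivative_quadratic_bound[of _ _ _ "c / 2"])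
    fix d
    show "\<bar>theta_c \<theta> c (?Z + d) - theta_c \<theta> c ?Z - v \<bullet> d\<bar> \<le> c / 2 * (norm d)\<^sup>2"
      using th[of 0] th[of d] unfolding abs_le_iff by auto
  qed
qed

text \<open>The affine minorant given by a subgradient makes the prox objective coercive.\<close>
lemma resolvent_exists:
  fixes \<theta> :: "'z::euclidean_space \<Rightarrow> ereal"
  assumes proper: "proper_fun \<theta>" and lsc: "lsc_fun \<theta>" and conv: "convex_fun \<theta>"
    and v0: "v0 \<in> subdiff \<theta> x0" and fin0: "\<bar>\<theta> x0\<bar> \<noteq> \<infinity>" and c: "c > 0"
  obtains P v where "v \<in> subdiff \<theta> P" "\<bar>\<theta> P\<bar> \<noteq> \<infinity>" "Z = P + v /\<^sub>R c"
proof -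
  obtain r0 where r0: "\<theta> x0 = ereal r0" using fin0 by auto
  define q where "q Z' = c / 2 * (norm (Z' - Z))\<^sup>2" for Z'
  define J where "J Z' = \<theta> Z' + ereal (q Z')" for Z'
  \<comment> \<open>Half of the quadratic term absorbs the linear minorant; completing the square in
    \<open>norm (Z' - Z)\<close> leaves the constant \<open>(norm v0)\<^sup>2 / c\<close>.\<close>
  define B where "B = (norm v0)\<^sup>2 / c - r0 - v0 \<bullet> (Z - x0)"
  have coer: "ereal (c / 4 * (norm (Z' - Z))\<^sup>2 - B) \<le> J Z'" for Z'
  proof -
    have "0 \<le> c / 4 * (norm (Z' - Z) - 2 * norm v0 / c)\<^sup>2" using c by simp
    also have "\<dots> = c / 4 * (norm (Z' - Z))\<^sup>2 - norm v0 * norm (Z' - Z) + (norm v0)\<^sup>2 / c"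
      using c by (simp add: power2_eq_square field_simps)
    also have "\<dots> \<le> c / 4 * (norm (Z' - Z))\<^sup>2 + v0 \<bullet> (Z' - Z) + (norm v0)\<^sup>2 / c"
      using Cauchy_Schwarz_ineq2[of v0 "Z' - Z"] by linarith
    finally have "c / 4 * (norm (Z' - Z))\<^sup>2 - B \<le> r0 + v0 \<bullet> (Z' - x0) + q Z'"
      by (simp add: B_def q_def inner_diff_right)
    then have "ereal (c / 4 * (norm (Z' - Z))\<^sup>2 - B) \<le> (\<theta> x0 + ereal (v0 \<bullet> (Z' - x0))) + ereal (q Z')"
      by (simp add: r0)
    also have "\<dots> \<le> J Z'"
      unfolding J_def using v0 unfolding subdiff_def by (intro add_right_mono) blast
    finally show ?thesis .
  qed
  define m where "m = (INF Z'. J Z')"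
  have "m \<le> J x0" unfolding m_def by (rule INF_lower) simp
  moreover have "ereal (- B) \<le> m"
    unfolding m_def
  proof (rule INF_greatest)
    fix Z'
    have "ereal (- B) \<le> ereal (c / 4 * (norm (Z' - Z))\<^sup>2 - B)" using c by simp
    also note coer
    finally show "ereal (- B) \<le> J Z'" .
  qed
  ultimately obtain \<mu> where \<mu>: "m = ereal \<mu>" by (cases m) (auto simp: J_def r0)
  have "\<exists>Z'. J Z' < ereal (\<mu> + inverse (Suc k))" for k :: nat
  proof -
    have "m < ereal (\<mu> + inverse (Suc k))" by (simp add: \<mu>)
    then show ?thesis unfolding m_def INF_less_iff by blast
  qed
  then obtain s where s: "\<And>k::nat. J (s k) < ereal (\<mu> + inverse (Suc k))" by metis
  have "bounded (range s)"
  proof -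
    have "norm (s k - Z) \<le> sqrt (4 / c * (\<mu> + 1 + B))" for k
    proof -
      have "ereal (c / 4 * (norm (s k - Z))\<^sup>2 - B) < ereal (\<mu> + inverse (Suc k))"
        using coer s order_le_less_trans by blast
      then have "c / 4 * (norm (s k - Z))\<^sup>2 - B < \<mu> + inverse (Suc k)" by simp
      moreover have "inverse (real (Suc k)) \<le> 1" by (simp add: field_simps)
      ultimately have "c / 4 * (norm (s k - Z))\<^sup>2 \<le> \<mu> + 1 + B" by linarith
      then have "(norm (s k - Z))\<^sup>2 \<le> 4 / c * (\<mu> + 1 + B)" using c by (simp add: field_simps)
      then show ?thesis by (rule real_le_rsqrt)
    qed
    then have "range s \<subseteq> cball Z (sqrt (4 / c * (\<mu> + 1 + B)))" by (auto simp: dist_norm norm_minus_commute)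
    then show ?thesis using bounded_cball bounded_subset by blast
  qed
  then obtain P \<phi> where P: "strict_mono \<phi>" "(s \<circ> \<phi>) \<longlonglongrightarrow> P"
    using bounded_imp_convergent_subsequence by blast
  have s\<phi>: "(\<lambda>k. s (\<phi> k)) \<longlonglongrightarrow> P" using P(2) by (simp add: o_def)
  have "J P \<le> ereal \<mu>"
  proof (rule ccontr)
    assume "\<not> ?thesis"
    then obtain a where a: "\<mu> < a" "ereal a < J P"
      using ereal_dense2[of "ereal \<mu>" "J P"] by (auto simp: not_le)
    have "ereal (a - q P) < \<theta> P" using a(2) by (cases "\<theta> P") (auto simp: J_def)
    then obtain b where b: "a - q P < b" "ereal b < \<theta> P"
      using ereal_dense2[of "ereal (a - q P)" "\<theta> P"] by auto
    have "ereal b < Liminf (at P) \<theta>" using b(2) lsc unfolding lsc_fun_def by (meson order_less_le_trans)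
    then have "\<forall>\<^sub>F y in at P. ereal b < \<theta> y" using less_LiminfD by blast
    \<comment> \<open>\<open>Liminf (at P)\<close> ignores the value at \<open>P\<close>, which the
      sequence may attain; \<open>b(2)\<close> supplies it.\<close>
    then have "\<forall>\<^sub>F y in nhds P. ereal b < \<theta> y"
      using b(2) unfolding eventually_at_filter by (auto elim!: eventually_mono)
    from eventually_compose_filterlim[OF this s\<phi>] have 1: "\<forall>\<^sub>F k in sequentially. ereal b < \<theta> (s (\<phi> k))" .
    have "(\<lambda>k. q (s (\<phi> k))) \<longlonglongrightarrow> q P" unfolding q_def by (intro tendsto_intros s\<phi>)
    then have 2: "\<forall>\<^sub>F k in sequentially. a - b < q (s (\<phi> k))" using order_tendstoD(1) b(1) by force
    have "(\<lambda>k. \<mu> + inverse (real (Suc (\<phi> k)))) \<longlonglongrightarrow> \<mu> + 0"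
      using LIMSEQ_subseq_LIMSEQ[OF LIMSEQ_inverse_real_of_nat P(1)] by (intro tendsto_intros) (simp add: o_def)
    then have 3: "\<forall>\<^sub>F k in sequentially. \<mu> + inverse (real (Suc (\<phi> k))) < a" using order_tendstoD(2) a(1) by force
    from 1 2 3 have "\<forall>\<^sub>F k::nat in sequentially. False"
    proof eventually_elim
      case (elim k)
      have "ereal a < ereal b + ereal (q (s (\<phi> k)))" using elim by simp
      also have "\<dots> \<le> J (s (\<phi> k))" unfolding J_def using elim by (intro add_right_mono) simp
      also have "\<dots> < ereal (\<mu> + inverse (Suc (\<phi> k)))" by (rule s)
      finally show False using elim by simp
    qed
    then show False by simp
  qed
  then obtain r where r: "\<theta> P = ereal r"
    using proper unfolding proper_fun_def J_def by (cases "\<theta> P") auto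
  define v where "v = c *\<^sub>R (Z - P)"
  have "\<theta> P + ereal (v \<bullet> (Z' - P)) \<le> \<theta> Z'" for Z'
  proof (cases "\<theta> Z'")
    case (real s)
    define w where "w = Z' - P"
    \<comment> \<open>\<open>P\<close> is compared with a point on the segment towards
      \<open>Z'\<close>. Convexity bounds \<open>\<theta>\<close> there, and after division by
      \<open>t\<close> a term of order \<open>t\<close> is all that separates this from the
      subgradient inequality.\<close>
    have step: "v \<bullet> w - (s - r) \<le> t * (c / 2 * (norm w)\<^sup>2)" if t: "0 < t" "t \<le> 1" for t
    proof -
      have "(1 - t) *\<^sub>R (P, r) + t *\<^sub>R (Z', s) \<in> {(z, r). \<theta> z \<le> ereal r}"
        using conv t r real unfolding convex_fun_def by (intro convexD) auto
      moreover have "(1 - t) *\<^sub>R P + t *\<^sub>R Z' = P + t *\<^sub>R w" by (simp add: w_def algebra_simps)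
      ultimately have "\<theta> (P + t *\<^sub>R w) \<le> ereal ((1 - t) * r + t * s)" by simp
      then have "J (P + t *\<^sub>R w) \<le> ereal ((1 - t) * r + t * s) + ereal (q (P + t *\<^sub>R w))"
        unfolding J_def by (intro add_right_mono)
      moreover have "J P \<le> J (P + t *\<^sub>R w)"
        using \<open>J P \<le> ereal \<mu>\<close> \<mu> INF_lower[of "P + t *\<^sub>R w" UNIV J] unfolding m_def by auto
      moreover have "J P = ereal (r + q P)" by (simp add: J_def r)
      ultimately have "ereal (r + q P) \<le> ereal ((1 - t) * r + t * s) + ereal (q (P + t *\<^sub>R w))"
        by (metis order_trans)
      then have "r + q P \<le> (1 - t) * r + t * s + q (P + t *\<^sub>R w)" by simp
      moreover have "q (P + t *\<^sub>R w) = q P + t * (t * (c / 2 * (norm w)\<^sup>2)) - t * (v \<bullet> w)"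
        unfolding q_def v_def power2_norm_eq_inner
        by (simp add: inner_diff_left inner_diff_right inner_add_left inner_add_right inner_commute field_simps)
      ultimately have "t * (v \<bullet> w - (s - r)) \<le> t * (t * (c / 2 * (norm w)\<^sup>2))" by (simp add: algebra_simps)
      then show ?thesis using t by simp
    qed
    have "v \<bullet> w - (s - r) \<le> e * (c / 2 * (norm w)\<^sup>2)" if "e > 0" for e
    proof (cases "e \<le> 1")
      case True then show ?thesis using step that by blast
    next
      case False
      then have "1 * (c / 2 * (norm w)\<^sup>2) \<le> e * (c / 2 * (norm w)\<^sup>2)" using c by (intro mult_right_mono) auto
      then show ?thesis using step[of 1] by simp
    qed
    then have "v \<bullet> w - (s - r) \<le> 0" by (rule le_zero_if_le_all_mult)
    then show ?thesis by (simp add: r real w_def)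
  qed (use proper in \<open>auto simp: proper_fun_def\<close>)
  then have "v \<in> subdiff \<theta> P" by (simp add: subdiff_def)
  moreover have "Z = P + v /\<^sub>R c" using c by (simp add: v_def)
  ultimately show ?thesis using that r by simp
qed

text \<open>Every \<open>Z\<close> is a point \<open>P + v /\<^sub>R c\<close> with a subgradient
  \<open>v\<close> at \<open>P\<close>, so differentiability at such points is differentiability
  everywhere.\<close>

lemma theta_c_has_derivative_grad:
  fixes \<theta> :: "'z::euclidean_space \<Rightarrow> ereal"
  assumes "proper_fun \<theta>" "lsc_fun \<theta>" "convex_fun \<theta>" "v0 \<in> subdiff \<theta> x0" "\<bar>\<theta> x0\<bar> \<noteq> \<infinity>" "c > 0"
  shows "(theta_c \<theta> c has_derivative (\<lambda>d. grad (theta_c \<theta> c) Z \<bullet> d)) (at Z)"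
proof -
  obtain P v where Pv: "v \<in> subdiff \<theta> P" "\<bar>\<theta> P\<bar> \<noteq> \<infinity>" "Z = P + v /\<^sub>R c"
    by (rule resolvent_exists[OF assms, of Z])
  have d: "(theta_c \<theta> c has_derivative (\<lambda>d. v \<bullet> d)) (at Z)"
    unfolding Pv(3) by (rule theta_c_has_derivative_at_resolvent[OF Pv(1,2) assms(6)])
  show ?thesis unfolding grad_eqI[OF d] by (rule d)
qed

section \<open>An implicit function theorem under strong monotonicity\<close>

lemma mult_norm_le_if_sq_le:
  assumes "k * (norm v)\<^sup>2 \<le> b * norm v" "b \<ge> 0" shows "k * norm v \<le> b"
  using assms by (cases "v = 0") (auto simp: power2_eq_square)

lemma strongly_monotone_if_dir_deriv:
  fixes \<Phi> :: "'x::euclidean_space \<times> 'y::euclidean_space \<Rightarrow> 'x"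
  assumes S: "semismooth_on UNIV \<Phi> \<Phi>'" and conv: "convex A"
    and pos: "\<And>x u. x \<in> A \<Longrightarrow> \<kappa> * (norm u)\<^sup>2 \<le> \<Phi>' (x, y) (u, 0) \<bullet> u"
    and x: "x1 \<in> A" "x2 \<in> A"
  shows "\<kappa> * (norm (x1 - x2))\<^sup>2 \<le> (\<Phi> (x1, y) - \<Phi> (x2, y)) \<bullet> (x1 - x2)"
proof -
  define u where "u = x1 - x2"
  define H where "H s = \<Phi> (x2 + s *\<^sub>R u, y) \<bullet> u - s * (\<kappa> * (norm u)\<^sup>2)" for s
  have contP: "continuous_on UNIV \<Phi>"
    using semismooth_on_continuous[OF S] by (simp add: continuous_at_imp_continuous_on)
  have "H 0 \<le> H 1"
  proof (rule right_deriv_nonneg_imp_le[of 0 1 H])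
    show "continuous_on {0..1} H"
      unfolding H_def by (intro continuous_intros continuous_on_compose2[OF contP]) auto
    fix s :: real assume s: "0 \<le> s" "s < 1"
    have "x2 + s *\<^sub>R u = (1 - s) *\<^sub>R x2 + s *\<^sub>R x1" by (simp add: u_def algebra_simps)
    then have A: "x2 + s *\<^sub>R u \<in> A" using convexD[OF conv x(2,1), of "1 - s" s] s by simp
    let ?z = "(x2 + s *\<^sub>R u, y)"
    have "((\<lambda>t. (\<Phi> (?z + t *\<^sub>R (u, 0)) - \<Phi> ?z) /\<^sub>R t) \<longlongrightarrow> \<Phi>' ?z (u, 0)) (at_right 0)"
      using semismooth_on_has_dir_deriv[OF S, of ?z "(u, 0)"] unfolding has_dir_deriv_def by simp
    then have lim: "((\<lambda>t. ((\<Phi> (?z + t *\<^sub>R (u, 0)) - \<Phi> ?z) /\<^sub>R t) \<bullet> u - \<kappa> * (norm u)\<^sup>2) \<longlongrightarrow> \<Phi>' ?z (u, 0) \<bullet> u - \<kappa> * (norm u)\<^sup>2) (at_right 0)"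
      by (intro tendsto_intros)
    have "\<forall>\<^sub>F t in at_right (0::real). ((\<Phi> (?z + t *\<^sub>R (u, 0)) - \<Phi> ?z) /\<^sub>R t) \<bullet> u - \<kappa> * (norm u)\<^sup>2 = (H (s + t) - H s) /\<^sub>R t"
      using eventually_at_right_less[of "0::real"]
      by eventually_elim (simp add: H_def scaleR_add_left add.assoc inner_diff_left field_simps)
    from Lim_transform_eventually[OF lim this]
    show "\<exists>l\<ge>0. ((\<lambda>t. (H (s + t) - H s) /\<^sub>R t) \<longlongrightarrow> l) (at_right 0)"
      using pos[OF A, of u] by (intro exI[of _ "\<Phi>' ?z (u, 0) \<bullet> u - \<kappa> * (norm u)\<^sup>2"]) simp
  qed simp
  then show ?thesis by (simp add: H_def u_def inner_diff_left)
qed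

lemma strongly_convex_if_gradient_strongly_monotone:
  fixes \<phi> :: "'x::real_inner \<Rightarrow> real"
  assumes \<phi>: "\<And>x. (\<phi> has_derivative (\<lambda>d. p x \<bullet> d)) (at x)" and conv: "convex A"
    and mono: "\<And>x1 x2. x1 \<in> A \<Longrightarrow> x2 \<in> A \<Longrightarrow> \<kappa> * (norm (x1 - x2))\<^sup>2 \<le> (p x1 - p x2) \<bullet> (x1 - x2)"
    and x: "x1 \<in> A" "x2 \<in> A"
  shows "\<phi> x2 + p x2 \<bullet> (x1 - x2) + \<kappa> / 2 * (norm (x1 - x2))\<^sup>2 \<le> \<phi> x1"
proof -
  define u where "u = x1 - x2"
  define H where "H s = \<phi> (x2 + s *\<^sub>R u) - s * (p x2 \<bullet> u) - s\<^sup>2 * (\<kappa> / 2 * (norm u)\<^sup>2)" for s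
  have "H 0 \<le> H 1"
  proof (rule DERIV_nonneg_imp_nondecreasing[of 0 1 H])
    fix s :: real assume s: "0 \<le> s" "s \<le> 1"
    let ?l = "p (x2 + s *\<^sub>R u) \<bullet> u - p x2 \<bullet> u - 2 * s * (\<kappa> / 2 * (norm u)\<^sup>2)"
    have "((\<lambda>s. \<phi> (x2 + s *\<^sub>R u)) has_derivative (\<lambda>h. p (x2 + s *\<^sub>R u) \<bullet> (h *\<^sub>R u))) (at s)"
      by (rule has_derivative_compose[of "\<lambda>s. x2 + s *\<^sub>R u" "\<lambda>h. h *\<^sub>R u", OF _ \<phi>]) (auto intro!: derivative_eq_intros)
    then have "((\<lambda>s. \<phi> (x2 + s *\<^sub>R u)) has_real_derivative p (x2 + s *\<^sub>R u) \<bullet> u) (at s)"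
      unfolding has_field_derivative_def by (rule has_derivative_eq_rhs) (simp add: fun_eq_iff)
    then have D: "(H has_real_derivative ?l) (at s)"
      unfolding H_def by (auto intro!: derivative_eq_intros)
    \<comment> \<open>Monotonicity between \<open>x2 + s *\<^sub>R u\<close> and \<open>x2\<close>
      carries a factor \<open>s\<close> on the right and \<open>s * s\<close> on the left; dividing
      by \<open>s\<close> requires \<open>s > 0\<close>.\<close>
    have "0 \<le> ?l"
    proof (cases "s = 0")
      case False
      then have sp: "s > 0" using s by simp
      have "x2 + s *\<^sub>R u = (1 - s) *\<^sub>R x2 + s *\<^sub>R x1" by (simp add: u_def algebra_simps)
      then have A: "x2 + s *\<^sub>R u \<in> A" using convexD[OF conv x(2,1), of "1 - s" s] s by simp
      have "s * (s * (\<kappa> * (norm u)\<^sup>2)) \<le> s * ((p (x2 + s *\<^sub>R u) - p x2) \<bullet> u)"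
        using mono[OF A x(2)] by (simp add: power2_eq_square mult_ac)
      then show ?thesis using sp by (simp add: inner_diff_left)
    qed simp
    with D show "\<exists>y. (H has_real_derivative y) (at s) \<and> 0 \<le> y" by blast
  qed simp
  then show ?thesis by (simp add: H_def u_def)
qed

text \<open>Strong monotonicity makes the zero of the linearization unique, so every limit point of the
  difference quotients of \<open>X\<close> is that zero and no solvability argument is needed.\<close>
lemma semismooth_on_implicit_function:
  fixes \<Phi> :: "'x::euclidean_space \<times> 'y::euclidean_space \<Rightarrow> 'x"
  assumes S: "semismooth_on UNIV \<Phi> \<Phi>'" and \<kappa>: "\<kappa> > 0" and opV: "open V" and cA: "convex A" "open A"
    and pos: "\<And>x y u. x \<in> A \<Longrightarrow> y \<in> V \<Longrightarrow> \<kappa> * (norm u)\<^sup>2 \<le> \<Phi>' (x, y) (u, 0) \<bullet> u"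
    and X: "\<And>y. y \<in> V \<Longrightarrow> X y \<in> A" "\<And>y. y \<in> V \<Longrightarrow> \<Phi> (X y, y) = 0" and XL: "M-lipschitz_on V X"
  obtains X' where "semismooth_on V X X'" "\<And>y d. y \<in> V \<Longrightarrow> \<Phi>' (X y, y) (X' y d, d) = 0"
proof -
  \<comment> \<open>By nonlinearity, the difference of the values of \<open>\<Phi>'\<close> at
    \<open>(u1, d)\<close> and \<open>(u2, d)\<close> need not be a value at
    \<open>(u1 - u2, 0)\<close>. Instead, strong monotonicity of \<open>\<Phi>\<close> at the
    parameter \<open>y + t *\<^sub>R d\<close> is applied to \<open>X y + t *\<^sub>R u1\<close> and
    \<open>X y + t *\<^sub>R u2\<close>, and divided by \<open>t * t\<close>.\<close>
  have mono': "\<kappa> * norm (u1 - u2) \<le> norm (\<Phi>' (X y, y) (u1, d) - \<Phi>' (X y, y) (u2, d))" if y: "y \<in> V" for y u1 u2 d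
  proof -
    let ?z = "(X y, y)"
    let ?q = "\<lambda>u t. (\<Phi> (?z + t *\<^sub>R (u, d)) - \<Phi> ?z) /\<^sub>R t"
    have hd: "((?q u) \<longlongrightarrow> \<Phi>' ?z (u, d)) (at_right 0)" for u
      using semismooth_on_has_dir_deriv[OF S, of ?z "(u, d)"] unfolding has_dir_deriv_def by simp
    have lim: "((\<lambda>t. (?q u1 t - ?q u2 t) \<bullet> (u1 - u2)) \<longlongrightarrow> (\<Phi>' ?z (u1, d) - \<Phi>' ?z (u2, d)) \<bullet> (u1 - u2)) (at_right 0)"
      by (intro tendsto_intros hd)
    have inA: "\<forall>\<^sub>F t in at_right (0::real). X y + t *\<^sub>R u \<in> A" for u
    proof -
      have "((\<lambda>t::real. X y + t *\<^sub>R u) \<longlongrightarrow> X y + 0 *\<^sub>R u) (at_right 0)" by (intro tendsto_intros)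
      then show ?thesis using topological_tendstoD[OF _ cA(2)] X(1)[OF y] by simp
    qed
    have inV: "\<forall>\<^sub>F t in at_right (0::real). y + t *\<^sub>R d \<in> V"
    proof -
      have "((\<lambda>t::real. y + t *\<^sub>R d) \<longlongrightarrow> y + 0 *\<^sub>R d) (at_right 0)" by (intro tendsto_intros)
      then show ?thesis using topological_tendstoD[OF _ opV] y by simp
    qed
    have "\<forall>\<^sub>F t in at_right (0::real). \<kappa> * (norm (u1 - u2))\<^sup>2 \<le> (?q u1 t - ?q u2 t) \<bullet> (u1 - u2)"
      using inA[of u1] inA[of u2] inV eventually_at_right_less[of "0::real"]
    proof eventually_elim
      case (elim t)
      let ?a = "X y + t *\<^sub>R u1" and ?b = "X y + t *\<^sub>R u2" and ?y = "y + t *\<^sub>R d"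
      have "\<kappa> * (norm (?a - ?b))\<^sup>2 \<le> (\<Phi> (?a, ?y) - \<Phi> (?b, ?y)) \<bullet> (?a - ?b)"
        by (rule strongly_monotone_if_dir_deriv[OF S cA(1) pos]) (use elim in auto)
      moreover have "?a - ?b = t *\<^sub>R (u1 - u2)" by (simp add: algebra_simps)
      ultimately have "t * (t * (\<kappa> * (norm (u1 - u2))\<^sup>2)) \<le> t * ((\<Phi> (?a, ?y) - \<Phi> (?b, ?y)) \<bullet> (u1 - u2))"
        by (simp add: power2_eq_square mult_ac)
      then have "t * (\<kappa> * (norm (u1 - u2))\<^sup>2) \<le> (\<Phi> (?a, ?y) - \<Phi> (?b, ?y)) \<bullet> (u1 - u2)" using elim by simp
      moreover have "?q u1 t - ?q u2 t = (\<Phi> (?a, ?y) - \<Phi> (?b, ?y)) /\<^sub>R t" by (simp flip: scaleR_diff_right)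
      then have "(?q u1 t - ?q u2 t) \<bullet> (u1 - u2) = ((\<Phi> (?a, ?y) - \<Phi> (?b, ?y)) \<bullet> (u1 - u2)) / t"
        by (simp add: divide_inverse mult.commute)
      ultimately show ?case using elim by (simp add: pos_le_divide_eq mult.commute)
    qed
    then have "\<kappa> * (norm (u1 - u2))\<^sup>2 \<le> (\<Phi>' ?z (u1, d) - \<Phi>' ?z (u2, d)) \<bullet> (u1 - u2)"
      by (rule tendsto_lowerbound[OF lim]) simp
    also have "\<dots> \<le> norm (\<Phi>' ?z (u1, d) - \<Phi>' ?z (u2, d)) * norm (u1 - u2)" by (rule norm_cauchy_schwarz)
    finally show ?thesis by (rule mult_norm_le_if_sq_le) simp
  qed
  define K where "K y h = (X (y + h) - X y, h)" for y h
  have K: "\<forall>\<^sub>F h in nhds 0. norm (K y h) \<le> (M + 1) * norm h" and inV: "\<forall>\<^sub>F h in nhds 0. y + h \<in> V"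
    if y: "y \<in> V" for y
  proof -
    obtain r where r: "r > 0" "ball y r \<subseteq> V" using opV y openE by blast
    show ev: "\<forall>\<^sub>F h in nhds 0. y + h \<in> V"
      using eventually_nhds_0_ball[OF r(1), of y] by eventually_elim (use r in blast)
    then show "\<forall>\<^sub>F h in nhds 0. norm (K y h) \<le> (M + 1) * norm h"
    proof eventually_elim
      case (elim h)
      have "norm (X (y + h) - X y) \<le> M * norm h"
        using lipschitz_onD[OF XL elim y] by (simp add: dist_norm)
      then show ?case using norm_Pair_le[of "X (y + h) - X y" h] unfolding K_def by (simp add: algebra_simps)
    qed
  qed
  have zK: "(X y, y) + K y h = (X (y + h), y + h)" for y h by (simp add: K_def)
  \<comment> \<open>\<open>\<Phi>\<close> vanishes at both graph points, so its first-order
    expansion leaves the derivative term alone as o(h).\<close>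
  have Q: "little_o (\<lambda>h. \<Phi>' (X y, y) (K y h))" if y: "y \<in> V" for y
  proof (rule little_o_dom[OF little_o_compose[OF semismooth_on_bdiff[OF S] K[OF y]], of "(X y, y)" _ 1])
    show "\<forall>\<^sub>F h in nhds 0. norm (\<Phi>' (X y, y) (K y h))
        \<le> 1 * norm (\<Phi> ((X y, y) + K y h) - \<Phi> (X y, y) - \<Phi>' (X y, y) (K y h))"
      using inV[OF y] by eventually_elim (simp add: zK X(2) y)
  qed simp
  \<comment> \<open>The difference quotients of \<open>X\<close> along \<open>d\<close> are bounded;
    a limit point of them solves the linearized equation because \<open>\<Phi>'\<close> at the graph
    point is Lipschitz in the direction.\<close>
  have ex: "\<exists>u. \<Phi>' (X y, y) (u, d) = 0" if y: "y \<in> V" for y d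
  proof -
    define t where "t k = inverse (real (Suc k))" for k
    have t: "t k > 0" "t \<longlonglongrightarrow> 0" for k
      unfolding t_def using LIMSEQ_inverse_real_of_nat by auto
    have "(\<lambda>k. t k *\<^sub>R d) \<longlonglongrightarrow> 0 *\<^sub>R d" by (intro tendsto_intros t)
    then have td: "(\<lambda>k. t k *\<^sub>R d) \<longlonglongrightarrow> 0" by simp
    define u where "u k = (X (y + t k *\<^sub>R d) - X y) /\<^sub>R t k" for k
    obtain N where N: "\<And>k. k \<ge> N \<Longrightarrow> y + t k *\<^sub>R d \<in> V"
      using eventually_compose_filterlim[OF inV[OF y] td] unfolding eventually_sequentially by blast
    have "norm (u (k + N)) \<le> M * norm d" for k
    proof -
      have "norm (X (y + t (k + N) *\<^sub>R d) - X y) \<le> M * (t (k + N) * norm d)"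
        using lipschitz_onD[OF XL N[of "k + N"] y] t(1)[of "k + N"] by (simp add: dist_norm)
      moreover have "norm (u (k + N)) = norm (X (y + t (k + N) *\<^sub>R d) - X y) / t (k + N)"
        using t(1)[of "k + N"] unfolding u_def norm_scaleR by (simp add: divide_inverse mult.commute)
      ultimately show ?thesis using t(1)[of "k + N"] by (simp add: pos_divide_le_eq mult_ac)
    qed
    then have "bounded (range (\<lambda>k. u (k + N)))" by (auto intro!: boundedI)
    then obtain v \<psi> where \<psi>: "strict_mono \<psi>" "((\<lambda>k. u (k + N)) \<circ> \<psi>) \<longlonglongrightarrow> v"
      using bounded_imp_convergent_subsequence by blast
    define \<phi> where "\<phi> k = \<psi> k + N" for k
    have \<phi>: "strict_mono \<phi>" using \<psi>(1) by (auto simp: strict_mono_def \<phi>_def)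
    have uv: "(\<lambda>k. u (\<phi> k)) \<longlonglongrightarrow> v" using \<psi>(2) by (simp add: o_def \<phi>_def)
    obtain r C where C: "r > 0" "C \<ge> 0" "\<And>z d1 d2. z \<in> ball (X y, y) r \<Longrightarrow> norm (\<Phi>' z d1 - \<Phi>' z d2) \<le> C * norm (d1 - d2)"
      using semismooth_on_deriv_lipschitz[OF S UNIV_I, of "(X y, y)"] by metis
    have eq: "\<Phi>' (X y, y) (K y (t k *\<^sub>R d)) = t k *\<^sub>R \<Phi>' (X y, y) (u k, d)" for k
    proof -
      have "K y (t k *\<^sub>R d) = t k *\<^sub>R (u k, d)" using t(1)[of k] by (simp add: K_def u_def)
      then show ?thesis using semismooth_on_scale[OF S, of "(X y, y)" "t k" "(u k, d)"] t(1)[of k] by simp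
    qed
    have "norm (\<Phi>' (X y, y) (v, d)) \<le> e * norm d" if e: "e > 0" for e
    proof -
      have "\<forall>\<^sub>F k in sequentially. norm (\<Phi>' (X y, y) (K y (t k *\<^sub>R d))) \<le> e * norm (t k *\<^sub>R d)"
        using eventually_compose_filterlim[OF little_oD[OF Q[OF y] e] td] .
      then have "\<forall>\<^sub>F k in sequentially. norm (\<Phi>' (X y, y) (u k, d)) \<le> e * norm d"
      proof eventually_elim
        case (elim k)
        then have "t k * norm (\<Phi>' (X y, y) (u k, d)) \<le> t k * (e * norm d)"
          unfolding eq using t(1)[of k] by (simp add: mult_ac)
        then show ?case using t(1)[of k] by simp
      qed
      then have "\<forall>\<^sub>F k in sequentially. norm (\<Phi>' (X y, y) (u (\<phi> k), d)) \<le> e * norm d"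
        using \<phi> eventually_subseq by blast
      then have ev: "\<forall>\<^sub>F k in sequentially. norm (\<Phi>' (X y, y) (v, d)) \<le> e * norm d + C * norm (v - u (\<phi> k))"
      proof eventually_elim
        case (elim k)
        have "norm (\<Phi>' (X y, y) (v, d) - \<Phi>' (X y, y) (u (\<phi> k), d)) \<le> C * norm (v - u (\<phi> k))"
          using C(3)[of "(X y, y)" "(v, d)" "(u (\<phi> k), d)"] C(1) by (simp add: norm_Pair)
        with elim norm_triangle_sub[of "\<Phi>' (X y, y) (v, d)" "\<Phi>' (X y, y) (u (\<phi> k), d)"] show ?case by linarith
      qed
      have "(\<lambda>k. e * norm d + C * norm (v - u (\<phi> k))) \<longlonglongrightarrow> e * norm d + C * norm (v - v)"
        by (intro tendsto_intros uv)
      from tendsto_lowerbound[OF this ev] show ?thesis by simp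
    qed
    then have "norm (\<Phi>' (X y, y) (v, d)) \<le> 0" by (rule le_zero_if_le_all_mult)
    then show ?thesis by auto
  qed
  define X' where "X' y d = (SOME u. \<Phi>' (X y, y) (u, d) = 0)" for y d
  have X': "\<Phi>' (X y, y) (X' y d, d) = 0" if "y \<in> V" for y d
    unfolding X'_def using someI_ex[OF ex[OF that]] .
  have bd: "little_o (\<lambda>h. X (y + h) - X y - X' y h)" if y: "y \<in> V" for y
  proof (rule little_o_dom[OF Q[OF y], of _ "1 / \<kappa>"], rule always_eventually, rule allI)
    fix h
    have "\<kappa> * norm (X (y + h) - X y - X' y h) \<le> norm (\<Phi>' (X y, y) (K y h))"
      using mono'[OF y, of "X (y + h) - X y" "X' y h" h] X'[OF y] by (simp add: K_def)
    then show "norm (X (y + h) - X y - X' y h) \<le> 1 / \<kappa> * norm (\<Phi>' (X y, y) (K y h))"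
      using \<kappa> by (simp add: field_simps)
  qed
  have "semismooth_on V X X'"
  proof (rule semismooth_onI[OF opV])
    fix y assume y: "y \<in> V"
    obtain r where "r > 0" "ball y r \<subseteq> V" using opV y openE by blast
    then show "\<exists>r>0. \<exists>C. C-lipschitz_on (ball y r) X" using lipschitz_on_subset[OF XL] by blast
    show "little_o (\<lambda>h. X (y + h) - X y - X' y h)" by (rule bd[OF y])
    show "X' y (t *\<^sub>R d) = t *\<^sub>R X' y d" if t: "0 \<le> t" for t d
    proof -
      have "\<Phi>' (X y, y) (t *\<^sub>R X' y d, t *\<^sub>R d) = 0"
        using semismooth_on_scale[OF S _ t, of "(X y, y)" "(X' y d, d)"] X'[OF y] by simp
      then have "\<kappa> * norm (X' y (t *\<^sub>R d) - t *\<^sub>R X' y d) \<le> 0"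
        using mono'[OF y, of "X' y (t *\<^sub>R d)" "t *\<^sub>R X' y d" "t *\<^sub>R d"] X'[OF y] by simp
      then show ?thesis using \<kappa> by (simp add: mult_le_0_iff)
    qed
    \<comment> \<open>\<open>(X' (y + h) h, h)\<close> is a zero of \<open>\<Phi>'\<close> at the
      moved graph point, and \<open>(X' y h, h)\<close> is one up to o(h); strong monotonicity at
      \<open>y + h\<close> compares their first components.\<close>
    show "little_o (\<lambda>h. X' (y + h) h - X' y h)"
    proof -
      let ?z = "(X y, y)"
      obtain r C where C: "r > 0" "C \<ge> 0" "\<And>z d1 d2. z \<in> ball ?z r \<Longrightarrow> norm (\<Phi>' z d1 - \<Phi>' z d2) \<le> C * norm (d1 - d2)"
        using semismooth_on_deriv_lipschitz[OF S UNIV_I, of ?z] by metis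
      have 1: "little_o (\<lambda>h. \<Phi>' (?z + K y h) (K y h) - \<Phi>' ?z (K y h))"
        using little_o_compose[OF semismooth_on_semi[OF S UNIV_I] K[OF y]] .
      have "isCont (\<lambda>h::'y. (M + 1) * norm h) 0" by (intro continuous_intros)
      then have "((\<lambda>h::'y. (M + 1) * norm h) \<longlongrightarrow> (M + 1) * norm (0::'y)) (nhds 0)"
        by (simp add: continuous_at tendsto_nhds_iff)
      then have "(K y \<longlongrightarrow> 0) (nhds 0)" using Lim_null_comparison[OF K[OF y]] by simp
      from eventually_compose_filterlim[OF eventually_nhds_0_ball[OF C(1), of ?z] this]
      have near: "\<forall>\<^sub>F h in nhds 0. ?z + K y h \<in> ball ?z r" .
      have 2: "little_o (\<lambda>h. \<Phi>' (?z + K y h) (X' y h, h) - \<Phi>' (?z + K y h) (K y h))"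
      proof (rule little_o_dom[OF bd[OF y], of _ C])
        show "\<forall>\<^sub>F h in nhds 0. norm (\<Phi>' (?z + K y h) (X' y h, h) - \<Phi>' (?z + K y h) (K y h))
            \<le> C * norm (X (y + h) - X y - X' y h)"
          using near
        proof eventually_elim
          case (elim h)
          from C(3)[OF elim, of "(X' y h, h)" "K y h"] show ?case
            by (simp add: K_def norm_Pair norm_minus_commute)
        qed
      qed
      have 3: "little_o (\<lambda>h. \<Phi>' (?z + K y h) (X' y h, h))"
        using little_o_add[OF little_o_add[OF 1 2] Q[OF y]] by simp
      show ?thesis
      proof (rule little_o_dom[OF 3, of _ "1 / \<kappa>"])
        show "\<forall>\<^sub>F h in nhds 0. norm (X' (y + h) h - X' y h) \<le> 1 / \<kappa> * norm (\<Phi>' (?z + K y h) (X' y h, h))"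
          using inV[OF y]
        proof eventually_elim
          case (elim h)
          have "\<kappa> * norm (X' (y + h) h - X' y h) \<le> norm (\<Phi>' (?z + K y h) (X' y h, h))"
            using mono'[OF elim, of "X' (y + h) h" "X' y h" h] X'[OF elim] by (simp add: zK)
          then show ?case using \<kappa> by (simp add: field_simps)
        qed
      qed
    qed
  qed
  with X' show ?thesis using that by blast
qed

text \<open>Strong convexity compares the minimizer \<open>m\<close> over a closed ball with
  \<open>xb\<close>, where the gradient is small for \<open>y\<close> near \<open>yb\<close>; this
  gives a bound on \<open>norm (m - xb)\<close> linear in \<open>norm (y - yb)\<close>. For
  \<open>y\<close> close to \<open>yb\<close> the minimizer is therefore interior, hence a zero of
  \<open>\<Phi>\<close>, and strong convexity makes it unique.\<close>

lemma semismooth_on_local_minimizer_map: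
  fixes \<phi> :: "'x::euclidean_space \<Rightarrow> 'y::euclidean_space \<Rightarrow> real" and \<Phi> :: "'x \<times> 'y \<Rightarrow> 'x"
  assumes \<phi>: "\<And>x y. ((\<lambda>x. \<phi> x y) has_derivative (\<lambda>d. \<Phi> (x, y) \<bullet> d)) (at x)"
    and S: "semismooth_on UNIV \<Phi> \<Phi>'" and zero: "\<Phi> (xb, yb) = 0" and \<kappa>: "\<kappa> > 0" and r: "r > 0"
    and pos: "\<And>x y u. x \<in> ball xb r \<Longrightarrow> y \<in> ball yb r \<Longrightarrow> \<kappa> * (norm u)\<^sup>2 \<le> \<Phi>' (x, y) (u, 0) \<bullet> u"
  obtains \<epsilon> \<delta> X X' where "\<epsilon> > 0" "\<delta> > 0" "X yb = xb"
    "\<And>y. y \<in> ball yb \<delta> \<Longrightarrow> {x. is_arg_min (\<lambda>x. \<phi> x y) (\<lambda>x. x \<in> ball xb \<epsilon>) x} = {X y}"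
    "\<And>y. y \<in> ball yb \<delta> \<Longrightarrow> \<Phi> (X y, y) = 0"
    "semismooth_on (ball yb \<delta>) X X'" "\<And>y d. y \<in> ball yb \<delta> \<Longrightarrow> \<Phi>' (X y, y) (X' y d, d) = 0"
proof -
  obtain r1 C where r1: "r1 > 0" "C-lipschitz_on (ball (xb, yb) r1) \<Phi>" using semismooth_on_lipschitz[OF S UNIV_I] by blast
  define r2 where "r2 = min r (r1 / 2)"
  have r2: "r2 > 0" "r2 \<le> r" using r r1 by (auto simp: r2_def)
  have inb: "(x, y) \<in> ball (xb, yb) r1" if "x \<in> ball xb r2" "y \<in> ball yb r2" for x y
  proof -
    have "dist (xb, yb) (x, y) \<le> dist xb x + dist yb y"
      by (simp add: dist_Pair_Pair sqrt_sum_squares_le_sum)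
    then show ?thesis using that by (auto simp: r2_def)
  qed
  define L where "L = C + 1"
  have L: "L > 0" using lipschitz_on_nonneg[OF r1(2)] by (simp add: L_def)
  have Lip: "norm (\<Phi> (x, y1) - \<Phi> (x, y2)) \<le> L * norm (y1 - y2)"
    if "x \<in> ball xb r2" "y1 \<in> ball yb r2" "y2 \<in> ball yb r2" for x y1 y2
  proof -
    have "norm (\<Phi> (x, y1) - \<Phi> (x, y2)) \<le> C * norm (y1 - y2)"
      using lipschitz_onD[OF r1(2) inb[OF that(1,2)] inb[OF that(1,3)]] by (simp add: dist_Pair_Pair dist_norm)
    also have "\<dots> \<le> L * norm (y1 - y2)" by (intro mult_right_mono) (auto simp: L_def)
    finally show ?thesis .
  qed
  have mono: "\<kappa> * (norm (x1 - x2))\<^sup>2 \<le> (\<Phi> (x1, y) - \<Phi> (x2, y)) \<bullet> (x1 - x2)"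
    if "x1 \<in> ball xb r2" "x2 \<in> ball xb r2" "y \<in> ball yb r2" for x1 x2 y
    by (rule strongly_monotone_if_dir_deriv[OF S convex_ball[of xb r2] pos]) (use that r2 in auto)
  have growth: "\<phi> x2 y + \<Phi> (x2, y) \<bullet> (x1 - x2) + \<kappa> / 2 * (norm (x1 - x2))\<^sup>2 \<le> \<phi> x1 y"
    if "x1 \<in> ball xb r2" "x2 \<in> ball xb r2" "y \<in> ball yb r2" for x1 x2 y
    by (rule strongly_convex_if_gradient_strongly_monotone[where p="\<lambda>x. \<Phi> (x, y)", OF \<phi> convex_ball mono that(1,2)]) (use that in auto)
  \<comment> \<open>Half the radius, so that the closed ball on which the minimum is attained stays
    inside the region of strong convexity.\<close>
  define \<epsilon> where "\<epsilon> = r2 / 2"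
  have \<epsilon>: "\<epsilon> > 0" "cball xb \<epsilon> \<subseteq> ball xb r2" using r2 by (auto simp: \<epsilon>_def)
  \<comment> \<open>Makes the distance bound \<open>2 * L / \<kappa> * norm (y - yb)\<close> smaller
    than \<open>\<epsilon>\<close>, so the minimizer stays off the boundary.\<close>
  define \<delta> where "\<delta> = min r2 (\<kappa> * \<epsilon> / (2 * L))"
  have \<delta>: "\<delta> > 0" "\<delta> \<le> r2" "\<delta> \<le> \<kappa> * \<epsilon> / (2 * L)" using r2 \<kappa> \<epsilon> L by (auto simp: \<delta>_def)
  have inr: "y \<in> ball yb r2" if "y \<in> ball yb \<delta>" for y using that \<delta>(2) by auto
  have "\<exists>m\<in>ball xb \<epsilon>. (\<forall>x\<in>ball xb \<epsilon>. \<phi> m y \<le> \<phi> x y) \<and> norm (m - xb) \<le> 2 * L / \<kappa> * norm (y - yb)"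
    if y: "y \<in> ball yb \<delta>" for y
  proof -
    have "continuous_on (cball xb \<epsilon>) (\<lambda>x. \<phi> x y)"
      using \<phi> has_derivative_continuous by (intro continuous_at_imp_continuous_on) blast
    from continuous_attains_inf[OF compact_cball _ this] \<epsilon>(1)
    obtain m where m: "m \<in> cball xb \<epsilon>" "\<And>x. x \<in> cball xb \<epsilon> \<Longrightarrow> \<phi> m y \<le> \<phi> x y" by auto
    have xb: "xb \<in> ball xb r2" "yb \<in> ball yb r2" "xb \<in> cball xb \<epsilon>" using r2 \<epsilon> by auto
    have "\<kappa> / 2 * (norm (m - xb))\<^sup>2 \<le> - (\<Phi> (xb, y) \<bullet> (m - xb))"
      using growth[of m xb y] m(1) m(2)[OF xb(3)] xb \<epsilon>(2) inr[OF y] by auto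
    also have "\<dots> \<le> norm (\<Phi> (xb, y)) * norm (m - xb)" using Cauchy_Schwarz_ineq2[of "\<Phi> (xb, y)" "m - xb"] by linarith
    also have "\<dots> \<le> L * norm (y - yb) * norm (m - xb)"
      using Lip[OF xb(1) inr[OF y] xb(2)] zero by (intro mult_right_mono) auto
    finally have "\<kappa> / 2 * norm (m - xb) \<le> L * norm (y - yb)" by (rule mult_norm_le_if_sq_le) (use L in simp)
    then have b: "norm (m - xb) \<le> 2 * L / \<kappa> * norm (y - yb)" using \<kappa> by (simp add: field_simps)
    have "norm (y - yb) < \<kappa> * \<epsilon> / (2 * L)" using y \<delta>(3) by (simp add: dist_norm norm_minus_commute)
    then have "2 * L / \<kappa> * norm (y - yb) < \<epsilon>" using L \<kappa> by (simp add: field_simps)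
    with b have "m \<in> ball xb \<epsilon>" by (simp add: dist_norm norm_minus_commute)
    with m(2) b show ?thesis by (intro bexI[of _ m]) auto
  qed
  then obtain X where X: "\<And>y. y \<in> ball yb \<delta> \<Longrightarrow> X y \<in> ball xb \<epsilon>"
    "\<And>y x. y \<in> ball yb \<delta> \<Longrightarrow> x \<in> ball xb \<epsilon> \<Longrightarrow> \<phi> (X y) y \<le> \<phi> x y"
    "\<And>y. y \<in> ball yb \<delta> \<Longrightarrow> norm (X y - xb) \<le> 2 * L / \<kappa> * norm (y - yb)" by metis
  have Xr: "X y \<in> ball xb r2" if "y \<in> ball yb \<delta>" for y
    using X(1)[OF that] \<epsilon>(2) ball_subset_cball by blast
  have Z: "\<Phi> (X y, y) = 0" if y: "y \<in> ball yb \<delta>" for y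
  proof -
    have "(\<lambda>d. \<Phi> (X y, y) \<bullet> d) = (\<lambda>v. 0)"
      by (rule differential_zero_maxmin[OF X(1)[OF y] open_ball \<phi>[of y "X y"]]) (use X(2)[OF y] in blast)
    then have "\<Phi> (X y, y) \<bullet> \<Phi> (X y, y) = 0" by metis
    then show ?thesis by simp
  qed
  have am: "{x. is_arg_min (\<lambda>x. \<phi> x y) (\<lambda>x. x \<in> ball xb \<epsilon>) x} = {X y}" if y: "y \<in> ball yb \<delta>" for y
  proof -
    have "x = X y" if x: "x \<in> ball xb \<epsilon>" "\<phi> x y \<le> \<phi> (X y) y" for x
    proof -
      have "x \<in> ball xb r2" using x(1) \<epsilon>(2) ball_subset_cball by blast
      from growth[OF this Xr[OF y] inr[OF y]] x(2) Z[OF y] have "\<kappa> * (norm (x - X y))\<^sup>2 \<le> 0" by simp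
      then show ?thesis using \<kappa> by (simp add: mult_le_0_iff)
    qed
    then show ?thesis
      using X(1)[OF y] X(2)[OF y] unfolding is_arg_min_def by (fastforce simp: not_less)
  qed
  have XL: "(L / \<kappa>)-lipschitz_on (ball yb \<delta>) X"
  proof (rule lipschitz_onI)
    fix y1 y2 assume y: "y1 \<in> ball yb \<delta>" "y2 \<in> ball yb \<delta>"
    have "\<kappa> * (norm (X y1 - X y2))\<^sup>2 \<le> (\<Phi> (X y1, y1) - \<Phi> (X y2, y1)) \<bullet> (X y1 - X y2)"
      by (rule mono[OF Xr[OF y(1)] Xr[OF y(2)] inr[OF y(1)]])
    \<comment> \<open>Exchanging the zero \<open>\<Phi> (X y1, y1)\<close> for the zero
      \<open>\<Phi> (X y2, y2)\<close> leaves a difference in the parameter alone.\<close>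
    also have "\<dots> = (\<Phi> (X y2, y2) - \<Phi> (X y2, y1)) \<bullet> (X y1 - X y2)" by (simp only: Z[OF y(1)] Z[OF y(2)])
    also have "\<dots> \<le> norm (\<Phi> (X y2, y2) - \<Phi> (X y2, y1)) * norm (X y1 - X y2)" by (rule norm_cauchy_schwarz)
    also have "\<dots> \<le> L * norm (y1 - y2) * norm (X y1 - X y2)"
      using Lip[OF Xr[OF y(2)] inr[OF y(2)] inr[OF y(1)]] by (intro mult_right_mono) (auto simp: norm_minus_commute)
    finally have "\<kappa> * norm (X y1 - X y2) \<le> L * norm (y1 - y2)" by (rule mult_norm_le_if_sq_le) (use L in simp)
    then show "dist (X y1) (X y2) \<le> L / \<kappa> * dist y1 y2" using \<kappa> by (simp add: dist_norm field_simps)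
  qed (use L \<kappa> in simp)
  have "\<kappa> * (norm u)\<^sup>2 \<le> \<Phi>' (x, y) (u, 0) \<bullet> u" if "x \<in> ball xb r" "y \<in> ball yb \<delta>" for x y u
    using pos that \<delta>(2) r2(2) by auto
  moreover have "X y \<in> ball xb r" if "y \<in> ball yb \<delta>" for y using Xr[OF that] r2(2) by auto
  ultimately obtain X' where X': "semismooth_on (ball yb \<delta>) X X'" "\<And>y d. y \<in> ball yb \<delta> \<Longrightarrow> \<Phi>' (X y, y) (X' y d, d) = 0"
    using semismooth_on_implicit_function[OF S \<kappa> open_ball convex_ball open_ball _ _ Z XL] by metis
  have "X yb = xb" using X(3)[of yb] \<delta>(1) by simp
  then show ?thesis using that[OF \<epsilon>(1) \<delta>(1) _ am Z X'] by blast
qed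

section \<open>The Lagrangian and its generalized Hessian\<close>

lemma C2_has_derivative:
  fixes G :: "'a::real_normed_vector \<Rightarrow> 'b::real_normed_vector"
  assumes "C2 G"
  shows "(G has_derivative blinfun_apply (Fderiv G x)) (at x)"
    and "(Fderiv G has_derivative blinfun_apply (Fderiv (Fderiv G) x)) (at x)"
    and "continuous_on UNIV (Fderiv (Fderiv G))"
proof -
  obtain G' :: "'a \<Rightarrow> 'a \<Rightarrow>\<^sub>L 'b" and G'' where G: "\<And>x. (G has_derivative blinfun_apply (G' x)) (at x)"
    "\<And>x. (G' has_derivative blinfun_apply (G'' x)) (at x)" "continuous_on UNIV G''"
    using assms unfolding C2_def by blast
  have 1: "Fderiv G = G'" using Fderiv_eqI[OF G(1)] by blast
  have 2: "Fderiv G' = G''" using Fderiv_eqI[OF G(2)] by blast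
  show "(G has_derivative blinfun_apply (Fderiv G x)) (at x)"
    "(Fderiv G has_derivative blinfun_apply (Fderiv (Fderiv G) x)) (at x)"
    "continuous_on UNIV (Fderiv (Fderiv G))"
    unfolding 1 2 by (rule G)+
qed

lemma C2_continuous: "C2 G \<Longrightarrow> continuous_on UNIV G" "C2 G \<Longrightarrow> continuous_on UNIV (Fderiv G)"
  using C2_has_derivative has_derivative_continuous by (metis continuous_at_imp_continuous_on)+

lemma C2_semismooth_on: "C2 G \<Longrightarrow> semismooth_on UNIV G (\<lambda>x. blinfun_apply (Fderiv G x))"
  by (rule semismooth_on_C1) (auto intro: C2_has_derivative C2_continuous)

lemma C2_Fderiv_semismooth_on: "C2 G \<Longrightarrow> semismooth_on UNIV (Fderiv G) (\<lambda>x. blinfun_apply (Fderiv (Fderiv G) x))"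
  by (rule semismooth_on_C1) (auto intro: C2_has_derivative C2_continuous)

lemma semismooth_on_linear_compose:
  assumes "semismooth_on U G G'" "bounded_linear T" shows "semismooth_on U (\<lambda>x. T (G x)) (\<lambda>x d. T (G' x d))"
  by (rule semismooth_on_compose[OF assms(1) semismooth_on_bounded_linear[OF assms(2)]]) simp

lemma semismooth_on_const: "semismooth_on UNIV (\<lambda>x. a) (\<lambda>x d. 0)"
  using semismooth_on_affine[OF bounded_linear_zero, of a] by simp

lemma semismooth_on_add: "semismooth_on U G G' \<Longrightarrow> semismooth_on U H H' \<Longrightarrow> semismooth_on U (\<lambda>x. G x + H x) (\<lambda>x d. G' x d + H' x d)"
  using semismooth_on_linear_compose[OF semismooth_on_Pair bounded_linear_add[OF bounded_linear_fst bounded_linear_snd]] by simp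

lemma semismooth_on_diff: "semismooth_on U G G' \<Longrightarrow> semismooth_on U H H' \<Longrightarrow> semismooth_on U (\<lambda>x. G x - H x) (\<lambda>x d. G' x d - H' x d)"
  using semismooth_on_linear_compose[OF semismooth_on_Pair bounded_linear_sub[OF bounded_linear_fst bounded_linear_snd]] by simp

lemma semismooth_on_scaleR: "semismooth_on U G G' \<Longrightarrow> semismooth_on U (\<lambda>x. r *\<^sub>R G x) (\<lambda>x d. r *\<^sub>R G' x d)"
  by (rule semismooth_on_linear_compose[OF _ bounded_linear_scaleR_right])

lemma semismooth_on_adjoint:
  fixes V :: "'c::real_normed_vector \<Rightarrow> 'a::euclidean_space \<Rightarrow>\<^sub>L 'b::euclidean_space"
  assumes "semismooth_on U V V'" "semismooth_on U z z'"
  shows "semismooth_on U (\<lambda>x. adjoint (V x) (z x)) (\<lambda>x d. adjoint (V x) (z' x d) + adjoint (V' x d) (z x))"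
  using semismooth_on_compose[OF semismooth_on_Pair[OF assms] semismooth_on_bounded_bilinear[OF bounded_bilinear_adjoint]] by simp

lemma semismooth_on_compose_UNIV:
  "semismooth_on U G G' \<Longrightarrow> semismooth_on UNIV H H' \<Longrightarrow> semismooth_on U (\<lambda>x. H (G x)) (\<lambda>x d. H' (G x) (G' x d))"
  by (rule semismooth_on_compose) auto

lemma jacobian_eq_Fderiv:
  fixes h :: "real^'n \<Rightarrow> real^'m"
  assumes "h differentiable (at x)"
  shows "jacobian h (at x) *v d = Fderiv h x d"
    and "transpose (jacobian h (at x)) *v z = adjoint (blinfun_apply (Fderiv h x)) z"
proof -
  have "(h has_derivative (\<lambda>d. jacobian h (at x) *v d)) (at x)" using assms jacobian_works by blast
  then have eq: "(\<lambda>d. jacobian h (at x) *v d) = blinfun_apply (Fderiv h x)"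
    using Fderiv_works[OF assms] has_derivative_unique by blast
  then show "jacobian h (at x) *v d = Fderiv h x d" by metis
  show "transpose (jacobian h (at x)) *v z = adjoint (blinfun_apply (Fderiv h x)) z"
    unfolding eq[symmetric] adjoint_matrix ..
qed

locale C2_data =
  fixes f :: "real^'n \<Rightarrow> real" and F :: "real^'n \<Rightarrow> 'z::euclidean_space"
    and h :: "real^'n \<Rightarrow> real^'m" and g :: "real^'n \<Rightarrow> 'y::euclidean_space"
  assumes C2: "C2 f" "C2 F" "C2 h" "C2 g"
begin

text \<open>Taken as a function of the point and the multipliers jointly, because the multipliers
  will be replaced by the update, which itself depends on the point.\<close>

definition Lagr_gradient :: "(real^'n) \<times> 'z \<times> (real^'m) \<times> 'y \<Rightarrow> real^'n" where
  "Lagr_gradient z = adjoint (Fderiv f (fst z)) 1 + adjoint (Fderiv F (fst z)) (fst (snd z))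
     + adjoint (Fderiv h (fst z)) (fst (snd (snd z))) - adjoint (Fderiv g (fst z)) (snd (snd (snd z)))"

definition Lagr_gradient_deriv :: "(real^'n) \<times> 'z \<times> (real^'m) \<times> 'y \<Rightarrow> (real^'n) \<times> 'z \<times> (real^'m) \<times> 'y \<Rightarrow> real^'n" where
  "Lagr_gradient_deriv z d = adjoint (Fderiv (Fderiv f) (fst z) (fst d)) 1
     + (adjoint (Fderiv F (fst z)) (fst (snd d)) + adjoint (Fderiv (Fderiv F) (fst z) (fst d)) (fst (snd z)))
     + (adjoint (Fderiv h (fst z)) (fst (snd (snd d))) + adjoint (Fderiv (Fderiv h) (fst z) (fst d)) (fst (snd (snd z))))
     - (adjoint (Fderiv g (fst z)) (snd (snd (snd d))) + adjoint (Fderiv (Fderiv g) (fst z) (fst d)) (snd (snd (snd z))))"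

lemma Lagr_gradient_semismooth_on: "semismooth_on UNIV Lagr_gradient Lagr_gradient_deriv"
proof -
  have 1: "semismooth_on UNIV (\<lambda>z. fst z) (\<lambda>z d :: (real^'n) \<times> 'z \<times> (real^'m) \<times> 'y. fst d)"
    by (rule semismooth_on_bounded_linear[OF bounded_linear_fst])
  have 2: "semismooth_on UNIV (\<lambda>z. fst (snd z)) (\<lambda>z d :: (real^'n) \<times> 'z \<times> (real^'m) \<times> 'y. fst (snd d))"
    "semismooth_on UNIV (\<lambda>z. fst (snd (snd z))) (\<lambda>z d :: (real^'n) \<times> 'z \<times> (real^'m) \<times> 'y. fst (snd (snd d)))"
    "semismooth_on UNIV (\<lambda>z. snd (snd (snd z))) (\<lambda>z d :: (real^'n) \<times> 'z \<times> (real^'m) \<times> 'y. snd (snd (snd d)))"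
    by (intro semismooth_on_bounded_linear bounded_linear_intros)+
  note D = C2[THEN C2_Fderiv_semismooth_on, THEN semismooth_on_compose_UNIV[OF 1]]
  have "semismooth_on UNIV (\<lambda>z. adjoint (Fderiv f (fst z)) 1 + adjoint (Fderiv F (fst z)) (fst (snd z))
     + adjoint (Fderiv h (fst z)) (fst (snd (snd z))) - adjoint (Fderiv g (fst z)) (snd (snd (snd z))))
     (\<lambda>z d :: (real^'n) \<times> 'z \<times> (real^'m) \<times> 'y. (adjoint (Fderiv f (fst z)) 0 + adjoint (Fderiv (Fderiv f) (fst z) (fst d)) 1)
     + (adjoint (Fderiv F (fst z)) (fst (snd d)) + adjoint (Fderiv (Fderiv F) (fst z) (fst d)) (fst (snd z)))
     + (adjoint (Fderiv h (fst z)) (fst (snd (snd d))) + adjoint (Fderiv (Fderiv h) (fst z) (fst d)) (fst (snd (snd z))))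
     - (adjoint (Fderiv g (fst z)) (snd (snd (snd d))) + adjoint (Fderiv (Fderiv g) (fst z) (fst d)) (snd (snd (snd z)))))"
    by (intro semismooth_on_add semismooth_on_diff semismooth_on_adjoint D 2 semismooth_on_const)
  moreover have "adjoint (Fderiv f x) 0 = 0" for x
    by (rule bounded_bilinear.zero_right[OF bounded_bilinear_adjoint])
  ultimately show ?thesis unfolding Lagr_gradient_def[abs_def] Lagr_gradient_deriv_def[abs_def] by simp
qed

lemmas adj_simps =
  bounded_bilinear.add_right[OF bounded_bilinear_adjoint] bounded_bilinear.diff_right[OF bounded_bilinear_adjoint]
  bounded_bilinear.scaleR_right[OF bounded_bilinear_adjoint] bounded_bilinear.minus_right[OF bounded_bilinear_adjoint]
  bounded_bilinear.zero_right[OF bounded_bilinear_adjoint]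
  bounded_bilinear.add_left[OF bounded_bilinear_adjoint] bounded_bilinear.scaleR_left[OF bounded_bilinear_adjoint]

lemma Lagr_has_derivative:
  "((\<lambda>x. Lagr f F h g x y) has_derivative (\<lambda>d. Lagr_gradient (x, y) \<bullet> d)) (at x)"
proof -
  obtain Y \<mu> l where y: "y = (Y, \<mu>, l)" by (cases y) auto
  note D = C2[THEN C2_has_derivative(1)]
  show ?thesis unfolding y Lagr.simps
    by (rule has_derivative_eq_rhs, (rule derivative_intros D)+)
      (simp add: Lagr_gradient_def inner_adjoint inner_add_left inner_diff_left)
qed

lemma grad_Lagr: "grad (\<lambda>x. Lagr f F h g x y) x = Lagr_gradient (x, y)"
  by (rule grad_eqI[OF Lagr_has_derivative])

lemma Lagr_gradient_has_derivative: "((\<lambda>x. Lagr_gradient (x, y)) has_derivative (\<lambda>u. Lagr_gradient_deriv (x, y) (u, 0))) (at x)"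
proof -
  note D = C2[THEN C2_has_derivative(2)]
  note A = bounded_linear.has_derivative[OF bounded_bilinear.bounded_linear_left[OF bounded_bilinear_adjoint]]
  show ?thesis unfolding Lagr_gradient_def fst_conv snd_conv
    by (rule has_derivative_eq_rhs, (rule derivative_intros A D)+) (simp add: Lagr_gradient_deriv_def adj_simps)
qed

lemma Fderiv_grad_Lagr: "Fderiv (grad (\<lambda>x. Lagr f F h g x y)) x u = Lagr_gradient_deriv (x, y) (u, 0)"
proof -
  have d: "(grad (\<lambda>x. Lagr f F h g x y) has_derivative (\<lambda>u. Lagr_gradient_deriv (x, y) (u, 0))) (at x)"
    using Lagr_gradient_has_derivative by (simp add: grad_Lagr[abs_def])
  then show ?thesis
    using Fderiv_works[of "grad (\<lambda>x. Lagr f F h g x y)" x] has_derivative_unique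
    unfolding differentiable_def by metis
qed

lemma Lagr_gradient_deriv_selfadjoint: "Lagr_gradient_deriv (x, y) (a, 0) \<bullet> b = Lagr_gradient_deriv (x, y) (b, 0) \<bullet> a"
  by (rule grad_derivative_selfadjoint[OF Lagr_has_derivative Lagr_gradient_has_derivative])

lemma Lagr_gradient_deriv_split: "Lagr_gradient_deriv (x, y) (u, v1, v2, v3) =
    Lagr_gradient_deriv (x, y) (u, 0) + (adjoint (Fderiv F x) v1 + adjoint (Fderiv h x) v2 - adjoint (Fderiv g x) v3)"
  by (simp add: Lagr_gradient_deriv_def adj_simps)

text \<open>When \<open>x\<close> moves by \<open>d\<close>, the updated multipliers move by the
  three vectors on the right, up to the choice of \<open>W1\<close> and \<open>W2\<close>. So the
  operator of B1 is a linearization in \<open>x\<close> of the gradient of the augmented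
  Lagrangian.\<close>

lemma A_op_eq:
  "A_op f F h g x y c W1 W2 d = Lagr_gradient_deriv (x, y) (d, W1 (Fderiv F x d), c *\<^sub>R Fderiv h x d, - c *\<^sub>R W2 (Fderiv g x d))"
proof -
  have "h differentiable (at x)" using C2_has_derivative(1)[OF C2(3)] by (auto simp: differentiable_def)
  note J = jacobian_eq_Fderiv[OF this]
  show ?thesis
    unfolding A_op_def Fderiv_grad_Lagr J Lagr_gradient_deriv_split by (simp add: adj_simps)
qed

lemma linear_A_op: "linear (A_op f F h g x y c W1 W2)"
  by (rule linearI) (simp_all add: A_op_eq Lagr_gradient_deriv_def adj_simps blinfun.add_right blinfun.add_left
      blinfun.scaleR_right blinfun.scaleR_left algebra_simps)

lemma A_op_selfadjoint:
  assumes "\<And>a b. blinfun_apply W1 a \<bullet> b = blinfun_apply W1 b \<bullet> a" "\<And>a b. blinfun_apply W2 a \<bullet> b = blinfun_apply W2 b \<bullet> a"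
  shows "A_op f F h g x y c W1 W2 a \<bullet> b = A_op f F h g x y c W1 W2 b \<bullet> a"
  using assms(1)[of "Fderiv F x a" "Fderiv F x b"] assms(2)[of "Fderiv g x a" "Fderiv g x b"] Lagr_gradient_deriv_selfadjoint[of x y a b]
  unfolding A_op_eq Lagr_gradient_deriv_split[of _ _ _ "blinfun_apply W1 _"] inner_add_left inner_diff_left inner_adjoint
  by (simp add: inner_commute)

text \<open>B2 only bounds a quadratic form. It becomes a bound on the operator norm because the elements
  of the B-subdifferentials of gradients are self-adjoint.\<close>
lemma V_vec_norm_le:
  assumes s1: "\<And>a b. blinfun_apply W1 a \<bullet> b = blinfun_apply W1 b \<bullet> a" and s2: "\<And>a b. blinfun_apply W2 a \<bullet> b = blinfun_apply W2 b \<bullet> a"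
    and co: "\<eta> > 0" "\<And>d. d \<bullet> A_op f F h g x y c W1 W2 d \<ge> \<eta> * (d \<bullet> d)"
    and form: "\<And>d. \<bar>(V_vec f F h g x y c W1 W2 d + d /\<^sub>R c) \<bullet> d\<bar> \<le> m * (norm d)\<^sup>2"
  shows "inj (A_op f F h g x y c W1 W2)"
    and "norm (V_vec f F h g x y c W1 W2 d + d /\<^sub>R c) \<le> m * norm d"
proof -
  let ?A = "A_op f F h g x y c W1 W2"
  have "a = 0" if "?A a = 0" for a
  proof -
    have "\<eta> * (a \<bullet> a) \<le> 0" using co(2)[of a] that by simp
    then have "a \<bullet> a \<le> 0" using co(1) by (auto simp: mult_le_0_iff)
    then have "a \<bullet> a = 0" using inner_ge_zero by (rule antisym)
    then show ?thesis by simp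
  qed
  then show inj: "inj ?A" using linear_injective_0[OF linear_A_op] by blast
  then have surj: "surj ?A" using linear_injective_imp_surjective[OF linear_A_op] by blast
  define R where "R d = - (adjoint (Fderiv F x) (W1 (fst d)) /\<^sub>R c) - adjoint (Fderiv h x) (fst (snd d))
      + adjoint (Fderiv g x) (W2 (snd (snd d)))" for d
  define u where "u d = inv ?A (R d)" for d
  have Au: "?A (u d) = R d" for d unfolding u_def by (rule surj_f_inv_f[OF surj])
  have ueq: "u d = v" if "?A v = R d" for d v by (rule injD[OF inj]) (simp only: Au that)
  have ul: "u (a + b) = u a + u b" "u (r *\<^sub>R a) = r *\<^sub>R u a" for a b r
    by (rule ueq, simp add: linear_add[OF linear_A_op] linear_scale[OF linear_A_op] Au R_def adj_simps
        blinfun.add_right blinfun.scaleR_right algebra_simps)+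
  define S where "S d = V_vec f F h g x y c W1 W2 d + d /\<^sub>R c" for d
  have "h differentiable (at x)" using C2_has_derivative(1)[OF C2(3)] by (auto simp: differentiable_def)
  note J = jacobian_eq_Fderiv[OF this]
  \<comment> \<open>Adding \<open>d /\<^sub>R c\<close> cancels the terms of \<open>V_vec\<close> in
    which \<open>d\<close> enters without \<open>W1\<close> or \<open>W2\<close>, and adds one in
    the middle component.\<close>
  have S: "S d = (W1 (Fderiv F x (u d)) /\<^sub>R c + W1 (fst d) /\<^sub>R c\<^sup>2,
      Fderiv h x (u d) + fst (snd d) /\<^sub>R c, W2 (snd (snd d)) /\<^sub>R c - W2 (Fderiv g x (u d)))" for d
    by (cases d, simp only: S_def V_vec.simps Let_def J u_def R_def fst_conv snd_conv) simp
  have lin: "linear S"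
    by (rule linearI) (simp_all add: S ul blinfun.add_right blinfun.scaleR_right algebra_simps)
  \<comment> \<open>The terms containing \<open>u a\<close> combine to
    \<open>- (R b \<bullet> u a)\<close>, and \<open>R b\<close> is the operator applied to
    \<open>u b\<close>. Symmetry of \<open>S\<close> thus reduces to symmetry of the operator and of
    \<open>W1\<close> and \<open>W2\<close>.\<close>
  have Sab: "S a \<bullet> b = W1 (fst a) \<bullet> fst b / c\<^sup>2 + fst (snd a) \<bullet> fst (snd b) / c + W2 (snd (snd a)) \<bullet> snd (snd b) / c
      - ?A (u b) \<bullet> u a" for a b
  proof -
    have "?A (u b) \<bullet> u a = - (W1 (Fderiv F x (u a)) \<bullet> fst b / c) - Fderiv h x (u a) \<bullet> fst (snd b)
        + W2 (Fderiv g x (u a)) \<bullet> snd (snd b)"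
      unfolding Au R_def inner_add_left inner_diff_left inner_minus_left inner_scaleR_left inner_adjoint
      using s1[of "fst b" "Fderiv F x (u a)"] s2[of "snd (snd b)" "Fderiv g x (u a)"]
      by (simp add: inner_commute divide_inverse mult.commute)
    then show ?thesis
      unfolding S by (simp add: inner_prod_def inner_add_left inner_diff_left divide_inverse algebra_simps)
  qed
  have "S a \<bullet> b = S b \<bullet> a" for a b
    unfolding Sab using s1[of "fst a" "fst b"] s2[of "snd (snd a)" "snd (snd b)"] A_op_selfadjoint[OF s1 s2, of x y c "u a" "u b"]
    by (simp add: inner_commute)
  from selfadjoint_norm_le[OF lin this, of m d] show "norm (V_vec f F h g x y c W1 W2 d + d /\<^sub>R c) \<le> m * norm d"
    using form by (simp add: S_def)
qed

text \<open>\<open>V_vec\<close> linearizes the difference of the updated and the old multiplier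
  divided by \<open>c\<close>, so adding \<open>d /\<^sub>R c\<close> and multiplying by
  \<open>c\<close> recovers the change \<open>m\<close> of the update. Sorting the linearized
  equation by \<open>u\<close> and \<open>d\<close> gives the linear system that is solved inside
  \<open>V_vec\<close>.\<close>

lemma V_vec_of_linearized_solution:
  assumes inj: "inj (A_op f F h g x y c W1 W2)" and c: "c > 0"
    and m: "m = (blinfun_apply W1 (Fderiv F x u + fst d /\<^sub>R c), fst (snd d) + c *\<^sub>R Fderiv h x u, blinfun_apply W2 (snd (snd d) - c *\<^sub>R Fderiv g x u))"
    and zero: "Lagr_gradient_deriv (x, y) (u, m) = 0"
  shows "m = c *\<^sub>R (V_vec f F h g x y c W1 W2 d + d /\<^sub>R c)"
proof -
  obtain dY d\<mu> dl where d: "d = (dY, d\<mu>, dl)" by (cases d) auto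
  have "h differentiable (at x)" using C2_has_derivative(1)[OF C2(3)] by (auto simp: differentiable_def)
  note J = jacobian_eq_Fderiv[OF this]
  have "A_op f F h g x y c W1 W2 u = - (adjoint (Fderiv F x) (W1 dY) /\<^sub>R c) - adjoint (Fderiv h x) d\<mu>
                 + adjoint (Fderiv g x) (W2 dl)"
    using zero unfolding m d A_op_eq Lagr_gradient_deriv_split
    by (simp add: adj_simps blinfun.add_right blinfun.diff_right blinfun.scaleR_right algebra_simps)
  then have u: "inv (A_op f F h g x y c W1 W2) (- (adjoint (Fderiv F x) (W1 dY) /\<^sub>R c) - adjoint (Fderiv h x) d\<mu>
                 + adjoint (Fderiv g x) (W2 dl)) = u" using inv_f_f[OF inj] by metis
  show ?thesis
    unfolding m d V_vec.simps J u Let_def using c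
    by (simp add: blinfun.add_right blinfun.diff_right blinfun.scaleR_right scaleR_add_right scaleR_diff_right power2_eq_square)
qed

end

section \<open>The augmented Lagrangian\<close>

text \<open>The penalty \<open>c\<close> is fixed, since \<epsilon> and \<delta> may depend on it.
  The multiplier and finiteness at \<open>xbar\<close> provide the affine minorant of
  \<open>\<theta>\<close> from which differentiability of its envelope is derived.\<close>

locale augmented_problem = C2_data f F h g
  for f :: "real^'n \<Rightarrow> real" and F :: "real^'n \<Rightarrow> 'z::euclidean_space"
    and h :: "real^'n \<Rightarrow> real^'m" and g :: "real^'n \<Rightarrow> 'y::euclidean_space" +
  fixes \<theta> :: "'z \<Rightarrow> ereal" and K :: "'y set" and c :: real
    and xbar :: "real^'n" and ybar :: "'z \<times> (real^'m) \<times> 'y"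
  assumes \<theta>: "proper_fun \<theta>" "lsc_fun \<theta>" "convex_fun \<theta>" and fin: "\<bar>\<theta> (F xbar)\<bar> \<noteq> \<infinity>" and c: "c > 0"
    and mult: "ybar \<in> multipliers f F h g \<theta> K xbar"
    and sm\<theta>: "\<And>Z. semismooth_at (Fderiv (theta_c \<theta> c)) Z"
    and smP: "\<And>w. semismooth_at (closest_point (dual_cone K)) w"
begin

definition p :: "'z \<Rightarrow> 'z" where "p = grad (theta_c \<theta> c)"
definition P :: "'y \<Rightarrow> 'y" where "P = closest_point (dual_cone K)"

lemma semismooth: "semismooth_at p Z" "semismooth_at P w"
  unfolding p_def P_def by (rule semismooth_grad sm\<theta> smP)+

lemma ybar_in_subdiff: "fst ybar \<in> subdiff \<theta> (F xbar)"
  using mult by (auto simp: multipliers_def)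

lemma theta_c_has_derivative: "(theta_c \<theta> c has_derivative (\<lambda>d. p Z \<bullet> d)) (at Z)"
  unfolding p_def by (rule theta_c_has_derivative_grad[OF \<theta> ybar_in_subdiff fin c])

section \<open>The multiplier update and the gradient of the augmented Lagrangian\<close>

definition M where "M z = mult_update F h g \<theta> K c (fst z) (snd z)"

lemma M_eq: "M z = (p (F (fst z) + fst (snd z) /\<^sub>R c), fst (snd (snd z)) + c *\<^sub>R h (fst z),
    P (snd (snd (snd z)) - c *\<^sub>R g (fst z)))"
  by (cases z) (simp add: M_def p_def P_def)

definition M' where
  "M' z d = (dir_deriv p (F (fst z) + fst (snd z) /\<^sub>R c) (Fderiv F (fst z) (fst d) + fst (snd d) /\<^sub>R c),
     fst (snd (snd d)) + c *\<^sub>R Fderiv h (fst z) (fst d),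
     dir_deriv P (snd (snd (snd z)) - c *\<^sub>R g (fst z)) (snd (snd (snd d)) - c *\<^sub>R Fderiv g (fst z) (fst d)))"

lemma M_semismooth_on: "semismooth_on UNIV M M'"
proof -
  have 1: "semismooth_on UNIV (\<lambda>z. fst z) (\<lambda>z d :: (real^'n) \<times> 'z \<times> (real^'m) \<times> 'y. fst d)"
    by (rule semismooth_on_bounded_linear[OF bounded_linear_fst])
  have 2: "semismooth_on UNIV (\<lambda>z. fst (snd z)) (\<lambda>z d :: (real^'n) \<times> 'z \<times> (real^'m) \<times> 'y. fst (snd d))"
    "semismooth_on UNIV (\<lambda>z. fst (snd (snd z))) (\<lambda>z d :: (real^'n) \<times> 'z \<times> (real^'m) \<times> 'y. fst (snd (snd d)))"
    "semismooth_on UNIV (\<lambda>z. snd (snd (snd z))) (\<lambda>z d :: (real^'n) \<times> 'z \<times> (real^'m) \<times> 'y. snd (snd (snd d)))"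
    by (intro semismooth_on_bounded_linear bounded_linear_intros)+
  note D = C2(2-4)[THEN C2_semismooth_on, THEN semismooth_on_compose_UNIV[OF 1]]
  show ?thesis
    unfolding M_eq[abs_def] M'_def[abs_def]
    by (intro semismooth_on_Pair semismooth_on_compose_UNIV[OF _ semismooth_at_imp_semismooth_on] semismooth semismooth_on_add semismooth_on_diff semismooth_on_scaleR D 2)
qed

definition \<Phi> where "\<Phi> z = Lagr_gradient (fst z, M z)"
definition \<Phi>' where "\<Phi>' z d = Lagr_gradient_deriv (fst z, M z) (fst d, M' z d)"

lemma \<Phi>_semismooth_on: "semismooth_on UNIV \<Phi> \<Phi>'"
  unfolding \<Phi>_def[abs_def] \<Phi>'_def[abs_def]
  by (intro semismooth_on_compose_UNIV[OF semismooth_on_Pair Lagr_gradient_semismooth_on] M_semismooth_on semismooth_on_bounded_linear bounded_linear_fst)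

lemma aug_Lagr_has_derivative:
  "((\<lambda>x. aug_Lagr f F h g \<theta> K c x y) has_derivative (\<lambda>d. \<Phi> (x, y) \<bullet> d)) (at x)"
proof -
  obtain Y \<mu> l where y: "y = (Y, \<mu>, l)" by (cases y) auto
  note D = C2[THEN C2_has_derivative(1), of x]
  have 1: "((\<lambda>x. theta_c \<theta> c (F x + Y /\<^sub>R c)) has_derivative (\<lambda>d. p (F x + Y /\<^sub>R c) \<bullet> (Fderiv F x d))) (at x)"
    by (rule has_derivative_compose[OF _ theta_c_has_derivative, of "\<lambda>x. F x + Y /\<^sub>R c"])
      (auto intro!: derivative_eq_intros D)
  define q where "q x = (norm (P (l - c *\<^sub>R g x)))\<^sup>2 / 2" for x
  \<comment> \<open>The terms independent of \<open>x\<close> are collected; the half in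
    \<open>q\<close> turns the factor \<open>1 / (2 * c)\<close> of the penalty into
    \<open>1 / c\<close>.\<close>
  define k where "k = (norm Y)\<^sup>2 / (2 * c) + (norm l)\<^sup>2 / (2 * c)"
  have 2: "(q has_derivative (\<lambda>d. P (l - c *\<^sub>R g x) \<bullet> (- c *\<^sub>R Fderiv g x d))) (at x)"
    unfolding q_def
    by (rule has_derivative_compose[of "\<lambda>x. l - c *\<^sub>R g x", OF _ half_norm_closest_point_has_derivative[of K, folded P_def]])
      (auto intro!: derivative_eq_intros D)
  have eq: "(\<lambda>x. aug_Lagr f F h g \<theta> K c x y) = (\<lambda>x. f x + theta_c \<theta> c (F x + Y /\<^sub>R c)
     + \<mu> \<bullet> h x + c / 2 * (h x \<bullet> h x) + 1 / c * q x - k)"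
    by (simp add: y P_def q_def k_def power2_norm_eq_inner fun_eq_iff right_diff_distrib)
  show ?thesis unfolding eq
    by (rule has_derivative_eq_rhs, (rule derivative_intros D 1 2)+)
      (unfold \<Phi>_def Lagr_gradient_def inner_add_left inner_diff_left inner_adjoint,
        use c in \<open>simp add: y M_eq inner_add_left inner_add_right inner_commute fun_eq_iff\<close>)
qed

text \<open>The optimality conditions are fixed-point equations of the update: the subgradient
  condition through the resolvent point \<open>F xbar + Y /\<^sub>R c\<close>, complementarity
  through the projection, and \<open>h xbar = 0\<close> for the middle component.\<close>

lemma M_bar: "M (xbar, ybar) = ybar"
proof -
  obtain Y \<mu> l where y: "ybar = (Y, \<mu>, l)" by (cases ybar) auto
  have m: "Y \<in> subdiff \<theta> (F xbar)" "h xbar = 0" "g xbar \<in> K" "l \<in> dual_cone K" "g xbar \<bullet> l = 0"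
    using mult by (auto simp: y multipliers_def)
  have "p (F xbar + Y /\<^sub>R c) = Y"
    unfolding p_def by (rule grad_eqI[OF theta_c_has_derivative_at_resolvent[OF m(1) fin c]])
  moreover have "P (l - c *\<^sub>R g xbar) = l"
    unfolding P_def by (rule closest_point_dual_cone_complementary) (use m c in auto)
  ultimately show ?thesis by (simp add: M_eq y m(2))
qed

lemma \<Phi>_bar: "\<Phi> (xbar, ybar) = 0"
proof -
  have "grad (\<lambda>x. Lagr f F h g x ybar) xbar = 0"
    using mult by (cases ybar) (simp add: multipliers_def del: Lagr.simps)
  then show ?thesis by (simp add: \<Phi>_def M_bar grad_Lagr)
qed

section \<open>Coercivity of the linearized gradient near the reference point\<close>

lemma W_sets:
  "W1_set F \<theta> xbar ybar c = B_subdiff p (F xbar + fst ybar /\<^sub>R c)"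
  "W2_set g K xbar ybar c = B_subdiff P (snd (snd ybar) - c *\<^sub>R g xbar)"
  by (cases ybar, simp add: p_def P_def)+

lemma W_selfadjoint:
  "W1 \<in> B_subdiff p Z \<Longrightarrow> blinfun_apply W1 a \<bullet> b = blinfun_apply W1 b \<bullet> a"
  "W2 \<in> B_subdiff P w \<Longrightarrow> blinfun_apply W2 a' \<bullet> b' = blinfun_apply W2 b' \<bullet> a'"
  using B_subdiff_grad_selfadjoint[OF theta_c_has_derivative]
    B_subdiff_grad_selfadjoint[OF half_norm_closest_point_has_derivative[of K, folded P_def]] by blast+

text \<open>The form \<open>d \<mapsto> \<langle>\<Phi>'((x, y); (d, 0)), d\<rangle>\<close> with the multipliers and the generalized
  derivatives of \<open>p\<close> and \<open>P\<close> made explicit, so that its continuity in all of them is visible.\<close>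
definition Q where
  "Q x m W1 W2 v = Fderiv (Fderiv f) x v v + fst m \<bullet> Fderiv (Fderiv F) x v v
     + fst (snd m) \<bullet> Fderiv (Fderiv h) x v v - snd (snd m) \<bullet> Fderiv (Fderiv g) x v v
     + blinfun_apply W1 (Fderiv F x v) \<bullet> Fderiv F x v + c * (Fderiv h x v \<bullet> Fderiv h x v)
     + c * (blinfun_apply W2 (Fderiv g x v) \<bullet> Fderiv g x v)"

text \<open>Directional derivatives are positively homogeneous, so the negative factor
  \<open>- c\<close> stays inside the direction until the linear \<open>W2\<close> replaces the
  derivative; its sign then cancels that of the \<open>g\<close> term of the Lagrangian.\<close>

lemma \<Phi>'_form:
  assumes "dir_deriv p (F x + fst y /\<^sub>R c) (Fderiv F x v) = blinfun_apply W1 (Fderiv F x v)"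
    and "dir_deriv P (snd (snd y) - c *\<^sub>R g x) (- c *\<^sub>R Fderiv g x v) = blinfun_apply W2 (- c *\<^sub>R Fderiv g x v)"
  shows "\<Phi>' (x, y) (v, 0) \<bullet> v = Q x (M (x, y)) W1 W2 v"
  using assms
  by (simp add: \<Phi>'_def Lagr_gradient_deriv_def M'_def Q_def inner_add_left inner_diff_left inner_adjoint
      blinfun.scaleR_right blinfun.minus_right)

lemma A_op_form: "v \<bullet> A_op f F h g xbar ybar c W1 W2 v = Q xbar ybar W1 W2 v"
  by (subst inner_commute)
    (simp add: A_op_eq Lagr_gradient_deriv_def Q_def inner_add_left inner_diff_left inner_adjoint)

lemma tendsto_Q:
  assumes x: "x \<longlonglongrightarrow> xl" and m: "m \<longlonglongrightarrow> ml" and W: "W1 \<longlonglongrightarrow> W1l" "W2 \<longlonglongrightarrow> W2l" and v: "v \<longlonglongrightarrow> vl"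
  shows "(\<lambda>k::nat. Q (x k) (m k) (W1 k) (W2 k) (v k)) \<longlonglongrightarrow> Q xl ml W1l W2l vl"
proof -
  have "isCont (Fderiv (Fderiv f)) xl" "isCont (Fderiv (Fderiv F)) xl" "isCont (Fderiv (Fderiv h)) xl"
    "isCont (Fderiv (Fderiv g)) xl" "isCont (Fderiv F) xl" "isCont (Fderiv h) xl" "isCont (Fderiv g) xl"
    using C2[THEN C2_has_derivative(3)] C2[THEN C2_continuous(2)]
    by (auto simp: continuous_on_eq_continuous_at)
  note T = this[THEN isCont_tendsto_compose, OF x]
  show ?thesis unfolding Q_def by (intro tendsto_intros T m W v)
qed

text \<open>If the bound failed at points tending to \<open>(xbar, ybar)\<close>, unit directions
  and representing elements of the B-subdifferentials would subconverge, and the limit would violate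
  B1. Halving \<open>\<eta>\<close> leaves the gap for the contradiction.\<close>

lemma \<Phi>'_coercive:
  assumes \<eta>: "\<eta> > 0"
    and B1: "\<And>W1 W2 d. W1 \<in> W1_set F \<theta> xbar ybar c \<Longrightarrow> W2 \<in> W2_set g K xbar ybar c \<Longrightarrow>
      d \<bullet> A_op f F h g xbar ybar c W1 W2 d \<ge> \<eta> * (d \<bullet> d)"
  shows "\<exists>r>0. \<forall>x\<in>ball xbar r. \<forall>y\<in>ball ybar r. \<forall>u. \<eta> / 2 * (norm u)\<^sup>2 \<le> \<Phi>' (x, y) (u, 0) \<bullet> u"
proof (rule ccontr)
  assume "\<not> ?thesis"
  then have *: "\<forall>r>0. \<exists>x\<in>ball xbar r. \<exists>y\<in>ball ybar r. \<exists>u. \<Phi>' (x, y) (u, 0) \<bullet> u < \<eta> / 2 * (norm u)\<^sup>2"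
    by (meson not_le)
  have "\<exists>x y u. x \<in> ball xbar (inverse (Suc k)) \<and> y \<in> ball ybar (inverse (Suc k)) \<and>
      \<Phi>' (x, y) (u, 0) \<bullet> u < \<eta> / 2 * (norm u)\<^sup>2" for k :: nat
  proof -
    have "0 < inverse (real (Suc k))" by simp
    with * show ?thesis by blast
  qed
  then obtain x y u where xyu: "\<And>k::nat. x k \<in> ball xbar (inverse (Suc k))" "\<And>k. y k \<in> ball ybar (inverse (Suc k))"
    "\<And>k. \<Phi>' (x k, y k) (u k, 0) \<bullet> u k < \<eta> / 2 * (norm (u k))\<^sup>2" by metis
  have xl: "x \<longlonglongrightarrow> xbar" by (rule LIMSEQ_dist_less_inverse_Suc) (use xyu(1) in \<open>simp add: dist_commute\<close>)
  have yl: "y \<longlonglongrightarrow> ybar" by (rule LIMSEQ_dist_less_inverse_Suc) (use xyu(2) in \<open>simp add: dist_commute\<close>)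
  define v where "v k = u k /\<^sub>R norm (u k)" for k
  have u0: "u k \<noteq> 0" for k
  proof
    assume "u k = 0"
    with xyu(3)[of k] show False by simp
  qed
  have v: "v k \<in> sphere 0 1" for k using u0[of k] by (simp add: v_def)
  have v\<Phi>: "\<Phi>' (x k, y k) (v k, 0) \<bullet> v k < \<eta> / 2" for k
  proof -
    let ?n = "norm (u k)"
    have n: "?n > 0" using u0 by simp
    have "\<Phi>' (x k, y k) (v k, 0) = \<Phi>' (x k, y k) (u k, 0) /\<^sub>R ?n"
      using semismooth_on_scale[OF \<Phi>_semismooth_on UNIV_I, of "inverse ?n" "(x k, y k)" "(u k, 0)"] by (simp add: v_def)
    then have "\<Phi>' (x k, y k) (v k, 0) \<bullet> v k = (\<Phi>' (x k, y k) (u k, 0) \<bullet> u k) / ?n\<^sup>2"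
      by (simp add: v_def power2_eq_square divide_inverse)
    then show ?thesis using xyu(3)[of k] n by (simp add: divide_less_eq)
  qed
  define w1 where "w1 k = F (x k) + fst (y k) /\<^sub>R c" for k
  define w2 where "w2 k = snd (snd (y k)) - c *\<^sub>R g (x k)" for k
  have cF: "isCont F xbar" "isCont g xbar"
    using C2_continuous(1)[OF C2(2)] C2_continuous(1)[OF C2(4)] by (auto simp: continuous_on_eq_continuous_at)
  have wl: "w1 \<longlonglongrightarrow> F xbar + fst ybar /\<^sub>R c" "w2 \<longlonglongrightarrow> snd (snd ybar) - c *\<^sub>R g xbar"
    unfolding w1_def w2_def by (intro tendsto_intros xl yl cF[THEN isCont_tendsto_compose])+
  have "\<exists>V\<in>B_subdiff p (w1 k). dir_deriv p (w1 k) (Fderiv F (x k) (v k)) = V (Fderiv F (x k) (v k))" for k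
    by (rule dir_deriv_eq_B_subdiff[OF semismooth(1)])
  then obtain W1 where W1: "\<And>k. W1 k \<in> B_subdiff p (w1 k)"
    "\<And>k. dir_deriv p (w1 k) (Fderiv F (x k) (v k)) = W1 k (Fderiv F (x k) (v k))" by metis
  have "\<exists>V\<in>B_subdiff P (w2 k). dir_deriv P (w2 k) (- c *\<^sub>R Fderiv g (x k) (v k)) = V (- c *\<^sub>R Fderiv g (x k) (v k))" for k
    by (rule dir_deriv_eq_B_subdiff[OF semismooth(2)])
  then obtain W2 where W2: "\<And>k. W2 k \<in> B_subdiff P (w2 k)"
    "\<And>k. dir_deriv P (w2 k) (- c *\<^sub>R Fderiv g (x k) (v k)) = W2 k (- c *\<^sub>R Fderiv g (x k) (v k))" by metis
  have Qk: "Q (x k) (M (x k, y k)) (W1 k) (W2 k) (v k) < \<eta> / 2" for k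
    using v\<Phi>[of k] \<Phi>'_form[OF W1(2)[unfolded w1_def] W2(2)[unfolded w2_def]] by simp
  \<comment> \<open>Nested subsequences make the directions, then \<open>W1\<close>, then
    \<open>W2\<close> converge; \<open>\<phi>\<close> below is their composition.\<close>
  obtain vl \<phi>1 where \<phi>1: "strict_mono \<phi>1" "vl \<in> sphere 0 1" "(v \<circ> \<phi>1) \<longlonglongrightarrow> vl"
    using compact_sphere[of "0 :: real^'n" 1] v unfolding compact_def by metis
  obtain r1 C1 where r1: "r1 > 0" "C1-lipschitz_on (ball (F xbar + fst ybar /\<^sub>R c) r1) p"
    using semismooth_lipschitz[OF semismooth(1)] by blast
  obtain \<phi>2 W1l where \<phi>2: "strict_mono \<phi>2" "W1l \<in> B_subdiff p (F xbar + fst ybar /\<^sub>R c)"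
    "(\<lambda>k. (W1 \<circ> \<phi>1) (\<phi>2 k)) \<longlonglongrightarrow> W1l"
    by (rule B_subdiff_compactness[OF r1 LIMSEQ_subseq_LIMSEQ[OF wl(1) \<phi>1(1)], of "W1 \<circ> \<phi>1"]) (use W1(1) in auto)
  obtain r2 C2 where r2: "r2 > 0" "C2-lipschitz_on (ball (snd (snd ybar) - c *\<^sub>R g xbar) r2) P"
    using semismooth_lipschitz[OF semismooth(2)] by blast
  obtain \<phi>3 W2l where \<phi>3: "strict_mono \<phi>3" "W2l \<in> B_subdiff P (snd (snd ybar) - c *\<^sub>R g xbar)"
    "(\<lambda>k. (W2 \<circ> \<phi>1 \<circ> \<phi>2) (\<phi>3 k)) \<longlonglongrightarrow> W2l"
    by (rule B_subdiff_compactness[OF r2 LIMSEQ_subseq_LIMSEQ[OF LIMSEQ_subseq_LIMSEQ[OF wl(2) \<phi>1(1)] \<phi>2(1)], of "W2 \<circ> \<phi>1 \<circ> \<phi>2"])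
      (use W2(1) in auto)
  define \<phi> where "\<phi> = \<phi>1 \<circ> \<phi>2 \<circ> \<phi>3"
  have \<phi>: "strict_mono \<phi>" unfolding \<phi>_def by (intro strict_mono_o \<phi>1 \<phi>2 \<phi>3)
  have L: "(\<lambda>k. x (\<phi> k)) \<longlonglongrightarrow> xbar" "(\<lambda>k. y (\<phi> k)) \<longlonglongrightarrow> ybar"
    using LIMSEQ_subseq_LIMSEQ[OF xl \<phi>] LIMSEQ_subseq_LIMSEQ[OF yl \<phi>] by (simp_all add: o_def)
  have LW: "(\<lambda>k. W1 (\<phi> k)) \<longlonglongrightarrow> W1l" "(\<lambda>k. W2 (\<phi> k)) \<longlonglongrightarrow> W2l"
    using LIMSEQ_subseq_LIMSEQ[OF \<phi>2(3) \<phi>3(1)] \<phi>3(3) by (simp_all add: o_def \<phi>_def)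
  have Lv: "(\<lambda>k. v (\<phi> k)) \<longlonglongrightarrow> vl"
    using LIMSEQ_subseq_LIMSEQ[OF LIMSEQ_subseq_LIMSEQ[OF \<phi>1(3) \<phi>2(1)] \<phi>3(1)] by (simp add: o_def \<phi>_def)
  \<comment> \<open>The form \<open>Q\<close> contains updated multipliers; they tend to
    \<open>ybar\<close> because the update is continuous and fixes \<open>ybar\<close> at
    \<open>xbar\<close>.\<close>
  have "(\<lambda>k. M (x (\<phi> k), y (\<phi> k))) \<longlonglongrightarrow> M (xbar, ybar)"
    by (intro isCont_tendsto_compose[OF semismooth_on_continuous[OF M_semismooth_on UNIV_I]] tendsto_intros L)
  then have "(\<lambda>k. Q (x (\<phi> k)) (M (x (\<phi> k), y (\<phi> k))) (W1 (\<phi> k)) (W2 (\<phi> k)) (v (\<phi> k))) \<longlonglongrightarrow> Q xbar ybar W1l W2l vl"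
    unfolding M_bar by (intro tendsto_Q L LW Lv)
  then have "Q xbar ybar W1l W2l vl \<le> \<eta> / 2"
    by (rule LIMSEQ_le_const2) (use Qk in \<open>auto intro: less_imp_le\<close>)
  moreover have "\<eta> * (vl \<bullet> vl) \<le> Q xbar ybar W1l W2l vl"
    using B1[of W1l W2l vl] \<phi>2(2) \<phi>3(2) unfolding W_sets A_op_form by blast
  moreover have "vl \<bullet> vl = 1" using \<phi>1(2) by (simp add: dot_square_norm)
  ultimately show False using \<eta> by simp
qed

end

section \<open>First-order estimates for the minimizer and the multiplier update\<close>

context augmented_problem
begin

text \<open>\<open>W1\<close> and \<open>W2\<close> are chosen to represent the two directional
  derivatives in the directions at hand. The pair depends on \<open>(u, d)\<close>, but B2 bounds
  the form of every pair with the same \<open>m\<close>, so the nonlinearity of \<open>M'\<close>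
  does no harm.\<close>

lemma multiplier_update_deriv_norm_le:
  assumes \<eta>: "\<eta> > 0"
    and B1: "\<And>W1 W2 d. W1 \<in> W1_set F \<theta> xbar ybar c \<Longrightarrow> W2 \<in> W2_set g K xbar ybar c \<Longrightarrow>
      d \<bullet> A_op f F h g xbar ybar c W1 W2 d \<ge> \<eta> * (d \<bullet> d)"
    and form: "\<And>dy v. v \<in> V_set f F h g \<theta> K xbar ybar c dy \<Longrightarrow> \<bar>(v + dy /\<^sub>R c) \<bullet> dy\<bar> \<le> m * (norm dy)\<^sup>2"
    and zero: "\<Phi>' (xbar, ybar) (u, d) = 0"
  shows "norm (M' (xbar, ybar) (u, d)) \<le> c * m * norm d"
proof -
  let ?w1 = "F xbar + fst ybar /\<^sub>R c" and ?w2 = "snd (snd ybar) - c *\<^sub>R g xbar"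
  let ?e1 = "Fderiv F xbar u + fst d /\<^sub>R c" and ?e2 = "snd (snd d) - c *\<^sub>R Fderiv g xbar u"
  obtain W1 where W1: "W1 \<in> B_subdiff p ?w1" "dir_deriv p ?w1 ?e1 = W1 ?e1"
    using dir_deriv_eq_B_subdiff[OF semismooth(1)] by blast
  obtain W2 where W2: "W2 \<in> B_subdiff P ?w2" "dir_deriv P ?w2 ?e2 = W2 ?e2"
    using dir_deriv_eq_B_subdiff[OF semismooth(2)] by blast
  have W: "W1 \<in> W1_set F \<theta> xbar ybar c" "W2 \<in> W2_set g K xbar ybar c"
    using W1(1) W2(1) by (simp_all only: W_sets)
  have form': "\<bar>(V_vec f F h g xbar ybar c W1 W2 dy + dy /\<^sub>R c) \<bullet> dy\<bar> \<le> m * (norm dy)\<^sup>2" for dy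
    by (rule form) (use W in \<open>auto simp: V_set_def\<close>)
  note V = V_vec_norm_le[OF W_selfadjoint(1)[OF W1(1)] W_selfadjoint(2)[OF W2(1)] \<eta> B1[OF W] form']
  have eq: "M' (xbar, ybar) (u, d) = (blinfun_apply W1 ?e1, fst (snd d) + c *\<^sub>R Fderiv h xbar u, blinfun_apply W2 ?e2)"
    by (simp add: M'_def W1(2) W2(2))
  have "Lagr_gradient_deriv (xbar, ybar) (u, M' (xbar, ybar) (u, d)) = 0" using zero by (simp add: \<Phi>'_def M_bar)
  from V_vec_of_linearized_solution[OF V(1) c eq this]
  have "norm (M' (xbar, ybar) (u, d)) = c * norm (V_vec f F h g xbar ybar c W1 W2 d + d /\<^sub>R c)"
    using c by simp
  also have "\<dots> \<le> c * (m * norm d)" using V(2) c by (intro mult_left_mono) auto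
  finally show ?thesis by simp
qed

text \<open>\<open>a\<close> and \<open>c * m\<close> bound the linearizations of the minimizer and
  of the update at \<open>ybar\<close>. The second \<open>a\<close> and the summand \<open>b\<close>
  absorb the o(d) remainders, so their size determines the radius \<open>\<delta>\<close>.\<close>

lemma local_convergence:
  assumes \<eta>: "\<eta> > 0"
    and B1: "\<And>W1 W2 d. W1 \<in> W1_set F \<theta> xbar ybar c \<Longrightarrow> W2 \<in> W2_set g K xbar ybar c \<Longrightarrow>
      d \<bullet> A_op f F h g xbar ybar c W1 W2 d \<ge> \<eta> * (d \<bullet> d)"
    and dX: "\<And>X dy. implicit_solution f F h g \<theta> K xbar ybar c X \<Longrightarrow> norm (dir_deriv X ybar dy) \<le> a * norm dy"
    and form: "\<And>dy v. v \<in> V_set f F h g \<theta> K xbar ybar c dy \<Longrightarrow> \<bar>(v + dy /\<^sub>R c) \<bullet> dy\<bar> \<le> m * (norm dy)\<^sup>2"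
    and ab: "a > 0" "b > 0"
  shows "\<exists>\<epsilon>>0. \<exists>\<delta>>0. \<exists>X.
    (\<forall>y\<in>ball ybar \<delta>. {x. is_arg_min (\<lambda>x. aug_Lagr f F h g \<theta> K c x y) (\<lambda>x. x \<in> ball xbar \<epsilon>) x} = {X y}) \<and>
    locally_lipschitz_on (ball ybar \<delta>) X \<and>
    (\<forall>y\<in>ball ybar \<delta>. semismooth_at X y) \<and>
    (\<forall>y\<in>ball ybar \<delta>. norm (X y - xbar) \<le> 2 * a * norm (y - ybar)) \<and>
    (\<forall>y\<in>ball ybar \<delta>. norm (mult_update F h g \<theta> K c (X y) y - ybar) \<le> (c * m + b) * norm (y - ybar))"
proof -
  obtain r where r: "r > 0" "\<And>x y u. x \<in> ball xbar r \<Longrightarrow> y \<in> ball ybar r \<Longrightarrow> \<eta> / 2 * (norm u)\<^sup>2 \<le> \<Phi>' (x, y) (u, 0) \<bullet> u"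
    using \<Phi>'_coercive[OF \<eta> B1] by blast
  have "\<eta> / 2 > 0" using \<eta> by simp
  from semismooth_on_local_minimizer_map[where \<phi>="\<lambda>x y. aug_Lagr f F h g \<theta> K c x y", OF aug_Lagr_has_derivative \<Phi>_semismooth_on \<Phi>_bar this r]
  obtain \<epsilon> \<delta>0 X X' where X: "\<epsilon> > 0" "\<delta>0 > 0" "X ybar = xbar"
    "\<And>y. y \<in> ball ybar \<delta>0 \<Longrightarrow> {x. is_arg_min (\<lambda>x. aug_Lagr f F h g \<theta> K c x y) (\<lambda>x. x \<in> ball xbar \<epsilon>) x} = {X y}"
    "\<And>y. y \<in> ball ybar \<delta>0 \<Longrightarrow> \<Phi> (X y, y) = 0"
    "semismooth_on (ball ybar \<delta>0) X X'" "\<And>y d. y \<in> ball ybar \<delta>0 \<Longrightarrow> \<Phi>' (X y, y) (X' y d, d) = 0" by blast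
  have yb: "ybar \<in> ball ybar \<delta>0" using X(2) by simp
  have LL: "locally_lipschitz_on S X" if "S \<subseteq> ball ybar \<delta>0" for S
    unfolding locally_lipschitz_on_def
  proof
    fix y assume "y \<in> S"
    then obtain s C where "s > 0" "C-lipschitz_on (ball y s) X" using semismooth_on_lipschitz[OF X(6)] \<open>S \<subseteq> _\<close> by blast
    then show "\<exists>s>0. \<exists>C. C-lipschitz_on (ball y s \<inter> S) X" by (meson inf_le1 lipschitz_on_subset)
  qed
  have hd: "has_dir_deriv X y d (X' y d)" if "y \<in> ball ybar \<delta>0" for y d
    by (rule semismooth_on_has_dir_deriv[OF X(6) that])
  \<comment> \<open>B2 quantifies over implicit solutions; its first half becomes available once the
    minimizer map is one of them.\<close>
  have "implicit_solution f F h g \<theta> K xbar ybar c X"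
    unfolding implicit_solution_def
  proof (intro conjI X(3) exI[of _ "ball ybar \<delta>0"] ballI)
    fix y assume y: "y \<in> ball ybar \<delta>0"
    show "dir_differentiable X y" unfolding dir_differentiable_def using hd[OF y] by blast
    show "grad (\<lambda>x. aug_Lagr f F h g \<theta> K c x y) (X y) = 0"
      using grad_eqI[OF aug_Lagr_has_derivative] X(5)[OF y] by simp
  qed (use yb LL in auto)
  from dX[OF this] have X'le: "norm (X' ybar d) \<le> a * norm d" for d
    using dir_deriv_eq[OF hd[OF yb]] by simp
  have M'le: "norm (M' (xbar, ybar) (X' ybar d, d)) \<le> c * m * norm d" for d
    by (rule multiplier_update_deriv_norm_le[OF \<eta> B1 form]) (use X(7)[OF yb] X(3) in auto)
  have "semismooth_on (ball ybar \<delta>0) (\<lambda>y. y) (\<lambda>y d. d)"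
    using semismooth_on_bounded_linear[OF bounded_linear_ident] by (auto simp: semismooth_on_def)
  from semismooth_on_compose_UNIV[OF semismooth_on_Pair[OF X(6) this] M_semismooth_on]
  have "semismooth_on (ball ybar \<delta>0) (\<lambda>y. M (X y, y)) (\<lambda>y d. M' (X y, y) (X' y d, d))" .
  \<comment> \<open>The update fixes \<open>ybar\<close> at \<open>xbar\<close>, so the expansion at
    \<open>ybar\<close> has constant term \<open>ybar\<close> and measures the error of the new
    multiplier.\<close>
  note M = semismooth_on_bdiff[OF this yb, unfolded X(3) M_bar]
  have "\<forall>\<^sub>F d in nhds 0. norm (X (ybar + d) - xbar) \<le> 2 * a * norm d \<and>
      norm (M (X (ybar + d), ybar + d) - ybar) \<le> (c * m + b) * norm d"
    using little_oD[OF semismooth_on_bdiff[OF X(6) yb, unfolded X(3)] ab(1)] little_oD[OF M ab(2)]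
  proof eventually_elim
    case (elim d)
    show ?case
      using elim X'le[of d] M'le[of d] norm_triangle_sub[of "X (ybar + d) - xbar" "X' ybar d"]
        norm_triangle_sub[of "M (X (ybar + d), ybar + d) - ybar" "M' (xbar, ybar) (X' ybar d, d)"]
      by (simp add: distrib_right)
  qed
  then obtain s where s: "s > 0" "\<And>d. norm d < s \<Longrightarrow> norm (X (ybar + d) - xbar) \<le> 2 * a * norm d \<and>
      norm (M (X (ybar + d), ybar + d) - ybar) \<le> (c * m + b) * norm d"
    by (auto simp: eventually_nhds_metric)
  define \<delta> where "\<delta> = min \<delta>0 s"
  have \<delta>: "\<delta> > 0" "ball ybar \<delta> \<subseteq> ball ybar \<delta>0" using X(2) s(1) by (auto simp: \<delta>_def)
  have est: "norm (X y - xbar) \<le> 2 * a * norm (y - ybar) \<and>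
      norm (mult_update F h g \<theta> K c (X y) y - ybar) \<le> (c * m + b) * norm (y - ybar)" if "y \<in> ball ybar \<delta>" for y
    using s(2)[of "y - ybar"] that by (simp add: \<delta>_def dist_norm norm_minus_commute M_def)
  show ?thesis
    by (intro exI[of _ \<epsilon>] exI[of _ \<delta>] exI[of _ X] conjI X(1) \<delta>(1) ballI LL[OF \<delta>(2)])
      (use \<delta>(2) X(4) est semismooth_on_imp_semismooth_at[OF X(6)] in blast)+
qed

end

theorem theorem2p1:
  fixes f :: "real^'n \<Rightarrow> real"
    and F :: "real^'n \<Rightarrow> 'z::euclidean_space"
    and h :: "real^'n \<Rightarrow> real^'m"
    and g :: "real^'n \<Rightarrow> 'y::euclidean_space"
    and \<theta> :: "'z \<Rightarrow> ereal"
    and K :: "'y set"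
    and xbar :: "real^'n"
    and ybar :: "'z \<times> (real^'m) \<times> 'y"
    and c0 \<eta> cbar \<mu>0 \<rho>0 \<gamma> \<rho>1 \<rho>2 :: real
  assumes "C2 f" and "C2 F" and "C2 h" and "C2 g"
    and "proper_fun \<theta>" and "lsc_fun \<theta>" and "convex_fun \<theta>"
    and "K \<noteq> {}" and "closed K" and "convex K" and "cone K"
    and "\<forall>c>0. \<forall>Z. semismooth_at (Fderiv (theta_c \<theta> c)) Z"
    and "\<forall>w. semismooth_at (closest_point (dual_cone K)) w"
    and "stationary f F h g \<theta> K xbar"
    and "ybar \<in> multipliers f F h g \<theta> K xbar"
    and "B1 f F h g \<theta> K xbar ybar c0 \<eta>"
    and "B2 f F h g \<theta> K xbar ybar c0 cbar \<mu>0 \<rho>0 \<gamma>"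
    and "\<rho>1 = 2 * \<rho>0" and "\<rho>2 = 4 * \<mu>0"
  shows "\<forall>c\<ge>cbar. \<exists>\<epsilon>>0. \<exists>\<delta>>0. \<exists>x_c :: 'z \<times> (real^'m) \<times> 'y \<Rightarrow> real^'n.
    (\<forall>y\<in>ball ybar \<delta>.
       {x. is_arg_min (\<lambda>x. aug_Lagr f F h g \<theta> K c x y) (\<lambda>x. x \<in> ball xbar \<epsilon>) x} = {x_c y}) \<and>
    locally_lipschitz_on (ball ybar \<delta>) x_c \<and>
    (\<forall>y\<in>ball ybar \<delta>. semismooth_at x_c y) \<and>
    (\<forall>y\<in>ball ybar \<delta>. norm (x_c y - xbar) \<le> \<rho>1 * norm (y - ybar) / c) \<and>
    (\<forall>y\<in>ball ybar \<delta>.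
       norm (mult_update F h g \<theta> K c (x_c y) y - ybar) \<le> \<rho>2 * norm (y - ybar) / c powr (\<gamma> - 1))"
proof (intro allI impI)
  fix c assume c: "c \<ge> cbar"
  have B1: "c0 > 0" "\<eta> > 0" "\<And>c W1 W2 d. c \<ge> c0 \<Longrightarrow> W1 \<in> W1_set F \<theta> xbar ybar c \<Longrightarrow> W2 \<in> W2_set g K xbar ybar c \<Longrightarrow>
      d \<bullet> A_op f F h g xbar ybar c W1 W2 d \<ge> \<eta> * (d \<bullet> d)"
    using \<open>B1 f F h g \<theta> K xbar ybar c0 \<eta>\<close> unfolding B1_def by blast+
  have B2: "cbar \<ge> c0" "\<mu>0 > 0" "\<rho>0 > 0"
    "\<And>X dy. implicit_solution f F h g \<theta> K xbar ybar c X \<Longrightarrow> norm (dir_deriv X ybar dy) \<le> \<rho>0 * norm dy / c"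
    "\<And>v dy. v \<in> V_set f F h g \<theta> K xbar ybar c dy \<Longrightarrow> \<bar>(v + dy /\<^sub>R c) \<bullet> dy\<bar> \<le> \<mu>0 * (norm dy)\<^sup>2 / c powr \<gamma>"
    using \<open>B2 f F h g \<theta> K xbar ybar c0 cbar \<mu>0 \<rho>0 \<gamma>\<close> c unfolding B2_def by blast+
  have c0: "c \<ge> c0" "c > 0" using B1(1) B2(1) c by auto
  \<comment> \<open>Feasibility excludes plus infinity, properness minus infinity.\<close>
  have "\<bar>\<theta> (F xbar)\<bar> \<noteq> \<infinity>"
    using \<open>stationary f F h g \<theta> K xbar\<close> \<open>proper_fun \<theta>\<close> unfolding stationary_def proper_fun_def by auto
  then interpret augmented_problem f F h g \<theta> K c xbar ybar
    using assms c0(2) by unfold_locales auto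
  \<comment> \<open>\<open>c * ?m\<close> equals \<open>\<mu>0 / c powr (\<gamma> - 1)\<close>; the
    remainder allowance \<open>?b\<close> is three more such units, which gives
    \<open>\<rho>2 = 4 * \<mu>0\<close>.\<close>
  let ?m = "\<mu>0 / c powr \<gamma>" and ?b = "3 * \<mu>0 / c powr (\<gamma> - 1)"
  have m: "c * ?m + ?b = \<rho>2 / c powr (\<gamma> - 1)"
    using c0(2) \<open>\<rho>2 = 4 * \<mu>0\<close> by (simp add: powr_diff field_simps)
  have a: "2 * (\<rho>0 / c) = \<rho>1 / c" using \<open>\<rho>1 = 2 * \<rho>0\<close> by simp
  have 1: "norm (dir_deriv X ybar dy) \<le> \<rho>0 / c * norm dy"
    if "implicit_solution f F h g \<theta> K xbar ybar c X" for X dy using B2(4)[OF that] by simp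
  have 2: "\<bar>(v + dy /\<^sub>R c) \<bullet> dy\<bar> \<le> ?m * (norm dy)\<^sup>2" if "v \<in> V_set f F h g \<theta> K xbar ybar c dy" for v dy
    using B2(5)[OF that] by simp
  have 3: "\<rho>0 / c > 0" "?b > 0" using B2(2,3) c0(2) by simp_all
  from local_convergence[OF B1(2) B1(3)[OF c0(1)] 1 2 3]
  show "\<exists>\<epsilon>>0. \<exists>\<delta>>0. \<exists>x_c :: 'z \<times> (real^'m) \<times> 'y \<Rightarrow> real^'n.
    (\<forall>y\<in>ball ybar \<delta>.
       {x. is_arg_min (\<lambda>x. aug_Lagr f F h g \<theta> K c x y) (\<lambda>x. x \<in> ball xbar \<epsilon>) x} = {x_c y}) \<and>
    locally_lipschitz_on (ball ybar \<delta>) x_c \<and>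
    (\<forall>y\<in>ball ybar \<delta>. semismooth_at x_c y) \<and>
    (\<forall>y\<in>ball ybar \<delta>. norm (x_c y - xbar) \<le> \<rho>1 * norm (y - ybar) / c) \<and>
    (\<forall>y\<in>ball ybar \<delta>.
       norm (mult_update F h g \<theta> K c (x_c y) y - ybar) \<le> \<rho>2 * norm (y - ybar) / c powr (\<gamma> - 1))"
    unfolding m a times_divide_eq_left .
qed

end
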